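(* Let $k$ be a field of characteristic $0$ and let $\mathcal I$ be an ideal of $k\langle X\rangle$, $X=\{X_1,\dots,X_g\}$. (a) If $\mathcal I$ is frr with rational resolvent $r$ (with respect to a decomposition $X=X'\cup X''$) and the coproduct of $k\langle X\rangle/\mathcal I$ and $k(\!\langle X'\rangle\!)_{h(r)}$ over $k\langle X'\rangle$ is faithful, then $\mathcal I$ is grr and satisfies the Nullstellensatz property. (b) If $\mathcal I$ is grr and satisfies the Nullstellensatz property, then $k\langle X\rangle/\mathcal I$ embeds into a free skew field.
   Context: $k\langle X\rangle$ is the free associative unital algebra over $k$ in the freely noncommuting variables $X_1,\dots,X_g$; "ideal" means two-sided ideal. For an ideal $\mathcal I\subset k\langle X\rangle$ put $Z(\mathcal I)=\bigcup_{n\in\mathbb N}\{A\in M_n(k)^g : h(A)=0\ \text{for all } h\in\mathcal I\}$. The ideal $\mathcal I$ has the Nullstellensatz property if for each $f\in k\langle X\rangle$: $f\in\mathcal I$ if and only if $f|_{Z(\mathcal I)}=0$. Free skew field. An nc rational expression in $X$ is a formal expression built from elements of $k\langle X\rangle$ using addition, multiplication and inversion; its domain $\operatorname{dom} r$ is the set of all $g$-tuples of square matrices over $k$ (of all sizes $n$) at which all the inverses occurring in $r$ exist. Only expressions with nonempty domain are considered. Expressions $r_1,r_2$ are equivalent if $r_1(A)=r_2(A)$ for all $A\in\operatorname{dom} r_1\cap\operatorname{dom} r_2$; equivalence classes are called (nc) rational functions, and they form a skew field $k(\!\langle X\rangle\!)$, the free skew field. The domain of a rational function consists of the tuples at which some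 expression representing it is defined. The height of an expression is the maximal number of nested inverses in it; the height of a rational function is the minimum of heights of the expressions representing it. $k(\!\langle X\rangle\!)_h$ is the subring of rational functions of height at most $h$; for a tuple $r$ of rational functions, $h(r)$ is the maximum of the heights of its components. Rational resolvability. Fix a partition $X=X'\cup X''=\{X'_1,\dots,X'_{g'}\}\cup\{X''_1,\dots,X''_{g''}\}$ (a decomposition of $X$) and a tuple $r=(r_1,\dots,r_{g''})$ with $r_j\in k(\!\langle X'\rangle\!)$. Let $\operatorname{dom} r\subset\bigcup_nM_n(k)^{g'}$ be the common domain of the $r_j$ and $\Gamma(r)=\{(A,r(A)): A\in\operatorname{dom} r\}\subset\bigcup_nM_n(k)^g$ the graph of $r$. Let $R_r$ be the subring of $k(\!\langle X\rangle\!)$ generated by $k(\!\langle X'\rangle\!)_{h(r)}$ and $k\langle X\rangle$, and let $\mathcal I_r$ be the ideal of $R_r$ generated by $\{X''_j-r_j(X')\}_j$. An ideal $\mathcal I\subset k\langle X\rangle$ is formally rationally resolvable (frr) with respect to the decomposition and $r$ if $\mathcal I\cap k\langle X'\rangle=0$ and $\mathcal I$ generates $\mathcal I_r$ as an ideal in $R_r$. It is geometrically rationally resolvable (grr) with respect to the decomposition and $r$ if $\Gamma(r)\subseteq Z(\mathcal I)$ and every polynomial in $k\langle X\rangle$ that vanishes on $\Gamma(r)$ also vanishes on $Z(\mathcal I)$. In both cases $r$ is called the rational resolvent of $\mathcal I$; $\mathcal I$ is called frr (grr) if it is so for some decomposition and some $r$. Coproduct. If $S$ is a subring of rings $R_1$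 and $R_2$, the coproduct $R_1*_SR_2$ is the pushout of $R_1$ and $R_2$ over $S$ in the category of rings; it is faithful if the canonical maps $R_1\to R_1*_SR_2$ and $R_2\to R_1*_SR_2$ are injective. When $\mathcal I\cap k\langle X'\rangle=0$, $k\langle X'\rangle$ is regarded as a subring of both $k\langle X\rangle/\mathcal I$ and $k(\!\langle X'\rangle\!)_{h(r)}$. *)

theory Defs
  imports
    "HOL-Library.Poly_Mapping"
    "HOL-Library.FuncSet"
    "HOL-Algebra.QuotRing"
    "HOL-Algebra.Generated_Rings"
    "Jordan_Normal_Form.Matrix"
begin

hide_const (open) Multiset.mult

section \<open>Free algebras\<close>

datatype 'x ncword = Word (letters: "'x list")

instantiation ncword :: (type) monoid_add
begin

definition zero_ncword :: "'a ncword" where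
  "0 = Word []"

definition plus_ncword :: "'a ncword \<Rightarrow> 'a ncword \<Rightarrow> 'a ncword" where
  "v + w = Word (letters v @ letters w)"

instance
  by standard (simp_all add: zero_ncword_def plus_ncword_def)

end

text \<open>
  Since the monoid \<^typ>\<open>'x ncword\<close> is written additively, the convolution product of finitely
  supported functions on it is the product of noncommutative polynomials.
\<close>

type_synonym ('x, 'c) ncpoly = "'x ncword \<Rightarrow>\<^sub>0 'c"

definition ncvar :: "'x \<Rightarrow> ('x, 'c::comm_ring_1) ncpoly" where
  "ncvar x = Poly_Mapping.single (Word [x]) 1"

definition ncconst :: "'c::comm_ring_1 \<Rightarrow> ('x, 'c) ncpoly" where
  "ncconst c = Poly_Mapping.single 0 c"

definition ncpolys :: "'x set \<Rightarrow> ('x, 'c::comm_ring_1) ncpoly set" where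
  "ncpolys V = {p. \<forall>w \<in> Poly_Mapping.keys p. set (letters w) \<subseteq> V}"

definition free_algebra :: "'x set \<Rightarrow> ('x, 'c::comm_ring_1) ncpoly ring" where
  "free_algebra V = \<lparr>carrier = ncpolys V, mult = (*), one = 1, zero = 0, add = (+)\<rparr>"

lemma zero_in_ncpolys: "0 \<in> ncpolys V"
  by (simp add: ncpolys_def)

lemma one_in_ncpolys: "1 \<in> ncpolys V"
  by (auto simp: ncpolys_def zero_ncword_def)

lemma add_in_ncpolys: "p \<in> ncpolys V \<Longrightarrow> q \<in> ncpolys V \<Longrightarrow> p + q \<in> ncpolys V"
  using keys_add[of p q] by (fastforce simp: ncpolys_def)

lemma uminus_in_ncpolys: "p \<in> ncpolys V \<Longrightarrow> - p \<in> ncpolys V"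
  by (auto simp: ncpolys_def in_keys_iff)

lemma mult_in_ncpolys: "p \<in> ncpolys V \<Longrightarrow> q \<in> ncpolys V \<Longrightarrow> p * q \<in> ncpolys V"
  using keys_mult[of p q] by (fastforce simp: ncpolys_def plus_ncword_def)

lemma ncvar_in_ncpolys: "x \<in> V \<Longrightarrow> ncvar x \<in> ncpolys V"
  by (auto simp: ncpolys_def ncvar_def in_keys_iff lookup_single when_def)

lemma ring_free_algebra: "ring (free_algebra V)"
proof (rule ringI)
  show "abelian_group (free_algebra V)"
    by (rule abelian_groupI)
      (auto simp: free_algebra_def zero_in_ncpolys add_in_ncpolys algebra_simps
        intro: bexI[OF _ uminus_in_ncpolys])
  show "Group.monoid (free_algebra V)"
    by (rule monoidI) (auto simp: free_algebra_def one_in_ncpolys mult_in_ncpolys mult.assoc)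
qed (auto simp: free_algebra_def algebra_simps)

lemma free_algebra_minus:
  assumes "p \<in> ncpolys V" "q \<in> ncpolys V"
  shows "p \<ominus>\<^bsub>free_algebra V\<^esub> q = p - q"
proof -
  interpret ring "free_algebra V" by (rule ring_free_algebra)
  have "\<ominus>\<^bsub>free_algebra V\<^esub> q = - q"
    by (rule minus_equality) (use assms in \<open>auto simp: free_algebra_def uminus_in_ncpolys\<close>)
  then show ?thesis by (simp add: a_minus_def free_algebra_def)
qed


section \<open>Evaluation at tuples of matrices\<close>

text \<open>
  A tuple of \<open>n \<times> n\<close> matrices indexed by \<open>V\<close> carries its size \<open>n\<close> explicitly, because for
  \<open>V = {}\<close> the tuple alone does not determine it. Sizes are positive: over the zero ring of
  \<open>0 \<times> 0\<close> matrices every expression would be defined.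
\<close>

type_synonym ('x, 'k) ncpoint = "nat \<times> ('x \<Rightarrow> 'k mat)"

definition ncpoints :: "'x set \<Rightarrow> ('x, 'k) ncpoint set" where
  "ncpoints V = {(n, A). 0 < n \<and> A \<in> V \<rightarrow>\<^sub>E carrier_mat n n}"

abbreviation matring :: "nat \<Rightarrow> 'k::field mat ring" where
  "matring n \<equiv> ring_mat TYPE('k) n ()"

definition word_eval :: "nat \<Rightarrow> ('x \<Rightarrow> 'k::field mat) \<Rightarrow> 'x ncword \<Rightarrow> 'k mat" where
  "word_eval n A w = foldr (\<lambda>x M. A x * M) (letters w) (1\<^sub>m n)"

definition poly_eval :: "nat \<Rightarrow> ('x \<Rightarrow> 'k::field mat) \<Rightarrow> ('x, 'k) ncpoly \<Rightarrow> 'k mat" where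
  "poly_eval n A p =
     (\<Oplus>\<^bsub>matring n\<^esub> w \<in> Poly_Mapping.keys p. Poly_Mapping.lookup p w \<cdot>\<^sub>m word_eval n A w)"

definition vanishes_on :: "('x, 'k::field) ncpoly \<Rightarrow> ('x, 'k) ncpoint set \<Rightarrow> bool" where
  "vanishes_on f S \<longleftrightarrow> (\<forall>(n, A) \<in> S. poly_eval n A f = 0\<^sub>m n n)"

definition zero_locus :: "'x set \<Rightarrow> ('x, 'k::field) ncpoly set \<Rightarrow> ('x, 'k) ncpoint set" where
  "zero_locus X I = {(n, A) \<in> ncpoints X. \<forall>h \<in> I. poly_eval n A h = 0\<^sub>m n n}"

definition nullstellensatz_property :: "'x set \<Rightarrow> ('x, 'k::field) ncpoly set \<Rightarrow> bool" where
  "nullstellensatz_property X I \<longleftrightarrow>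
     (\<forall>f \<in> ncpolys X. f \<in> I \<longleftrightarrow> vanishes_on f (zero_locus X I))"


section \<open>Rational expressions\<close>

context
  notes [[typedef_overloaded]]
begin

datatype ('x, 'k) ratexpr =
    Poly "('x, 'k) ncpoly"
  | Add "('x, 'k) ratexpr" "('x, 'k) ratexpr"
  | Mul "('x, 'k) ratexpr" "('x, 'k) ratexpr"
  | Inv "('x, 'k) ratexpr"

end

primrec expr_over :: "'x set \<Rightarrow> ('x, 'k::field) ratexpr \<Rightarrow> bool" where
  "expr_over V (Poly p) \<longleftrightarrow> p \<in> ncpolys V"
| "expr_over V (Add a b) \<longleftrightarrow> expr_over V a \<and> expr_over V b"
| "expr_over V (Mul a b) \<longleftrightarrow> expr_over V a \<and> expr_over V b"
| "expr_over V (Inv a) \<longleftrightarrow> expr_over V a"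

primrec expr_height :: "('x, 'k) ratexpr \<Rightarrow> nat" where
  "expr_height (Poly p) = 0"
| "expr_height (Add a b) = max (expr_height a) (expr_height b)"
| "expr_height (Mul a b) = max (expr_height a) (expr_height b)"
| "expr_height (Inv a) = Suc (expr_height a)"

primrec expr_eval :: "nat \<Rightarrow> ('x \<Rightarrow> 'k::field mat) \<Rightarrow> ('x, 'k) ratexpr \<Rightarrow> 'k mat" where
  "expr_eval n A (Poly p) = poly_eval n A p"
| "expr_eval n A (Add a b) = expr_eval n A a + expr_eval n A b"
| "expr_eval n A (Mul a b) = expr_eval n A a * expr_eval n A b"
| "expr_eval n A (Inv a) = inv\<^bsub>matring n\<^esub> (expr_eval n A a)"

primrec expr_defined :: "nat \<Rightarrow> ('x \<Rightarrow> 'k::field mat) \<Rightarrow> ('x, 'k) ratexpr \<Rightarrow> bool" where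
  "expr_defined n A (Poly p) \<longleftrightarrow> True"
| "expr_defined n A (Add a b) \<longleftrightarrow> expr_defined n A a \<and> expr_defined n A b"
| "expr_defined n A (Mul a b) \<longleftrightarrow> expr_defined n A a \<and> expr_defined n A b"
| "expr_defined n A (Inv a) \<longleftrightarrow> expr_defined n A a \<and> expr_eval n A a \<in> Units (matring n)"

definition expr_dom :: "'x set \<Rightarrow> ('x, 'k::field) ratexpr \<Rightarrow> ('x, 'k) ncpoint set" where
  "expr_dom V e = {(n, A) \<in> ncpoints V. expr_defined n A e}"

definition ratexprs :: "'x set \<Rightarrow> ('x, 'k::field) ratexpr set" where
  "ratexprs V = {e. expr_over V e \<and> expr_dom V e \<noteq> {}}"


section \<open>The free skew field\<close>

definition rat_equiv :: "'x set \<Rightarrow> (('x, 'k::field) ratexpr \<times> ('x, 'k) ratexpr) set" where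
  "rat_equiv V = {(a, b). a \<in> ratexprs V \<and> b \<in> ratexprs V \<and>
     (\<forall>(n, A) \<in> expr_dom V a \<inter> expr_dom V b. expr_eval n A a = expr_eval n A b)}"

type_synonym ('x, 'k) ratfun = "('x, 'k) ratexpr set"

definition free_skew_field :: "'x set \<Rightarrow> ('x, 'k::field) ratfun ring" where
  "free_skew_field V =
     \<lparr>carrier = ratexprs V // rat_equiv V,
      mult = (\<lambda>F G. \<Union>a \<in> F. \<Union>b \<in> G. rat_equiv V `` {Mul a b}),
      one = rat_equiv V `` {Poly 1},
      zero = rat_equiv V `` {Poly 0},
      add = (\<lambda>F G. \<Union>a \<in> F. \<Union>b \<in> G. rat_equiv V `` {Add a b})\<rparr>"

definition poly_ratfun :: "'x set \<Rightarrow> ('x, 'k::field) ncpoly \<Rightarrow> ('x, 'k) ratfun" where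
  "poly_ratfun V p = rat_equiv V `` {Poly p}"

definition ratfun_dom :: "'x set \<Rightarrow> ('x, 'k::field) ratfun \<Rightarrow> ('x, 'k) ncpoint set" where
  "ratfun_dom V F = (\<Union>e \<in> F. expr_dom V e)"

definition ratfun_eval ::
  "'x set \<Rightarrow> ('x, 'k::field) ratfun \<Rightarrow> nat \<Rightarrow> ('x \<Rightarrow> 'k mat) \<Rightarrow> 'k mat" where
  "ratfun_eval V F n A = (THE M. \<exists>e \<in> F. (n, A) \<in> expr_dom V e \<and> M = expr_eval n A e)"

definition ratfun_height :: "('x, 'k) ratfun \<Rightarrow> nat" where
  "ratfun_height F = (LEAST h. \<exists>e \<in> F. expr_height e = h)"

definition free_skew_field_height :: "'x set \<Rightarrow> nat \<Rightarrow> ('x, 'k::field) ratfun ring" where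
  "free_skew_field_height V h =
     (free_skew_field V)
       \<lparr>carrier := {F \<in> carrier (free_skew_field V). ratfun_height F \<le> h}\<rparr>"

text \<open>
  For \<open>V \<subseteq> X\<close>, a class of expressions over \<open>V\<close> is contained in a single class of expressions
  over \<open>X\<close>; this is the inclusion of the free skew field on \<open>V\<close> into the one on \<open>X\<close>.
\<close>

definition ratfun_incl :: "'x set \<Rightarrow> ('x, 'k::field) ratfun \<Rightarrow> ('x, 'k) ratfun" where
  "ratfun_incl X F = rat_equiv X `` F"


section \<open>Rational resolvability\<close>

text \<open>
  In the following, a decomposition of the set \<open>X\<close> of variables is given by the subset \<open>X'\<close>, the
  other part being \<open>X - X'\<close>, and the tuple \<open>r\<close> is indexed by the variables in \<open>X - X'\<close>; its
  values elsewhere are irrelevant.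
\<close>

definition resolvent_data :: "'x set \<Rightarrow> 'x set \<Rightarrow> ('x \<Rightarrow> ('x, 'k::field) ratfun) \<Rightarrow> bool" where
  "resolvent_data X X' r \<longleftrightarrow>
     X' \<subseteq> X \<and> (\<forall>j \<in> X - X'. r j \<in> carrier (free_skew_field X'))"

definition tuple_height :: "'x set \<Rightarrow> 'x set \<Rightarrow> ('x \<Rightarrow> ('x, 'k) ratfun) \<Rightarrow> nat" where
  "tuple_height X X' r = Max (insert 0 ((\<lambda>j. ratfun_height (r j)) ` (X - X')))"

definition tuple_dom ::
  "'x set \<Rightarrow> 'x set \<Rightarrow> ('x \<Rightarrow> ('x, 'k::field) ratfun) \<Rightarrow> ('x, 'k) ncpoint set" where
  "tuple_dom X X' r = {(n, A) \<in> ncpoints X'. \<forall>j \<in> X - X'. (n, A) \<in> ratfun_dom X' (r j)}"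

definition tuple_graph ::
  "'x set \<Rightarrow> 'x set \<Rightarrow> ('x \<Rightarrow> ('x, 'k::field) ratfun) \<Rightarrow> ('x, 'k) ncpoint set" where
  "tuple_graph X X' r =
     (\<lambda>(n, A). (n, \<lambda>i \<in> X. if i \<in> X' then A i else ratfun_eval X' (r i) n A)) ` tuple_dom X X' r"

definition resolvent_ring ::
  "'x set \<Rightarrow> 'x set \<Rightarrow> ('x \<Rightarrow> ('x, 'k::field) ratfun) \<Rightarrow> ('x, 'k) ratfun ring" where
  "resolvent_ring X X' r =
     (free_skew_field X)
       \<lparr>carrier := generate_ring (free_skew_field X)
          (ratfun_incl X ` carrier (free_skew_field_height X' (tuple_height X X' r)) \<union>
           poly_ratfun X ` ncpolys X)\<rparr>"

definition resolvent_ideal ::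
  "'x set \<Rightarrow> 'x set \<Rightarrow> ('x \<Rightarrow> ('x, 'k::field) ratfun) \<Rightarrow> ('x, 'k) ratfun set" where
  "resolvent_ideal X X' r =
     Idl\<^bsub>resolvent_ring X X' r\<^esub>
       {poly_ratfun X (ncvar j) \<ominus>\<^bsub>resolvent_ring X X' r\<^esub> ratfun_incl X (r j) | j. j \<in> X - X'}"

definition frr_wrt ::
  "'x set \<Rightarrow> 'x set \<Rightarrow> ('x \<Rightarrow> ('x, 'k::field) ratfun) \<Rightarrow> ('x, 'k) ncpoly set \<Rightarrow> bool" where
  "frr_wrt X X' r I \<longleftrightarrow> resolvent_data X X' r \<and>
     I \<inter> ncpolys X' = {0} \<and>
     Idl\<^bsub>resolvent_ring X X' r\<^esub> (poly_ratfun X ` I) = resolvent_ideal X X' r"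

definition grr_wrt ::
  "'x set \<Rightarrow> 'x set \<Rightarrow> ('x \<Rightarrow> ('x, 'k::field) ratfun) \<Rightarrow> ('x, 'k) ncpoly set \<Rightarrow> bool" where
  "grr_wrt X X' r I \<longleftrightarrow> resolvent_data X X' r \<and>
     tuple_graph X X' r \<subseteq> zero_locus X I \<and>
     (\<forall>f \<in> ncpolys X. vanishes_on f (tuple_graph X X' r) \<longrightarrow> vanishes_on f (zero_locus X I))"

definition grr :: "'x set \<Rightarrow> ('x, 'k::field) ncpoly set \<Rightarrow> bool" where
  "grr X I \<longleftrightarrow> (\<exists>X' r. grr_wrt X X' r I)"


section \<open>Coproducts of rings\<close>

text \<open>
  The pushout of ring homomorphisms \<open>f\<^sub>1 : S \<rightarrow> R\<^sub>1\<close> and \<open>f\<^sub>2 : S \<rightarrow> R\<^sub>2\<close>, presented by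
  generators and relations: the free ring (over the integers) on the disjoint union of the
  carriers of \<open>R\<^sub>1\<close> and \<open>R\<^sub>2\<close>, modulo the relations which say that the two
  canonical maps are (unital) ring homomorphisms and agree on \<open>S\<close>.
\<close>

definition hom_relations :: "('a, 'm) ring_scheme \<Rightarrow> ('a \<Rightarrow> 'x) \<Rightarrow> ('x, int) ncpoly set" where
  "hom_relations R \<iota> =
     {ncvar (\<iota> (a \<oplus>\<^bsub>R\<^esub> b)) - (ncvar (\<iota> a) + ncvar (\<iota> b)) | a b. a \<in> carrier R \<and> b \<in> carrier R} \<union>
     {ncvar (\<iota> (a \<otimes>\<^bsub>R\<^esub> b)) - ncvar (\<iota> a) * ncvar (\<iota> b) | a b. a \<in> carrier R \<and> b \<in> carrier R} \<union>
     {ncvar (\<iota> \<one>\<^bsub>R\<^esub>) - 1}"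

definition coproduct_free ::
  "('a, 'm) ring_scheme \<Rightarrow> ('b, 'n) ring_scheme \<Rightarrow> ('a + 'b, int) ncpoly ring" where
  "coproduct_free R\<^sub>1 R\<^sub>2 = free_algebra (carrier R\<^sub>1 <+> carrier R\<^sub>2)"

definition coproduct_relations ::
  "('s, 'l) ring_scheme \<Rightarrow> ('a, 'm) ring_scheme \<Rightarrow> ('b, 'n) ring_scheme \<Rightarrow>
   ('s \<Rightarrow> 'a) \<Rightarrow> ('s \<Rightarrow> 'b) \<Rightarrow> ('a + 'b, int) ncpoly set" where
  "coproduct_relations S R\<^sub>1 R\<^sub>2 f\<^sub>1 f\<^sub>2 =
     hom_relations R\<^sub>1 Inl \<union> hom_relations R\<^sub>2 Inr \<union>
     {ncvar (Inl (f\<^sub>1 s)) - ncvar (Inr (f\<^sub>2 s)) | s. s \<in> carrier S}"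

definition coproduct_ideal ::
  "('s, 'l) ring_scheme \<Rightarrow> ('a, 'm) ring_scheme \<Rightarrow> ('b, 'n) ring_scheme \<Rightarrow>
   ('s \<Rightarrow> 'a) \<Rightarrow> ('s \<Rightarrow> 'b) \<Rightarrow> ('a + 'b, int) ncpoly set" where
  "coproduct_ideal S R\<^sub>1 R\<^sub>2 f\<^sub>1 f\<^sub>2 =
     Idl\<^bsub>coproduct_free R\<^sub>1 R\<^sub>2\<^esub> (coproduct_relations S R\<^sub>1 R\<^sub>2 f\<^sub>1 f\<^sub>2)"

definition coproduct ::
  "('s, 'l) ring_scheme \<Rightarrow> ('a, 'm) ring_scheme \<Rightarrow> ('b, 'n) ring_scheme \<Rightarrow>
   ('s \<Rightarrow> 'a) \<Rightarrow> ('s \<Rightarrow> 'b) \<Rightarrow> ('a + 'b, int) ncpoly set ring" where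
  "coproduct S R\<^sub>1 R\<^sub>2 f\<^sub>1 f\<^sub>2 = coproduct_free R\<^sub>1 R\<^sub>2 Quot coproduct_ideal S R\<^sub>1 R\<^sub>2 f\<^sub>1 f\<^sub>2"

definition coproduct_inj ::
  "('s, 'l) ring_scheme \<Rightarrow> ('a, 'm) ring_scheme \<Rightarrow> ('b, 'n) ring_scheme \<Rightarrow>
   ('s \<Rightarrow> 'a) \<Rightarrow> ('s \<Rightarrow> 'b) \<Rightarrow> 'a + 'b \<Rightarrow> ('a + 'b, int) ncpoly set" where
  "coproduct_inj S R\<^sub>1 R\<^sub>2 f\<^sub>1 f\<^sub>2 x =
     coproduct_ideal S R\<^sub>1 R\<^sub>2 f\<^sub>1 f\<^sub>2 +>\<^bsub>coproduct_free R\<^sub>1 R\<^sub>2\<^esub> ncvar x"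

lemma coproduct_relations_closed:
  assumes "ring R\<^sub>1" "ring R\<^sub>2" "f\<^sub>1 \<in> Ring.ring_hom S R\<^sub>1" "f\<^sub>2 \<in> Ring.ring_hom S R\<^sub>2"
  shows "coproduct_relations S R\<^sub>1 R\<^sub>2 f\<^sub>1 f\<^sub>2 \<subseteq> carrier (coproduct_free R\<^sub>1 R\<^sub>2)"
proof -
  interpret R1: ring R\<^sub>1 by fact
  interpret R2: ring R\<^sub>2 by fact
  have d: "p - q \<in> ncpolys V" if "p \<in> ncpolys V" "q \<in> ncpolys V" for p q :: "('z, int) ncpoly" and V
    using add_in_ncpolys[OF that(1) uminus_in_ncpolys[OF that(2)]] by simp
  show ?thesis
    using assms(3,4)
    by (auto simp: coproduct_relations_def hom_relations_def coproduct_free_def free_algebra_def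
        ring_hom_closed
        intro!: d add_in_ncpolys mult_in_ncpolys ncvar_in_ncpolys one_in_ncpolys)
qed

lemma coset_eqI:
  assumes "ideal J (free_algebra V)" "p \<in> ncpolys V" "q \<in> ncpolys V" "p - q \<in> J"
  shows "J +>\<^bsub>free_algebra V\<^esub> p = J +>\<^bsub>free_algebra V\<^esub> q"
proof -
  interpret J: ideal J "free_algebra V" by fact
  have "p \<ominus>\<^bsub>free_algebra V\<^esub> q = p - q"
    using assms(2,3) by (rule free_algebra_minus)
  moreover have "p \<in> carrier (free_algebra V)" "q \<in> carrier (free_algebra V)"
    using assms(2,3) by (simp_all add: free_algebra_def)
  ultimately show ?thesis
    using J.quotient_eq_iff_same_a_r_cos[OF assms(1), of p q] assms(4) by simp
qed

lemma ncvar_coset_hom: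
  fixes \<iota> :: "'a \<Rightarrow> 'x"
  assumes "ring R" "ideal J (free_algebra V)" "\<And>a. a \<in> carrier R \<Longrightarrow> \<iota> a \<in> V"
    and rel: "hom_relations R \<iota> \<subseteq> J"
  shows "(\<lambda>a. J +>\<^bsub>free_algebra V\<^esub> ncvar (\<iota> a)) \<in> Ring.ring_hom R (free_algebra V Quot J)"
proof -
  interpret R: ring R by fact
  interpret J: ideal J "free_algebra V" by fact
  have ops: "carrier (free_algebra V :: ('x, int) ncpoly ring) = ncpolys V"
    "\<And>p q :: ('x, int) ncpoly. p \<oplus>\<^bsub>free_algebra V\<^esub> q = p + q"
    "\<And>p q :: ('x, int) ncpoly. p \<otimes>\<^bsub>free_algebra V\<^esub> q = p * q"
    "\<one>\<^bsub>free_algebra V :: ('x, int) ncpoly ring\<^esub> = 1"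
    by (simp_all add: free_algebra_def)
  note proj = J.rcos_ring_hom
  have var: "ncvar (\<iota> a) \<in> ncpolys V" if "a \<in> carrier R" for a
    using assms(3)[OF that] by (rule ncvar_in_ncpolys)
  note coset = coset_eqI[OF assms(2)]
  show ?thesis
  proof (rule ring_hom_memI)
    fix a assume a: "a \<in> carrier R"
    show "J +>\<^bsub>free_algebra V\<^esub> ncvar (\<iota> a) \<in> carrier (free_algebra V Quot J)"
      by (rule ring_hom_closed[OF proj]) (simp add: ops var a)
    fix b assume b: "b \<in> carrier R"
    have "ncvar (\<iota> (a \<otimes>\<^bsub>R\<^esub> b)) - ncvar (\<iota> a) * ncvar (\<iota> b) \<in> J"
      using rel a b by (auto simp: hom_relations_def)
    then show "J +>\<^bsub>free_algebra V\<^esub> ncvar (\<iota> (a \<otimes>\<^bsub>R\<^esub> b)) =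
        (J +>\<^bsub>free_algebra V\<^esub> ncvar (\<iota> a)) \<otimes>\<^bsub>free_algebra V Quot J\<^esub>
        (J +>\<^bsub>free_algebra V\<^esub> ncvar (\<iota> b))"
      using ring_hom_mult[OF proj, of "ncvar (\<iota> a)" "ncvar (\<iota> b)"] a b
        coset[of "ncvar (\<iota> (a \<otimes>\<^bsub>R\<^esub> b))" "ncvar (\<iota> a) * ncvar (\<iota> b)"]
      by (simp add: ops var mult_in_ncpolys)
    have "ncvar (\<iota> (a \<oplus>\<^bsub>R\<^esub> b)) - (ncvar (\<iota> a) + ncvar (\<iota> b)) \<in> J"
      using rel a b by (auto simp: hom_relations_def)
    then show "J +>\<^bsub>free_algebra V\<^esub> ncvar (\<iota> (a \<oplus>\<^bsub>R\<^esub> b)) =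
        (J +>\<^bsub>free_algebra V\<^esub> ncvar (\<iota> a)) \<oplus>\<^bsub>free_algebra V Quot J\<^esub>
        (J +>\<^bsub>free_algebra V\<^esub> ncvar (\<iota> b))"
      using ring_hom_add[OF proj, of "ncvar (\<iota> a)" "ncvar (\<iota> b)"] a b
        coset[of "ncvar (\<iota> (a \<oplus>\<^bsub>R\<^esub> b))" "ncvar (\<iota> a) + ncvar (\<iota> b)"]
      by (simp add: ops var add_in_ncpolys)
  next
    have "ncvar (\<iota> \<one>\<^bsub>R\<^esub>) - 1 \<in> J"
      using rel by (auto simp: hom_relations_def)
    then show "J +>\<^bsub>free_algebra V\<^esub> ncvar (\<iota> \<one>\<^bsub>R\<^esub>) = \<one>\<^bsub>free_algebra V Quot J\<^esub>"
      using ring_hom_one[OF proj] coset[of "ncvar (\<iota> \<one>\<^bsub>R\<^esub>)" 1]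
      by (simp add: ops var one_in_ncpolys)
  qed
qed

lemma coproduct_inj_hom:
  assumes "ring R\<^sub>1" "ring R\<^sub>2" "f\<^sub>1 \<in> Ring.ring_hom S R\<^sub>1" "f\<^sub>2 \<in> Ring.ring_hom S R\<^sub>2"
  shows "ring (coproduct S R\<^sub>1 R\<^sub>2 f\<^sub>1 f\<^sub>2)"
    and "(\<lambda>a. coproduct_inj S R\<^sub>1 R\<^sub>2 f\<^sub>1 f\<^sub>2 (Inl a)) \<in> Ring.ring_hom R\<^sub>1 (coproduct S R\<^sub>1 R\<^sub>2 f\<^sub>1 f\<^sub>2)"
    and "(\<lambda>b. coproduct_inj S R\<^sub>1 R\<^sub>2 f\<^sub>1 f\<^sub>2 (Inr b)) \<in> Ring.ring_hom R\<^sub>2 (coproduct S R\<^sub>1 R\<^sub>2 f\<^sub>1 f\<^sub>2)"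
    and "\<And>s. s \<in> carrier S \<Longrightarrow>
      coproduct_inj S R\<^sub>1 R\<^sub>2 f\<^sub>1 f\<^sub>2 (Inl (f\<^sub>1 s)) = coproduct_inj S R\<^sub>1 R\<^sub>2 f\<^sub>1 f\<^sub>2 (Inr (f\<^sub>2 s))"
proof -
  let ?F = "free_algebra (carrier R\<^sub>1 <+> carrier R\<^sub>2)" and ?J = "coproduct_ideal S R\<^sub>1 R\<^sub>2 f\<^sub>1 f\<^sub>2"
  interpret F: ring ?F by (rule ring_free_algebra)
  note closed = coproduct_relations_closed[OF assms, unfolded coproduct_free_def]
  have J: "ideal ?J ?F"
    unfolding coproduct_ideal_def coproduct_free_def by (rule F.genideal_ideal[OF closed])
  have rel: "coproduct_relations S R\<^sub>1 R\<^sub>2 f\<^sub>1 f\<^sub>2 \<subseteq> ?J"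
    unfolding coproduct_ideal_def coproduct_free_def by (rule F.genideal_self[OF closed])
  note defs = coproduct_def coproduct_inj_def coproduct_free_def
  show "ring (coproduct S R\<^sub>1 R\<^sub>2 f\<^sub>1 f\<^sub>2)"
    unfolding defs by (rule ideal.quotient_is_ring[OF J])
  show "(\<lambda>a. coproduct_inj S R\<^sub>1 R\<^sub>2 f\<^sub>1 f\<^sub>2 (Inl a)) \<in> Ring.ring_hom R\<^sub>1 (coproduct S R\<^sub>1 R\<^sub>2 f\<^sub>1 f\<^sub>2)"
    unfolding defs
    by (rule ncvar_coset_hom[OF assms(1) J]) (use rel in \<open>auto simp: coproduct_relations_def\<close>)
  show "(\<lambda>b. coproduct_inj S R\<^sub>1 R\<^sub>2 f\<^sub>1 f\<^sub>2 (Inr b)) \<in> Ring.ring_hom R\<^sub>2 (coproduct S R\<^sub>1 R\<^sub>2 f\<^sub>1 f\<^sub>2)"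
    unfolding defs
    by (rule ncvar_coset_hom[OF assms(2) J]) (use rel in \<open>auto simp: coproduct_relations_def\<close>)
  show "coproduct_inj S R\<^sub>1 R\<^sub>2 f\<^sub>1 f\<^sub>2 (Inl (f\<^sub>1 s)) = coproduct_inj S R\<^sub>1 R\<^sub>2 f\<^sub>1 f\<^sub>2 (Inr (f\<^sub>2 s))"
    if "s \<in> carrier S" for s
  proof -
    have "ncvar (Inl (f\<^sub>1 s)) - ncvar (Inr (f\<^sub>2 s)) \<in> ?J"
      using rel that by (auto simp: coproduct_relations_def)
    then show ?thesis
      unfolding defs
      using ring_hom_closed[OF assms(3) that] ring_hom_closed[OF assms(4) that]
      by (intro coset_eqI[OF J] ncvar_in_ncpolys) auto
  qed
qed

definition faithful_coproduct ::
  "('s, 'l) ring_scheme \<Rightarrow> ('a, 'm) ring_scheme \<Rightarrow> ('b, 'n) ring_scheme \<Rightarrow>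
   ('s \<Rightarrow> 'a) \<Rightarrow> ('s \<Rightarrow> 'b) \<Rightarrow> bool" where
  "faithful_coproduct S R\<^sub>1 R\<^sub>2 f\<^sub>1 f\<^sub>2 \<longleftrightarrow>
     inj_on (\<lambda>a. coproduct_inj S R\<^sub>1 R\<^sub>2 f\<^sub>1 f\<^sub>2 (Inl a)) (carrier R\<^sub>1) \<and>
     inj_on (\<lambda>b. coproduct_inj S R\<^sub>1 R\<^sub>2 f\<^sub>1 f\<^sub>2 (Inr b)) (carrier R\<^sub>2)"


section \<open>Embeddings into free skew fields\<close>

text \<open>Embeddings are \<open>k\<close>-algebra embeddings into the free skew field over the same field \<open>k\<close>.\<close>

definition embeds_into_free_skew_field :: "'x set \<Rightarrow> ('x, 'k::field) ncpoly set \<Rightarrow> bool" where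
  "embeds_into_free_skew_field X I \<longleftrightarrow>
     (\<exists>m::nat. \<exists>\<phi> \<in> Ring.ring_hom (free_algebra X Quot I)
                            (free_skew_field {1..m} :: (nat, 'k) ratfun ring).
        inj_on \<phi> (carrier (free_algebra X Quot I)) \<and>
        (\<forall>c. \<phi> (I +>\<^bsub>free_algebra X\<^esub> ncconst c) = poly_ratfun {1..m} (ncconst c)))"

end

theory Submission
  imports Defs "Jordan_Normal_Form.Determinant"
begin

hide_const (open) Polynomial.Poly Multiset.mult

text \<open>
  A rational function is determined by its values on the domain of any one expression. Along a line of
  matrix tuples an expression is a quotient of a matrix of polynomials by a polynomial
  (\<open>expr_rational_at\<close>), and tuples of different sizes are brought to a common size by direct sums;
  so an expression that vanishes on a nonempty domain vanishes wherever it is defined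
  (\<open>expr_dom_dense\<close>). Hence the classes of expressions form a ring, and identities between them
  may be checked pointwise (\<open>rat_eqI\<close>).

  Fix a resolvent \<open>r\<close>. Substituting \<open>r\<close> for the variables outside \<open>X'\<close> is a homomorphism \<open>resolve\<close>
  from \<open>k\<langle>X\<rangle>\<close> to the rational functions in \<open>X'\<close>, and its kernel consists of the polynomials that
  vanish on the graph of \<open>r\<close> (\<open>resolve_eq_zero_iff\<close>). Both parts of the theorem rest on the
  statement that this kernel is the ideal \<open>I\<close>. In the second part the hypotheses say so, and
  \<open>resolve\<close> induces the embedding of the quotient (\<open>quotient_embeds\<close>).

  In the first part, the generators \<open>X''\<^sub>j - r\<^sub>j\<close> of the resolvent ideal vanish at generic points of
  the graph, so \<open>I\<close> lies in the kernel. Conversely \<open>f\<close> and \<open>resolve f\<close> agree modulo the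
  resolvent ideal (\<open>resolve_cong\<close>), so an \<open>f\<close> in the kernel lies in the ideal that \<open>I\<close> generates in
  the resolvent ring. To return from there to \<open>I\<close> one maps the resolvent ring to the coproduct of
  \<open>k\<langle>X\<rangle>/I\<close> with the coefficient ring, in which \<open>I\<close> becomes zero; faithfulness of the coproduct then
  gives \<open>f \<in> I\<close>. Such a map exists because the resolvent ring satisfies no relations beyond those
  of a coproduct: a formal expression in coefficients and variables that is zero as a rational
  function is zero in every ring that receives both (\<open>formal_val_zero_imp\<close>). Modulo the obvious
  relations, a formal expression is a combination of alternating monomials
  \<open>a\<^sub>0 x\<^sub>1 a\<^sub>1 \<cdots> x\<^sub>d a\<^sub>d\<close>. Values of the \<open>x\<^sub>i\<close> on block upper triangular matrices single out one word
  and evaluate its coefficients at independently chosen points (\<open>alt_mono_separation\<close>). Finitely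
  many coefficients are recovered linearly from finitely many of their values
  (\<open>reproducing_points\<close>), so replacing the coefficients one after the other shows that the
  combination is zero (\<open>alt_mono_vanish\<close>).
\<close>

section \<open>Evaluation of noncommutative polynomials\<close>

lemma ncpolys_add_induct [consumes 1, case_names monom add]:
  assumes "p \<in> ncpolys V"
    and monom: "\<And>w c. set (letters w) \<subseteq> V \<Longrightarrow> P (Poly_Mapping.single w c)"
    and add: "\<And>p q. p \<in> ncpolys V \<Longrightarrow> q \<in> ncpolys V \<Longrightarrow> P p \<Longrightarrow> P q \<Longrightarrow> P (p + q)"
  shows "P p"
proof -
  have "(\<Sum>w\<in>T. Poly_Mapping.single w (Poly_Mapping.lookup p w)) \<in> ncpolys V \<and>
        P (\<Sum>w\<in>T. Poly_Mapping.single w (Poly_Mapping.lookup p w))"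
    if "finite T" "T \<subseteq> Poly_Mapping.keys p" for T
    using that
  proof induction
    case empty
    have "P (Poly_Mapping.single (Word []) 0)" by (rule monom) simp
    then show ?case by (simp add: zero_in_ncpolys)
  next
    case (insert w T)
    have w: "set (letters w) \<subseteq> V" using assms(1) insert.prems by (auto simp: ncpolys_def)
    have "Poly_Mapping.single w (Poly_Mapping.lookup p w) \<in> ncpolys V"
      using w by (auto simp: ncpolys_def in_keys_iff lookup_single when_def split: if_splits)
    then show ?case
      using insert monom[OF w] by (simp add: add add_in_ncpolys)
  qed
  moreover have "(\<Sum>w\<in>Poly_Mapping.keys p. Poly_Mapping.single w (Poly_Mapping.lookup p w)) = p"
    by (rule poly_mapping_eqI)
      (auto simp: lookup_sum lookup_single when_def in_keys_iff)
  ultimately show ?thesis by (metis finite_keys order_refl)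
qed

lemma ncconst_in_ncpolys: "ncconst c \<in> ncpolys V"
  by (auto simp: ncpolys_def ncconst_def in_keys_iff lookup_single when_def zero_ncword_def
      split: if_splits)

lemma monom_in_ncpolys: "set (letters w) \<subseteq> V \<Longrightarrow> Poly_Mapping.single w c \<in> ncpolys V"
  by (auto simp: ncpolys_def in_keys_iff lookup_single when_def split: if_splits)

lemma ncconst_mult_monom: "ncconst c * Poly_Mapping.single w d = Poly_Mapping.single w (c * d)"
  by (simp add: ncconst_def mult_single)

lemma ncvar_mult_monom:
  "ncvar x * Poly_Mapping.single w d = Poly_Mapping.single (Word (x # letters w)) d"
  by (simp add: ncvar_def mult_single plus_ncword_def)

lemma ncpolys_induct [consumes 1, case_names const var add mult]:
  assumes "p \<in> ncpolys V"
    and const: "\<And>c. P (ncconst c)"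
    and var: "\<And>x. x \<in> V \<Longrightarrow> P (ncvar x)"
    and add: "\<And>p q. p \<in> ncpolys V \<Longrightarrow> q \<in> ncpolys V \<Longrightarrow> P p \<Longrightarrow> P q \<Longrightarrow> P (p + q)"
    and mult: "\<And>p q. p \<in> ncpolys V \<Longrightarrow> q \<in> ncpolys V \<Longrightarrow> P p \<Longrightarrow> P q \<Longrightarrow> P (p * q)"
  shows "P p"
  using assms(1)
proof (induction rule: ncpolys_add_induct)
  case (monom w c)
  have "set l \<subseteq> V \<Longrightarrow> P (Poly_Mapping.single (Word l) c)" for l
  proof (induction l)
    case Nil
    then show ?case using const[of c] by (simp add: ncconst_def zero_ncword_def)
  next
    case (Cons x l)
    have "P (ncvar x * Poly_Mapping.single (Word l) c)"
      by (rule mult) (use Cons in \<open>auto simp: var intro!: ncvar_in_ncpolys monom_in_ncpolys\<close>)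
    then show ?case by (simp add: ncvar_mult_monom)
  qed
  from this[of "letters w"] monom show ?case by simp
next
  case (add p q)
  then show ?case by (rule assms(4))
qed

lemma ncconst_0 [simp]: "ncconst 0 = 0"
  by (simp add: ncconst_def)

lemma ncconst_1 [simp]: "ncconst 1 = 1"
  by (simp add: ncconst_def)

lemma ncconst_add: "ncconst (a + b) = ncconst a + ncconst b"
  by (simp add: ncconst_def single_add)

lemma ncconst_mult: "ncconst (a * b) = ncconst a * ncconst b"
  by (simp add: ncconst_def mult_single)

lemma ncconst_commute:
  assumes "p \<in> ncpolys V"
  shows "ncconst c * p = p * ncconst c"
  using assms
proof (induction rule: ncpolys_add_induct)
  case (monom w d)
  then show ?case by (simp add: ncconst_def mult_single mult.commute)
qed (simp add: algebra_simps)

lemma sum_in_ncpolys: "(\<And>i. i \<in> T \<Longrightarrow> f i \<in> ncpolys V) \<Longrightarrow> sum f T \<in> ncpolys V"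
  by (induction T rule: infinite_finite_induct) (auto simp: zero_in_ncpolys add_in_ncpolys)

definition word_prod :: "('q, 'm) ring_scheme \<Rightarrow> ('x \<Rightarrow> 'q) \<Rightarrow> 'x list \<Rightarrow> 'q" where
  "word_prod Q \<xi> l = foldr (\<lambda>x M. \<xi> x \<otimes>\<^bsub>Q\<^esub> M) l \<one>\<^bsub>Q\<^esub>"

text \<open>
  The homomorphism out of the free algebra that is given on scalars by \<open>\<sigma>\<close> and on variables by
  \<open>\<xi>\<close>. Matrices, rational functions and coproducts all serve as targets; none of them is a type
  class, hence the ring as an argument.
\<close>

definition nc_eval ::
  "('q, 'm) ring_scheme \<Rightarrow> ('c::comm_ring_1 \<Rightarrow> 'q) \<Rightarrow> ('x \<Rightarrow> 'q) \<Rightarrow> ('x, 'c) ncpoly \<Rightarrow> 'q" where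
  "nc_eval Q \<sigma> \<xi> p =
     (\<Oplus>\<^bsub>Q\<^esub> w \<in> Poly_Mapping.keys p. \<sigma> (Poly_Mapping.lookup p w) \<otimes>\<^bsub>Q\<^esub> word_prod Q \<xi> (letters w))"

locale nc_evaluation = ring Q
  for Q :: "('q, 'm) ring_scheme" (structure)
    and \<sigma> :: "'c::comm_ring_1 \<Rightarrow> 'q" and \<xi> :: "'x \<Rightarrow> 'q" and V :: "'x set" +
  assumes scalar_closed [simp]: "\<sigma> c \<in> carrier Q"
    and scalar_add: "\<sigma> (c + d) = \<sigma> c \<oplus> \<sigma> d"
    and scalar_mult: "\<sigma> (c * d) = \<sigma> c \<otimes> \<sigma> d"
    and scalar_one: "\<sigma> 1 = \<one>"
    and var_closed [simp]: "x \<in> V \<Longrightarrow> \<xi> x \<in> carrier Q"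
    and commute: "x \<in> V \<Longrightarrow> \<sigma> c \<otimes> \<xi> x = \<xi> x \<otimes> \<sigma> c"
begin

lemma word_prod_closed [simp]: "set l \<subseteq> V \<Longrightarrow> word_prod Q \<xi> l \<in> carrier Q"
  by (induction l) (auto simp: word_prod_def)

lemma scalar_zero [simp]: "\<sigma> 0 = \<zero>"
proof -
  have "\<sigma> 0 \<oplus> \<sigma> 0 = \<sigma> 0" using scalar_add[of 0 0] by simp
  then show ?thesis using add.l_cancel_one scalar_closed by blast
qed

abbreviation eval where "eval \<equiv> nc_eval Q \<sigma> \<xi>"

lemma eval_superset:
  assumes "finite T" "Poly_Mapping.keys p \<subseteq> T" "\<And>w. w \<in> T \<Longrightarrow> set (letters w) \<subseteq> V"
  shows "eval p = (\<Oplus>w \<in> T. \<sigma> (Poly_Mapping.lookup p w) \<otimes> word_prod Q \<xi> (letters w))"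
  unfolding nc_eval_def using assms
  by (intro add.finprod_mono_neutral_cong_left) (auto simp: in_keys_iff)

lemma eval_closed [simp]: "p \<in> ncpolys V \<Longrightarrow> eval p \<in> carrier Q"
  unfolding nc_eval_def by (rule finsum_closed) (auto simp: ncpolys_def)

lemma eval_add:
  assumes "p \<in> ncpolys V" "q \<in> ncpolys V"
  shows "eval (p + q) = eval p \<oplus> eval q"
proof -
  let ?T = "Poly_Mapping.keys p \<union> Poly_Mapping.keys q"
  have T: "finite ?T" "\<And>w. w \<in> ?T \<Longrightarrow> set (letters w) \<subseteq> V"
    using assms by (auto simp: ncpolys_def)
  have "eval (p + q) =
      (\<Oplus>w \<in> ?T. \<sigma> (Poly_Mapping.lookup (p + q) w) \<otimes> word_prod Q \<xi> (letters w))"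
    by (rule eval_superset[OF T(1) keys_add T(2)])
  also have "\<dots> = (\<Oplus>w \<in> ?T. \<sigma> (Poly_Mapping.lookup p w) \<otimes> word_prod Q \<xi> (letters w) \<oplus>
      \<sigma> (Poly_Mapping.lookup q w) \<otimes> word_prod Q \<xi> (letters w))"
    using T(2) by (intro finsum_cong') (auto simp: lookup_add scalar_add l_distr)
  also have "\<dots> = (\<Oplus>w \<in> ?T. \<sigma> (Poly_Mapping.lookup p w) \<otimes> word_prod Q \<xi> (letters w)) \<oplus>
      (\<Oplus>w \<in> ?T. \<sigma> (Poly_Mapping.lookup q w) \<otimes> word_prod Q \<xi> (letters w))"
    by (rule finsum_addf) (use T(2) in auto)
  also have "\<dots> = eval p \<oplus> eval q"
    by (rule arg_cong2[where f = "(\<oplus>)", OF eval_superset[symmetric] eval_superset[symmetric]])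
      (use T in auto)
  finally show ?thesis .
qed

lemma eval_monom:
  assumes "set (letters w) \<subseteq> V"
  shows "eval (Poly_Mapping.single w c) = \<sigma> c \<otimes> word_prod Q \<xi> (letters w)"
  using assms by (subst eval_superset[of "{w}"]) (auto)

lemma eval_const: "eval (ncconst c) = \<sigma> c"
  unfolding ncconst_def by (subst eval_monom) (auto simp: zero_ncword_def word_prod_def)

lemma eval_var: "x \<in> V \<Longrightarrow> eval (ncvar x) = \<xi> x"
  unfolding ncvar_def by (subst eval_monom) (auto simp: word_prod_def scalar_one)

lemma eval_one: "eval 1 = \<one>"
  using eval_const[of 1] by (simp add: scalar_one)

lemma eval_zero: "eval 0 = \<zero>"
  using eval_const[of 0] by simp

lemma eval_mult:
  assumes "p \<in> ncpolys V" "q \<in> ncpolys V"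
  shows "eval (p * q) = eval p \<otimes> eval q"
  using assms
proof (induction arbitrary: q rule: ncpolys_induct)
  case (const c)
  then show ?case
  proof (induction rule: ncpolys_add_induct)
    case (monom w d)
    then show ?case
      by (simp add: ncconst_mult_monom eval_monom eval_const scalar_mult m_assoc)
  qed (simp add: distrib_left eval_add eval_const r_distr mult_in_ncpolys ncconst_in_ncpolys)
next
  case (var x)
  from var(2) show ?case
  proof (induction rule: ncpolys_add_induct)
    case (monom w d)
    have "\<sigma> d \<otimes> (\<xi> x \<otimes> word_prod Q \<xi> (letters w)) = \<xi> x \<otimes> (\<sigma> d \<otimes> word_prod Q \<xi> (letters w))"
      using var monom commute[of x d] m_assoc[symmetric] by simp
    then show ?case
      using var monom by (simp add: ncvar_mult_monom eval_monom eval_var word_prod_def)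
  qed (use var in \<open>simp add: distrib_left eval_add eval_var r_distr mult_in_ncpolys ncvar_in_ncpolys\<close>)
next
  case (add p p')
  then show ?case by (simp add: distrib_right eval_add l_distr mult_in_ncpolys)
next
  case (mult p p')
  then show ?case by (simp add: mult.assoc m_assoc mult_in_ncpolys)
qed

lemma eval_uminus:
  assumes "p \<in> ncpolys V"
  shows "eval (- p) = \<ominus> eval p"
  using eval_add[OF uminus_in_ncpolys[OF assms] assms] assms
  by (simp add: eval_zero minus_equality uminus_in_ncpolys)

lemma eval_hom: "eval \<in> Ring.ring_hom (free_algebra V) Q"
  by (rule ring_hom_memI) (simp_all add: free_algebra_def eval_add eval_mult eval_one)

end

section \<open>Evaluation at matrices\<close>

lemma smult_smult_mat: "a \<cdot>\<^sub>m (b \<cdot>\<^sub>m M) = (a * b :: 'k::semigroup_mult) \<cdot>\<^sub>m M"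
  by (rule eq_matI) (auto simp: mult.assoc)

lemma nc_evaluation_matring:
  assumes "\<And>x. x \<in> V \<Longrightarrow> A x \<in> carrier_mat n n"
  shows "nc_evaluation (matring n) (\<lambda>c::'k::field. c \<cdot>\<^sub>m 1\<^sub>m n) A V"
proof -
  interpret ring "matring n :: 'k mat ring" by (rule ring_mat)
  show ?thesis
  proof
    fix c x assume x: "x \<in> V"
    have "c \<cdot>\<^sub>m 1\<^sub>m n * A x = c \<cdot>\<^sub>m A x" "A x * (c \<cdot>\<^sub>m 1\<^sub>m n) = c \<cdot>\<^sub>m A x"
      using assms[OF x] mult_smult_assoc_mat[OF one_carrier_mat assms[OF x], of c]
        mult_smult_distrib[OF assms[OF x] one_carrier_mat, of c] by simp_all
    then show "c \<cdot>\<^sub>m 1\<^sub>m n \<otimes>\<^bsub>matring n\<^esub> A x = A x \<otimes>\<^bsub>matring n\<^esub> (c \<cdot>\<^sub>m 1\<^sub>m n)"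
      by (simp add: ring_mat_simps)
  next
    fix c d :: 'k
    have "c \<cdot>\<^sub>m 1\<^sub>m n * (d \<cdot>\<^sub>m 1\<^sub>m n) = c \<cdot>\<^sub>m (1\<^sub>m n * (d \<cdot>\<^sub>m 1\<^sub>m n))"
      by (rule mult_smult_assoc_mat) auto
    also have "\<dots> = (c * d) \<cdot>\<^sub>m (1\<^sub>m n :: 'k mat)"
      by (subst left_mult_one_mat[of _ n n]) (auto simp: smult_smult_mat)
    finally have "c \<cdot>\<^sub>m 1\<^sub>m n * (d \<cdot>\<^sub>m 1\<^sub>m n) = (c * d) \<cdot>\<^sub>m (1\<^sub>m n :: 'k mat)" .
    then show "(c * d) \<cdot>\<^sub>m 1\<^sub>m n = c \<cdot>\<^sub>m 1\<^sub>m n \<otimes>\<^bsub>matring n\<^esub> (d \<cdot>\<^sub>m 1\<^sub>m n)"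
      by (simp add: ring_mat_simps)
  qed (use assms in \<open>auto simp: ring_mat_simps add_smult_distrib_right_mat[of _ n n]\<close>)
qed

text \<open>
  Scalars act on matrices through the scalar matrices, which turns the evaluation of polynomials
  at matrices into an instance of the general one, so that its homomorphism property need not be
  proved again.
\<close>

lemma poly_eval_eq_nc_eval:
  assumes "\<And>x. x \<in> V \<Longrightarrow> A x \<in> carrier_mat n n" and p: "p \<in> ncpolys V"
  shows "poly_eval n A p = nc_eval (matring n) (\<lambda>c::'k::field. c \<cdot>\<^sub>m 1\<^sub>m n) A p"
proof -
  interpret nc_evaluation "matring n" "\<lambda>c::'k. c \<cdot>\<^sub>m 1\<^sub>m n" A V
    using assms(1) by (rule nc_evaluation_matring)
  have eq: "word_eval n A w = word_prod (matring n) A (letters w)" for w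
    by (simp add: word_eval_def word_prod_def ring_mat_simps)
  have M: "word_eval n A w \<in> carrier_mat n n" if "w \<in> Poly_Mapping.keys p" for w
    using word_prod_closed[of "letters w"] that p unfolding eq ncpolys_def by (auto simp: ring_mat_simps)
  show ?thesis
    unfolding poly_eval_def nc_eval_def
    by (rule finsum_cong')
      (use M smult_carrier_mat[OF M] mult_smult_assoc_mat[OF one_carrier_mat M] left_mult_one_mat[OF M] in \<open>auto simp: ring_mat_simps eq[symmetric]\<close>)
qed

context
  fixes V :: "'x set" and A :: "'x \<Rightarrow> 'k::field mat" and n :: nat
  assumes A: "\<And>x. x \<in> V \<Longrightarrow> A x \<in> carrier_mat n n"
begin

interpretation nc_evaluation "matring n" "\<lambda>c::'k. c \<cdot>\<^sub>m 1\<^sub>m n" A V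
  using A by (rule nc_evaluation_matring)

lemma poly_eval_closed: "p \<in> ncpolys V \<Longrightarrow> poly_eval n A p \<in> carrier_mat n n"
  using eval_closed by (simp add: poly_eval_eq_nc_eval[OF A] ring_mat_simps)

lemma poly_eval_add:
  "p \<in> ncpolys V \<Longrightarrow> q \<in> ncpolys V \<Longrightarrow> poly_eval n A (p + q) = poly_eval n A p + poly_eval n A q"
  using eval_add by (simp add: poly_eval_eq_nc_eval[OF A] ring_mat_simps add_in_ncpolys)

lemma poly_eval_mult:
  "p \<in> ncpolys V \<Longrightarrow> q \<in> ncpolys V \<Longrightarrow> poly_eval n A (p * q) = poly_eval n A p * poly_eval n A q"
  using eval_mult by (simp add: poly_eval_eq_nc_eval[OF A] ring_mat_simps mult_in_ncpolys)

lemma poly_eval_const: "poly_eval n A (ncconst c) = c \<cdot>\<^sub>m 1\<^sub>m n"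
  using eval_const[of c] by (simp add: poly_eval_eq_nc_eval[OF A] ncconst_in_ncpolys)

lemma poly_eval_var: "x \<in> V \<Longrightarrow> poly_eval n A (ncvar x) = A x"
  using eval_var by (simp add: poly_eval_eq_nc_eval[OF A] ncvar_in_ncpolys)

end

lemmas poly_eval_simps = poly_eval_add poly_eval_mult poly_eval_const poly_eval_var

lemma poly_eval_cong:
  assumes "p \<in> ncpolys V" "\<And>x. x \<in> V \<Longrightarrow> A x \<in> carrier_mat n n" "\<And>x. x \<in> V \<Longrightarrow> A x = B x"
  shows "poly_eval n A p = poly_eval n B p"
proof -
  have B: "B x \<in> carrier_mat n n" if "x \<in> V" for x using assms(2,3) that by metis
  show ?thesis
    using assms(1)
    by (induction rule: ncpolys_induct)
      (simp_all add: poly_eval_simps[OF assms(2)] poly_eval_simps[of V B, OF B] assms(3))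
qed

lemma expr_cong:
  assumes "expr_over V e" "\<And>x. x \<in> V \<Longrightarrow> A x \<in> carrier_mat n n" "\<And>x. x \<in> V \<Longrightarrow> A x = B x"
  shows "expr_eval n A e = expr_eval n B e" "expr_defined n A e = expr_defined n B e"
proof -
  have "expr_eval n A e = expr_eval n B e \<and> expr_defined n A e = expr_defined n B e"
    using assms(1) by (induction e) (auto intro: poly_eval_cong assms(2,3))
  then show "expr_eval n A e = expr_eval n B e" "expr_defined n A e = expr_defined n B e"
    by auto
qed

lemma matring_unit:
  assumes "M \<in> Units (matring n)"
  shows "M \<in> carrier_mat n n" "inv\<^bsub>matring n\<^esub> M \<in> carrier_mat n n"
    "M * inv\<^bsub>matring n\<^esub> M = 1\<^sub>m n" "inv\<^bsub>matring n\<^esub> M * M = 1\<^sub>m n"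
proof -
  interpret ring "matring n :: 'a mat ring" by (rule ring_mat)
  show "M \<in> carrier_mat n n" "inv\<^bsub>matring n\<^esub> M \<in> carrier_mat n n"
    "M * inv\<^bsub>matring n\<^esub> M = 1\<^sub>m n" "inv\<^bsub>matring n\<^esub> M * M = 1\<^sub>m n"
    using assms Units_closed[OF assms] Units_inv_closed[OF assms] Units_r_inv[OF assms]
      Units_l_inv[OF assms] by (simp_all add: ring_mat_simps)
qed

lemma matring_unitI:
  fixes M N :: "'k::field mat"
  assumes "M \<in> carrier_mat n n" "N \<in> carrier_mat n n" "M * N = 1\<^sub>m n" "N * M = 1\<^sub>m n"
  shows "M \<in> Units (matring n)" "inv\<^bsub>matring n\<^esub> M = N"
proof -
  interpret ring "matring n :: 'k mat ring" by (rule ring_mat)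
  show M: "M \<in> Units (matring n)" using assms by (auto simp: Units_def ring_mat_simps)
  show "inv\<^bsub>matring n\<^esub> M = N"
    using assms inv_char[of M N] by (simp add: ring_mat_simps)
qed

lemma expr_eval_closed:
  assumes "\<And>x. x \<in> V \<Longrightarrow> A x \<in> carrier_mat n n" "expr_over V e" "expr_defined n A e"
  shows "expr_eval n A e \<in> carrier_mat n n"
  using assms(2,3)
proof (induction e)
  case (Poly p)
  then show ?case using poly_eval_closed[OF assms(1)] by simp
next
  case (Inv e)
  then show ?case using matring_unit(2) by auto
qed auto

section \<open>Rational dependence on a parameter\<close>

text \<open>
  Regularity at \<open>t0\<close>: the denominator \<open>q\<close> of the matrix \<open>F t\<close> of rational functions of \<open>t\<close>
  is not zero there. The predicate \<open>D\<close> records where an expression is defined, so that the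
  same denominator controls definedness and value.
\<close>

definition rational_at :: "nat \<Rightarrow> (('k::field) \<Rightarrow> bool) \<Rightarrow> ('k \<Rightarrow> 'k mat) \<Rightarrow> 'k \<Rightarrow> bool" where
  "rational_at n D F t0 \<longleftrightarrow> (\<exists>q P. poly q t0 \<noteq> 0 \<and> P \<in> carrier_mat n n \<and>
     (\<forall>t. poly q t \<noteq> 0 \<longrightarrow> D t \<and> poly q t \<cdot>\<^sub>m F t = map_mat (\<lambda>p. poly p t) P))"

lemma inverse_by_adjugate:
  fixes M N :: "'k::field mat"
  assumes "N \<in> carrier_mat n n" "q \<cdot>\<^sub>m M = N" "q \<noteq> 0" "det N \<noteq> 0"
  shows "M \<in> Units (matring n)" "(q * det N) \<cdot>\<^sub>m inv\<^bsub>matring n\<^esub> M = (q * q) \<cdot>\<^sub>m adj_mat N"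
proof -
  have M: "M \<in> carrier_mat n n"
    using assms(1,2) by (metis carrier_matD carrier_matI index_smult_mat(2,3))
  have M_eq: "M = inverse q \<cdot>\<^sub>m N"
    using assms(3) unfolding assms(2)[symmetric] smult_smult_mat by (auto intro!: eq_matI)
  note adj = adj_mat[OF assms(1)]
  let ?I = "(q / det N) \<cdot>\<^sub>m adj_mat N"
  have "M * ?I = 1\<^sub>m n" "?I * M = 1\<^sub>m n"
    using assms adj
    by (auto simp: M_eq mult_smult_assoc_mat[of _ n n] mult_smult_distrib[of _ n n] smult_smult_mat
        intro!: eq_matI)
  note * = matring_unitI[OF M _ this]
  show "M \<in> Units (matring n)" using * adj by auto
  have "inv\<^bsub>matring n\<^esub> M = ?I" using * adj by auto
  then show "(q * det N) \<cdot>\<^sub>m inv\<^bsub>matring n\<^esub> M = (q * q) \<cdot>\<^sub>m adj_mat N"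
    using assms adj by (auto intro!: eq_matI)
qed

lemma comm_ring_hom_poly: "comm_ring_hom (\<lambda>p. poly p t)"
  by unfold_locales auto

lemma rational_at_add:
  assumes "rational_at n D F t0" "rational_at n E G t0"
  shows "rational_at n (\<lambda>t. D t \<and> E t) (\<lambda>t. F t + G t) t0"
proof -
  obtain q P q' P' where 1: "poly q t0 \<noteq> 0" "P \<in> carrier_mat n n"
      "\<And>t. poly q t \<noteq> 0 \<Longrightarrow> D t \<and> poly q t \<cdot>\<^sub>m F t = map_mat (\<lambda>p. poly p t) P"
    and 2: "poly q' t0 \<noteq> 0" "P' \<in> carrier_mat n n"
      "\<And>t. poly q' t \<noteq> 0 \<Longrightarrow> E t \<and> poly q' t \<cdot>\<^sub>m G t = map_mat (\<lambda>p. poly p t) P'"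
    using assms unfolding rational_at_def by blast
  show ?thesis
    unfolding rational_at_def
  proof (intro exI conjI allI impI)
    show "poly (q * q') t0 \<noteq> 0" "q' \<cdot>\<^sub>m P + q \<cdot>\<^sub>m P' \<in> carrier_mat n n" using 1 2 by auto
    fix t assume t: "poly (q * q') t \<noteq> 0"
    then have *: "D t \<and> poly q t \<cdot>\<^sub>m F t = map_mat (\<lambda>p. poly p t) P"
      "E t \<and> poly q' t \<cdot>\<^sub>m G t = map_mat (\<lambda>p. poly p t) P'" using 1(3) 2(3) by auto
    then show "D t" "E t" by auto
    have c: "F t \<in> carrier_mat n n" "G t \<in> carrier_mat n n"
      using * 1(2) 2(2) by (metis carrier_matD carrier_matI index_map_mat(2,3) index_smult_mat(2,3))+
    have eq: "poly q t * F t $$ (i,j) = poly (P $$ (i,j)) t"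
       "poly q' t * G t $$ (i,j) = poly (P' $$ (i,j)) t" if "i < n" "j < n" for i j
      using that 1(2) 2(2) c arg_cong[OF conjunct2[OF *(1)], of "\<lambda>M. M $$ (i,j)"]
        arg_cong[OF conjunct2[OF *(2)], of "\<lambda>M. M $$ (i,j)"] by simp_all
    show "poly (q * q') t \<cdot>\<^sub>m (F t + G t) = map_mat (\<lambda>p. poly p t) (q' \<cdot>\<^sub>m P + q \<cdot>\<^sub>m P')"
      using c 1(2) 2(2) by (intro eq_matI) (auto simp: algebra_simps eq[symmetric])
  qed
qed

lemma rational_at_mult:
  assumes "rational_at n D F t0" "rational_at n E G t0"
  shows "rational_at n (\<lambda>t. D t \<and> E t) (\<lambda>t. F t * G t) t0"
proof -
  obtain q P q' P' where 1: "poly q t0 \<noteq> 0" "P \<in> carrier_mat n n"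
      "\<And>t. poly q t \<noteq> 0 \<Longrightarrow> D t \<and> poly q t \<cdot>\<^sub>m F t = map_mat (\<lambda>p. poly p t) P"
    and 2: "poly q' t0 \<noteq> 0" "P' \<in> carrier_mat n n"
      "\<And>t. poly q' t \<noteq> 0 \<Longrightarrow> E t \<and> poly q' t \<cdot>\<^sub>m G t = map_mat (\<lambda>p. poly p t) P'"
    using assms unfolding rational_at_def by blast
  show ?thesis
    unfolding rational_at_def
  proof (intro exI conjI allI impI)
    show "poly (q * q') t0 \<noteq> 0" "P * P' \<in> carrier_mat n n" using 1 2 by auto
    fix t assume t: "poly (q * q') t \<noteq> 0"
    then have *: "D t \<and> poly q t \<cdot>\<^sub>m F t = map_mat (\<lambda>p. poly p t) P"
      "E t \<and> poly q' t \<cdot>\<^sub>m G t = map_mat (\<lambda>p. poly p t) P'" using 1(3) 2(3) by auto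
    then show "D t" "E t" by auto
    interpret poly_hom: comm_ring_hom "\<lambda>p. poly p t" by (rule comm_ring_hom_poly)
    have c: "F t \<in> carrier_mat n n" "G t \<in> carrier_mat n n"
      using * 1(2) 2(2) by (metis carrier_matD carrier_matI index_map_mat(2,3) index_smult_mat(2,3))+
    have "map_mat (\<lambda>p. poly p t) (P * P') = (poly q t \<cdot>\<^sub>m F t) * (poly q' t \<cdot>\<^sub>m G t)"
      using * poly_hom.mat_hom_mult[OF 1(2) 2(2)] by simp
    also have "\<dots> = (poly (q * q') t) \<cdot>\<^sub>m (F t * G t)"
      using c by (simp add: mult_smult_assoc_mat[of _ n n] mult_smult_distrib[of _ n n] smult_smult_mat mult.commute)
    finally show "poly (q * q') t \<cdot>\<^sub>m (F t * G t) = map_mat (\<lambda>p. poly p t) (P * P')" ..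
  qed
qed

lemma rational_at_affine:
  assumes "A \<in> carrier_mat n n" "B \<in> carrier_mat n n"
  shows "rational_at n (\<lambda>_. True) (\<lambda>t. A + t \<cdot>\<^sub>m (B - A)) t0"
  unfolding rational_at_def
  by (rule exI[of _ 1], rule exI[of _ "mat n n (\<lambda>ij. [: A $$ ij, B $$ ij - A $$ ij :])"])
    (use assms in \<open>auto intro!: eq_matI\<close>)

text \<open>
  The adjugate provides the inverse: if \<open>q F = P\<close>, then \<open>(q det P) F\<^sup>-\<^sup>1 = q\<^sup>2 adj P\<close>, and the new
  denominator is nonzero at \<open>t0\<close> because \<open>F t0\<close> is invertible.
\<close>

lemma rational_at_inv:
  assumes "rational_at n D F t0" "F t0 \<in> Units (matring n)"
  shows "rational_at n (\<lambda>t. D t \<and> F t \<in> Units (matring n)) (\<lambda>t. inv\<^bsub>matring n\<^esub> (F t)) t0"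
proof -
  obtain q P where 1: "poly q t0 \<noteq> 0" "P \<in> carrier_mat n n"
      "\<And>t. poly q t \<noteq> 0 \<Longrightarrow> D t \<and> poly q t \<cdot>\<^sub>m F t = map_mat (\<lambda>p. poly p t) P"
    using assms unfolding rational_at_def by blast
  have det: "det (map_mat (\<lambda>p. poly p t) P) = poly (det P) t" for t
  proof -
    interpret poly_hom: comm_ring_hom "\<lambda>p. poly p t" by (rule comm_ring_hom_poly)
    show ?thesis by simp
  qed
  have adj: "map_mat (\<lambda>p. poly p t) (adj_mat P) = adj_mat (map_mat (\<lambda>p. poly p t) P)" for t
  proof -
    interpret poly_hom: comm_ring_hom "\<lambda>p. poly p t" by (rule comm_ring_hom_poly)
    show ?thesis
      by (rule eq_matI)
        (auto simp: adj_mat_def cofactor_def mat_delete_def poly_hom.hom_det[symmetric]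
          simp del: poly_hom.hom_det intro!: arg_cong[where f = det] eq_matI)
  qed
  show ?thesis
    unfolding rational_at_def
  proof (intro exI conjI allI impI)
    have "poly (det P) t0 = poly q t0 ^ dim_col (F t0) * det (F t0)"
      using det[of t0] 1(3)[OF 1(1)] by (metis det_smult)
    then show "poly (q * det P) t0 \<noteq> 0"
      using 1 unit_imp_det_non_zero[OF assms(2)] by auto
    show "(q * q) \<cdot>\<^sub>m adj_mat P \<in> carrier_mat n n" using adj_mat(1)[OF 1(2)] by simp
    fix t assume t: "poly (q * det P) t \<noteq> 0"
    let ?N = "map_mat (\<lambda>p. poly p t) P"
    have *: "D t" "poly q t \<cdot>\<^sub>m F t = ?N" using 1 t by auto
    show "D t" by fact
    have N: "?N \<in> carrier_mat n n" "poly q t \<noteq> 0" "det ?N \<noteq> 0" using 1 t by (auto simp: det)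
    note inv = inverse_by_adjugate[OF N(1) *(2) N(2,3)]
    show "F t \<in> Units (matring n)" by (rule inv(1))
    have "map_mat (\<lambda>p. poly p t) ((q * q) \<cdot>\<^sub>m adj_mat P) =
        (poly q t * poly q t) \<cdot>\<^sub>m map_mat (\<lambda>p. poly p t) (adj_mat P)"
      by (rule eq_matI) auto
    then show "poly (q * det P) t \<cdot>\<^sub>m inv\<^bsub>matring n\<^esub> (F t) =
        map_mat (\<lambda>p. poly p t) ((q * q) \<cdot>\<^sub>m adj_mat P)"
      using inv(2) by (simp add: det adj)
  qed
qed

lemma rational_at_const: "M \<in> carrier_mat n n \<Longrightarrow> rational_at n (\<lambda>_. True) (\<lambda>_. M) t0"
  unfolding rational_at_def
  by (rule exI[of _ 1], rule exI[of _ "map_mat (\<lambda>c. [:c:]) M"]) (auto intro!: eq_matI)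

definition line :: "('x \<Rightarrow> 'k::field mat) \<Rightarrow> ('x \<Rightarrow> 'k mat) \<Rightarrow> 'k \<Rightarrow> 'x \<Rightarrow> 'k mat" where
  "line A B t x = A x + t \<cdot>\<^sub>m (B x - A x)"

lemma expr_rational_at:
  assumes A: "\<And>x. x \<in> V \<Longrightarrow> A x \<in> carrier_mat n n" and B: "\<And>x. x \<in> V \<Longrightarrow> B x \<in> carrier_mat n n"
    and e: "expr_over V e" "expr_defined n (line A B t0) e"
  shows "rational_at n (\<lambda>t. expr_defined n (line A B t) e) (\<lambda>t. expr_eval n (line A B t) e) t0"
  using e
proof (induction e)
  case (Poly p)
  have L: "line A B t x \<in> carrier_mat n n" if "x \<in> V" for t x
    using A[OF that] B[OF that] by (auto simp: line_def)
  have "p \<in> ncpolys V" using Poly by simp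
  then have "rational_at n (\<lambda>t. True) (\<lambda>t. poly_eval n (line A B t) p) t0"
  proof (induction rule: ncpolys_induct)
    case (const c)
    then show ?case by (simp add: poly_eval_const[OF L] rational_at_const)
  next
    case (var x)
    have "poly_eval n (line A B t) (ncvar x) = A x + t \<cdot>\<^sub>m (B x - A x)" for t
      using poly_eval_var[of V "line A B t" n x, OF L var] unfolding line_def .
    then show ?case using rational_at_affine[OF A[OF var] B[OF var]] by simp
  next
    case (add p q)
    have "poly_eval n (line A B t) (p + q) =
        poly_eval n (line A B t) p + poly_eval n (line A B t) q" for t
      using poly_eval_add[of V "line A B t" n, OF L add(1,2)] .
    then show ?case using rational_at_add[OF add.IH] by simp
  next
    case (mult p q)
    have "poly_eval n (line A B t) (p * q) =
        poly_eval n (line A B t) p * poly_eval n (line A B t) q" for t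
      using poly_eval_mult[of V "line A B t" n, OF L mult(1,2)] .
    then show ?case using rational_at_mult[OF mult.IH] by simp
  qed
  then show ?case by simp
next
  case (Add a b)
  then have "expr_over V a" "expr_over V b" "expr_defined n (line A B t0) a"
    "expr_defined n (line A B t0) b" by simp_all
  from rational_at_add[OF Add.IH(1)[OF this(1,3)] Add.IH(2)[OF this(2,4)]] show ?case by simp
next
  case (Mul a b)
  then have "expr_over V a" "expr_over V b" "expr_defined n (line A B t0) a"
    "expr_defined n (line A B t0) b" by simp_all
  from rational_at_mult[OF Mul.IH(1)[OF this(1,3)] Mul.IH(2)[OF this(2,4)]] show ?case by simp
next
  case (Inv a)
  then have "expr_over V a" "expr_defined n (line A B t0) a"
    "expr_eval n (line A B t0) a \<in> Units (matring n)" by simp_all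
  from rational_at_inv[OF Inv.IH[OF this(1,2)] this(3)] show ?case by simp
qed

section \<open>Direct sums of points and density of domains\<close>

definition block_sum :: "'k::zero mat \<Rightarrow> 'k mat \<Rightarrow> 'k mat" where
  "block_sum M N = four_block_mat M (0\<^sub>m (dim_row M) (dim_col N)) (0\<^sub>m (dim_row N) (dim_col M)) N"

lemma block_sum_closed [simp]:
  "M \<in> carrier_mat n n \<Longrightarrow> N \<in> carrier_mat m m \<Longrightarrow> block_sum M N \<in> carrier_mat (n + m) (n + m)"
  by (simp add: block_sum_def)

lemma block_sum_add:
  fixes M N :: "'k::comm_ring_1 mat"
  assumes "M \<in> carrier_mat n n" "M' \<in> carrier_mat n n" "N \<in> carrier_mat m m" "N' \<in> carrier_mat m m"
  shows "block_sum M N + block_sum M' N' = block_sum (M + M') (N + N')"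
  using assms unfolding block_sum_def by (subst add_four_block_mat[of _ n n _ m _ m]) auto

lemma block_sum_mult:
  fixes M N :: "'k::comm_ring_1 mat"
  assumes "M \<in> carrier_mat n n" "M' \<in> carrier_mat n n" "N \<in> carrier_mat m m" "N' \<in> carrier_mat m m"
  shows "block_sum M N * block_sum M' N' = block_sum (M * M') (N * N')"
  using assms unfolding block_sum_def
  by (subst mult_four_block_mat[of _ n n _ m _ m]) (auto intro!: cong_four_block_mat)

lemma block_sum_scalar:
  "block_sum (c \<cdot>\<^sub>m 1\<^sub>m n) (c \<cdot>\<^sub>m 1\<^sub>m m) = c \<cdot>\<^sub>m (1\<^sub>m (n + m) :: 'k::comm_ring_1 mat)"
  unfolding block_sum_def by (rule eq_matI) auto

lemma block_sum_one: "block_sum (1\<^sub>m n) (1\<^sub>m m) = (1\<^sub>m (n + m) :: 'k::comm_ring_1 mat)"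
  unfolding block_sum_def by (rule eq_matI) auto

lemma block_sum_index:
  assumes "M \<in> carrier_mat n n" "N \<in> carrier_mat m m" "i < n" "j < n"
  shows "block_sum M N $$ (i, j) = M $$ (i, j)"
  using assms unfolding block_sum_def by auto

lemma expr_block_sum:
  fixes A B C :: "'x \<Rightarrow> 'k::field mat"
  assumes A: "\<And>x. x \<in> V \<Longrightarrow> A x \<in> carrier_mat n n" and B: "\<And>x. x \<in> V \<Longrightarrow> B x \<in> carrier_mat m m"
    and C: "\<And>x. x \<in> V \<Longrightarrow> C x = block_sum (A x) (B x)"
    and e: "expr_over V e" "expr_defined n A e" "expr_defined m B e"
  shows "expr_defined (n + m) C e \<and> expr_eval (n + m) C e = block_sum (expr_eval n A e) (expr_eval m B e)"
  using e
proof (induction e)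
  case (Poly p)
  have C': "C x \<in> carrier_mat (n + m) (n + m)" if "x \<in> V" for x
    using A[OF that] B[OF that] C[OF that] by simp
  have "p \<in> ncpolys V" using Poly by simp
  then have "poly_eval (n + m) C p = block_sum (poly_eval n A p) (poly_eval m B p)"
  proof (induction rule: ncpolys_induct)
    case (const c)
    then show ?case
      by (simp add: poly_eval_const[OF A] poly_eval_const[OF B] poly_eval_const[OF C'] block_sum_scalar)
  next
    case (var x)
    then show ?case
      by (simp add: poly_eval_var[of V A, OF A] poly_eval_var[of V B, OF B]
          poly_eval_var[of V C, OF C'] C)
  next
    case (add p q)
    then show ?case
      by (simp add: poly_eval_add[of V A, OF A] poly_eval_add[of V B, OF B]
          poly_eval_add[of V C, OF C'] block_sum_add[of _ n _ _ m] poly_eval_closed[of V A, OF A]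
          poly_eval_closed[of V B, OF B])
  next
    case (mult p q)
    then show ?case
      by (simp add: poly_eval_mult[of V A, OF A] poly_eval_mult[of V B, OF B]
          poly_eval_mult[of V C, OF C'] block_sum_mult[of _ n _ _ m] poly_eval_closed[of V A, OF A]
          poly_eval_closed[of V B, OF B])
  qed
  then show ?case by simp
next
  case (Add a b)
  then show ?case
    by (simp add: block_sum_add[of _ n _ _ m] expr_eval_closed[of V A, OF A] expr_eval_closed[of V B, OF B])
next
  case (Mul a b)
  then show ?case
    by (simp add: block_sum_mult[of _ n _ _ m] expr_eval_closed[of V A, OF A] expr_eval_closed[of V B, OF B])
next
  case (Inv a)
  then have IH: "expr_defined (n + m) C a"
      "expr_eval (n + m) C a = block_sum (expr_eval n A a) (expr_eval m B a)"
    and u: "expr_eval n A a \<in> Units (matring n)" "expr_eval m B a \<in> Units (matring m)"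
    by auto
  note u1 = matring_unit[OF u(1)] and u2 = matring_unit[OF u(2)]
  let ?M = "block_sum (expr_eval n A a) (expr_eval m B a)"
  let ?N = "block_sum (inv\<^bsub>matring n\<^esub> (expr_eval n A a)) (inv\<^bsub>matring m\<^esub> (expr_eval m B a))"
  have c: "?M \<in> carrier_mat (n + m) (n + m)" "?N \<in> carrier_mat (n + m) (n + m)"
    using u1 u2 by auto
  have prod: "?M * ?N = 1\<^sub>m (n + m)" "?N * ?M = 1\<^sub>m (n + m)"
    using u1 u2 by (simp_all add: block_sum_mult[of _ n _ _ m] block_sum_one)
  have "?M \<in> Units (matring (n + m))" "inv\<^bsub>matring (n + m)\<^esub> ?M = ?N"
    by (rule matring_unitI[OF c prod])+
  then show ?case using IH by simp
qed

lemma ncpointsD: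
  assumes "(n, A) \<in> ncpoints V"
  shows "0 < n" "\<And>x. x \<in> V \<Longrightarrow> A x \<in> carrier_mat n n"
  using assms by (auto simp: ncpoints_def PiE_def Pi_def)

lemma restrict_in_ncpoints:
  "0 < n \<Longrightarrow> (\<And>x. x \<in> V \<Longrightarrow> A x \<in> carrier_mat n n) \<Longrightarrow> (n, restrict A V) \<in> ncpoints V"
  by (auto simp: ncpoints_def)

lemma expr_restrict:
  assumes "expr_over V e" "\<And>x. x \<in> V \<Longrightarrow> A x \<in> carrier_mat n n"
  shows "expr_eval n (restrict A V) e = expr_eval n A e"
    "expr_defined n (restrict A V) e = expr_defined n A e"
  using expr_cong[of V e A n "restrict A V", OF assms] by simp_all

lemma expr_dom_iff:
  "(n, A) \<in> expr_dom V e \<longleftrightarrow> (n, A) \<in> ncpoints V \<and> expr_defined n A e"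
  by (simp add: expr_dom_def)

text \<open>
  The \<open>k\<close>-fold direct sum of a point with itself. Its values are block diagonal, and
  the upper left block suffices to recover the value at the given point.
\<close>

lemma point_amplify:
  fixes A :: "'x \<Rightarrow> 'k::field mat"
  assumes A: "(n, A) \<in> ncpoints V" and "0 < k"
  shows "\<exists>B. (k * n, B) \<in> ncpoints V \<and> (\<forall>e. expr_over V e \<and> expr_defined n A e \<longrightarrow>
    expr_defined (k * n) B e \<and>
    (\<forall>i < n. \<forall>j < n. expr_eval (k * n) B e $$ (i, j) = expr_eval n A e $$ (i, j)))"
  using \<open>0 < k\<close>
proof (induction k rule: nat_induct_non_zero)
  case 1
  then show ?case using A by auto
next
  case (Suc k)
  then obtain B where B: "(k * n, B) \<in> ncpoints V"
    and def: "\<And>e. expr_over V e \<Longrightarrow> expr_defined n A e \<Longrightarrow> expr_defined (k * n) B e"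
    by auto
  let ?C = "restrict (\<lambda>x. block_sum (A x) (B x)) V"
  note * = expr_block_sum[of V A n B "k * n" ?C, OF ncpointsD(2)[OF A] ncpointsD(2)[OF B]]
  show ?case
  proof (intro exI conjI allI impI; (elim conjE)?)
    show "(Suc k * n, ?C) \<in> ncpoints V"
      using ncpointsD[OF A] ncpointsD[OF B] by (intro restrict_in_ncpoints) auto
    fix e assume e: "expr_over V e" "expr_defined n A e"
    then show "expr_defined (Suc k * n) ?C e" using *[of e] def by simp
    fix i j assume ij: "i < n" "j < n"
    have "expr_eval (Suc k * n) ?C e = block_sum (expr_eval n A e) (expr_eval (k * n) B e)"
      using *[of e] def e by simp
    then show "expr_eval (Suc k * n) ?C e $$ (i, j) = expr_eval n A e $$ (i, j)"
      using block_sum_index[OF expr_eval_closed[of V A n e, OF ncpointsD(2)[OF A] e]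
          expr_eval_closed[of V B "k * n" e, OF ncpointsD(2)[OF B] e(1) def[OF e]] ij] by simp
  qed
qed

text \<open>
  The entries of the numerator are polynomials with infinitely many zeros, hence zero.
\<close>

lemma rational_at_zero:
  fixes F :: "'k::field_char_0 \<Rightarrow> 'k mat"
  assumes F: "rational_at n D F t0" and "finite Z"
    and 0: "\<And>t. t \<notin> Z \<Longrightarrow> D t \<Longrightarrow> F t = 0\<^sub>m n n"
  shows "F t0 = 0\<^sub>m n n"
proof -
  obtain q P where 1: "poly q t0 \<noteq> 0" "P \<in> carrier_mat n n"
      "\<And>t. poly q t \<noteq> 0 \<Longrightarrow> D t \<and> poly q t \<cdot>\<^sub>m F t = map_mat (\<lambda>p. poly p t) P"
    using F unfolding rational_at_def by blast
  have "finite {t. poly q t = 0}" using 1(1) by (intro poly_roots_finite) auto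
  then have fin: "finite (Z \<union> {t. poly q t = 0})" using \<open>finite Z\<close> by simp
  have P0: "P $$ (i, j) = 0" if ij: "i < n" "j < n" for i j
  proof (rule ccontr)
    assume "P $$ (i, j) \<noteq> 0"
    then have "finite {t. poly (P $$ (i, j)) t = 0}" by (rule poly_roots_finite)
    moreover have "poly (P $$ (i, j)) t = 0" if t: "t \<notin> Z \<union> {t. poly q t = 0}" for t
    proof -
      have "F t = 0\<^sub>m n n" using 1(3)[of t] 0[of t] t by auto
      moreover have "poly q t \<cdot>\<^sub>m F t = map_mat (\<lambda>p. poly p t) P" using 1(3)[of t] t by auto
      ultimately have "poly q t \<cdot>\<^sub>m 0\<^sub>m n n = map_mat (\<lambda>p. poly p t) P" by metis
      from arg_cong[OF this, of "\<lambda>M. M $$ (i, j)"] show ?thesis using ij 1(2) by simp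
    qed
    ultimately have "finite (UNIV :: 'k set)"
      using fin by (metis (mono_tags, lifting) finite_UnI finite_subset mem_Collect_eq subsetI UnCI)
    then show False using infinite_UNIV_char_0 by blast
  qed
  have eq: "poly q t0 \<cdot>\<^sub>m F t0 = map_mat (\<lambda>p. poly p t0) P" using 1 by blast
  have c: "F t0 \<in> carrier_mat n n"
    using eq 1(2) by (metis carrier_matD carrier_matI index_map_mat(2,3) index_smult_mat(2,3))
  have "poly q t0 * F t0 $$ (i, j) = 0" if "i < n" "j < n" for i j
    using arg_cong[OF eq, of "\<lambda>M. M $$ (i, j)"] P0[OF that] that c 1(2) by simp
  then show ?thesis using 1(1) c by (intro eq_matI) auto
qed

lemma rational_at_cofinite:
  assumes "rational_at n D F t0"
  shows "finite {t. \<not> D t}"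
proof -
  obtain q where 1: "poly q t0 \<noteq> 0" "\<And>t. poly q t \<noteq> 0 \<Longrightarrow> D t"
    using assms unfolding rational_at_def by blast
  have "finite {t. poly q t = 0}" using 1(1) by (intro poly_roots_finite) auto
  then show ?thesis by (rule finite_subset[rotated]) (use 1 in auto)
qed

lemma line_points:
  fixes A B :: "'x \<Rightarrow> 'k::field mat"
  assumes "(n, A) \<in> ncpoints V" "(n, B) \<in> ncpoints V" and e: "expr_over V e"
  shows "(n, restrict (line A B t) V) \<in> ncpoints V"
    "expr_eval n (restrict (line A B t) V) e = expr_eval n (line A B t) e"
    "expr_defined n (restrict (line A B t) V) e = expr_defined n (line A B t) e"
    "expr_eval n (line A B 0) e = expr_eval n A e"
    "expr_defined n (line A B 0) e = expr_defined n A e"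
    "expr_defined n (line A B 1) e = expr_defined n B e"
proof -
  note A = ncpointsD[OF assms(1)] and B = ncpointsD[OF assms(2)]
  have L: "line A B t x \<in> carrier_mat n n" if "x \<in> V" for t x
    using A(2)[OF that] B(2)[OF that] by (auto simp: line_def)
  have L0: "line A B 0 x = A x" "line A B 1 x = B x" if "x \<in> V" for x
    using A(2)[OF that] B(2)[OF that] by (auto simp: line_def intro!: eq_matI)
  show "(n, restrict (line A B t) V) \<in> ncpoints V"
    using A(1) L by (rule restrict_in_ncpoints)
  show "expr_eval n (restrict (line A B t) V) e = expr_eval n (line A B t) e"
    "expr_defined n (restrict (line A B t) V) e = expr_defined n (line A B t) e"
    using expr_restrict[of V e "line A B t" n, OF e L] by simp_all
  show "expr_eval n (line A B 0) e = expr_eval n A e"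
    "expr_defined n (line A B 0) e = expr_defined n A e"
    "expr_defined n (line A B 1) e = expr_defined n B e"
    using expr_cong[of V e "line A B 0" n A, OF e L L0(1)]
      expr_cong[of V e "line A B 1" n B, OF e L L0(2)] by simp_all
qed

lemma common_size:
  assumes a: "expr_over V a" "(n, A) \<in> expr_dom V a"
    and b: "expr_over V b" "(m, B) \<in> expr_dom V b"
  obtains A' B' where "(m * n, A') \<in> expr_dom V a" "(m * n, B') \<in> expr_dom V b"
    "\<And>i j. i < n \<Longrightarrow> j < n \<Longrightarrow> expr_eval (m * n) A' a $$ (i, j) = expr_eval n A a $$ (i, j)"
proof -
  have *: "(n, A) \<in> ncpoints V" "(m, B) \<in> ncpoints V" "expr_defined n A a" "expr_defined m B b"
    using a b by (auto simp: expr_dom_iff)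
  obtain A' where A': "(m * n, A') \<in> ncpoints V" "expr_defined (m * n) A' a"
    "\<And>i j. i < n \<Longrightarrow> j < n \<Longrightarrow> expr_eval (m * n) A' a $$ (i, j) = expr_eval n A a $$ (i, j)"
    using point_amplify[OF *(1) ncpointsD(1)[OF *(2)]] * a by blast
  obtain B' where B': "(n * m, B') \<in> ncpoints V" "expr_defined (n * m) B' b"
    using point_amplify[OF *(2) ncpointsD(1)[OF *(1)]] * b by blast
  show ?thesis
    by (rule that[of A' B']) (use A' B' in \<open>simp_all add: expr_dom_iff mult.commute\<close>)
qed

text \<open>
  Enlarge the point \<open>A\<close> and a point in the domain of \<open>c\<close> to a common size and join them by a
  line. On all but finitely many of its points \<open>c\<close> is defined, so that \<open>d\<close> is zero wherever
  it is defined; then \<open>d\<close> is zero at the end \<open>A\<close> of the line too.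
\<close>

lemma expr_dom_dense:
  fixes d c :: "('x, 'k::field_char_0) ratexpr"
  assumes d: "expr_over V d" "(n, A) \<in> expr_dom V d" and c: "c \<in> ratexprs V"
    and 0: "\<And>m B. (m, B) \<in> expr_dom V d \<Longrightarrow> (m, B) \<in> expr_dom V c \<Longrightarrow> expr_eval m B d = 0\<^sub>m m m"
  shows "expr_eval n A d = 0\<^sub>m n n"
proof -
  obtain m B where B: "expr_over V c" "(m, B) \<in> expr_dom V c" using c by (auto simp: ratexprs_def)
  obtain A' B' where A': "(m * n, A') \<in> expr_dom V d" and B': "(m * n, B') \<in> expr_dom V c"
    and eq: "\<And>i j. i < n \<Longrightarrow> j < n \<Longrightarrow> expr_eval (m * n) A' d $$ (i, j) = expr_eval n A d $$ (i, j)"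
    by (rule common_size[OF d B]) (rule that)
  have p: "(m * n, A') \<in> ncpoints V" "expr_defined (m * n) A' d" 
    "(m * n, B') \<in> ncpoints V" "expr_defined (m * n) B' c"
    using A' B' by (auto simp: expr_dom_iff)
  note lp = line_points[OF p(1,3)]
  note cl = ncpointsD(2)[OF p(1)] ncpointsD(2)[OF p(3)]
  have rd: "rational_at (m * n) (\<lambda>t. expr_defined (m * n) (line A' B' t) d)
      (\<lambda>t. expr_eval (m * n) (line A' B' t) d) 0"
    by (rule expr_rational_at[OF cl d(1)], assumption, assumption, rule iffD2[OF lp(5)[OF d(1)] p(2)])
  have "rational_at (m * n) (\<lambda>t. expr_defined (m * n) (line A' B' t) c)
      (\<lambda>t. expr_eval (m * n) (line A' B' t) c) 1"
    by (rule expr_rational_at[OF cl B(1)], assumption, assumption, rule iffD2[OF lp(6)[OF B(1)] p(4)])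
  then have "finite {t. \<not> expr_defined (m * n) (line A' B' t) c}" by (rule rational_at_cofinite)
  from rd this have "expr_eval (m * n) (line A' B' 0) d = 0\<^sub>m (m * n) (m * n)"
  proof (rule rational_at_zero)
    fix t
    assume t: "t \<notin> {t. \<not> expr_defined (m * n) (line A' B' t) c}"
      "expr_defined (m * n) (line A' B' t) d"
    have "expr_eval (m * n) (restrict (line A' B' t) V) d = 0\<^sub>m (m * n) (m * n)"
      by (rule 0) (use t lp(1,3)[OF d(1), of t] lp(3)[OF B(1), of t] in \<open>simp_all add: expr_dom_iff\<close>)
    then show "expr_eval (m * n) (line A' B' t) d = 0\<^sub>m (m * n) (m * n)"
      using lp(2)[OF d(1), of t] by simp
  qed
  then have z: "expr_eval (m * n) A' d = 0\<^sub>m (m * n) (m * n)" using lp(4)[OF d(1)] by simp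
  have "(m, B) \<in> ncpoints V" "(n, A) \<in> ncpoints V" "expr_defined n A d"
    using B d by (auto simp: expr_dom_iff)
  then have le: "n \<le> m * n" and c: "expr_eval n A d \<in> carrier_mat n n"
    using expr_eval_closed[OF ncpointsD(2) d(1)] by (auto dest: ncpointsD(1))
  have "i < m * n" if "i < n" for i using that le by (rule less_le_trans)
  with z c show ?thesis by (intro eq_matI) (auto simp: eq[symmetric])
qed

text \<open>
  On the line that joins two enlarged points, each of the two expressions is defined at all but
  finitely many points, and the field is infinite.
\<close>

lemma expr_dom_inter_nonempty:
  fixes a b :: "('x, 'k::field_char_0) ratexpr"
  assumes "a \<in> ratexprs V" "b \<in> ratexprs V"
  shows "expr_dom V a \<inter> expr_dom V b \<noteq> {}"
proof
  assume empty: "expr_dom V a \<inter> expr_dom V b = {}"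
  obtain n A m B where a: "expr_over V a" "(n, A) \<in> expr_dom V a"
    and b: "expr_over V b" "(m, B) \<in> expr_dom V b"
    using assms by (fastforce simp: ratexprs_def)
  obtain A' B' where A': "(m * n, A') \<in> expr_dom V a" and B': "(m * n, B') \<in> expr_dom V b"
    by (rule common_size[OF a b]) (rule that)
  have p: "(m * n, A') \<in> ncpoints V" "expr_defined (m * n) A' a" 
    "(m * n, B') \<in> ncpoints V" "expr_defined (m * n) B' b"
    using A' B' by (auto simp: expr_dom_iff)
  note lp = line_points[OF p(1,3)]
  note cl = ncpointsD(2)[OF p(1)] ncpointsD(2)[OF p(3)]
  have "rational_at (m * n) (\<lambda>t. expr_defined (m * n) (line A' B' t) a)
      (\<lambda>t. expr_eval (m * n) (line A' B' t) a) 0"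
    by (rule expr_rational_at[OF cl a(1)], assumption, assumption, rule iffD2[OF lp(5)[OF a(1)] p(2)])
  moreover have "rational_at (m * n) (\<lambda>t. expr_defined (m * n) (line A' B' t) b)
      (\<lambda>t. expr_eval (m * n) (line A' B' t) b) 1"
    by (rule expr_rational_at[OF cl b(1)], assumption, assumption, rule iffD2[OF lp(6)[OF b(1)] p(4)])
  ultimately have "finite ({t. \<not> expr_defined (m * n) (line A' B' t) a} \<union>
      {t. \<not> expr_defined (m * n) (line A' B' t) b})"
    by (intro finite_UnI) (rule rational_at_cofinite, assumption)+
  then obtain t where "expr_defined (m * n) (line A' B' t) a" "expr_defined (m * n) (line A' B' t) b"
    using ex_new_if_finite[OF infinite_UNIV_char_0] by blast
  then have "(m * n, restrict (line A' B' t) V) \<in> expr_dom V a \<inter> expr_dom V b"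
    using lp(1,3)[OF a(1), of t] lp(3)[OF b(1), of t] by (simp add: expr_dom_iff)
  then show False using empty by blast
qed

section \<open>The ring of rational functions\<close>

lemma ratexprsI: "expr_over V e \<Longrightarrow> (n, A) \<in> expr_dom V e \<Longrightarrow> e \<in> ratexprs V"
  by (auto simp: ratexprs_def)

lemma expr_dom_simps [simp]:
  "expr_dom V (Add a b) = expr_dom V a \<inter> expr_dom V b"
  "expr_dom V (Mul a b) = expr_dom V a \<inter> expr_dom V b"
  "expr_dom V (Poly p) = ncpoints V"
  by (auto simp: expr_dom_def)

lemma ncpoints_nonempty: "(1, restrict (\<lambda>_. 0\<^sub>m 1 1) V) \<in> ncpoints V"
  by (rule restrict_in_ncpoints) auto

lemma ratexprs_Poly: "p \<in> ncpolys V \<Longrightarrow> Poly p \<in> ratexprs V"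
  using ncpoints_nonempty by (auto intro!: ratexprsI)

lemma ratexprs_Add:
  fixes a b :: "('x, 'k::field_char_0) ratexpr"
  shows "a \<in> ratexprs V \<Longrightarrow> b \<in> ratexprs V \<Longrightarrow> Add a b \<in> ratexprs V"
  using expr_dom_inter_nonempty[of a V b] by (auto simp: ratexprs_def)

lemma ratexprs_Mul:
  fixes a b :: "('x, 'k::field_char_0) ratexpr"
  shows "a \<in> ratexprs V \<Longrightarrow> b \<in> ratexprs V \<Longrightarrow> Mul a b \<in> ratexprs V"
  using expr_dom_inter_nonempty[of a V b] by (auto simp: ratexprs_def)

lemma expr_dom_closed:
  assumes "expr_over V e" "(n, A) \<in> expr_dom V e"
  shows "expr_eval n A e \<in> carrier_mat n n"
  using assms expr_eval_closed[of V A n e] ncpointsD(2)[of n A V] by (auto simp: expr_dom_iff)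

lemma scalar_mult_mat:
  fixes M :: "'k::comm_ring_1 mat"
  assumes "M \<in> carrier_mat n n"
  shows "c \<cdot>\<^sub>m 1\<^sub>m n * M = c \<cdot>\<^sub>m M" "M * (c \<cdot>\<^sub>m 1\<^sub>m n) = c \<cdot>\<^sub>m M"
  using assms mult_smult_assoc_mat[OF one_carrier_mat assms, of c]
    mult_smult_distrib[OF assms one_carrier_mat, of c] by simp_all

text \<open>
  Pointwise equality on the domain of one further expression \<open>c\<close> already gives equivalence. This
  is where transitivity of the equivalence comes from: \<open>c\<close> is then the middle term, whose domain
  need not meet the domains of the other two in every size.
\<close>

lemma rat_equivI:
  fixes a b c :: "('x, 'k::field_char_0) ratexpr"
  assumes a: "a \<in> ratexprs V" and b: "b \<in> ratexprs V" and c: "c \<in> ratexprs V"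
    and eq: "\<And>n A. (n, A) \<in> expr_dom V a \<Longrightarrow> (n, A) \<in> expr_dom V b \<Longrightarrow> (n, A) \<in> expr_dom V c \<Longrightarrow>
      expr_eval n A a = expr_eval n A b"
  shows "(a, b) \<in> rat_equiv V"
proof -
  \<comment> \<open>The expression for \<open>a - b\<close>.\<close>
  let ?d = "Add a (Mul (Poly (ncconst (-1))) b)"
  have over: "expr_over V a" "expr_over V b" using a b by (auto simp: ratexprs_def)
  have d: "expr_eval n A ?d = expr_eval n A a - expr_eval n A b"
    if "(n, A) \<in> expr_dom V a" "(n, A) \<in> expr_dom V b" for n A
  proof -
    have "(n, A) \<in> ncpoints V" using that by (auto simp: expr_dom_iff)
    note A = ncpointsD(2)[OF this]
    show ?thesis
      using expr_dom_closed[OF over(1) that(1)] expr_dom_closed[OF over(2) that(2)]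
      by (auto simp: poly_eval_const[of V A, OF A] scalar_mult_mat intro!: eq_matI)
  qed
  have "expr_eval n A a = expr_eval n A b"
    if A: "(n, A) \<in> expr_dom V a" "(n, A) \<in> expr_dom V b" for n A
  proof -
    note cl = expr_dom_closed[OF over(1) A(1)] expr_dom_closed[OF over(2) A(2)]
    have "expr_eval n A ?d = 0\<^sub>m n n"
    proof (rule expr_dom_dense[OF _ _ c])
      show "expr_over V ?d" using over by (simp add: ncconst_in_ncpolys)
      show "(n, A) \<in> expr_dom V ?d" using A by (auto simp: expr_dom_iff)
      fix m B assume B: "(m, B) \<in> expr_dom V ?d" "(m, B) \<in> expr_dom V c"
      then have B': "(m, B) \<in> expr_dom V a" "(m, B) \<in> expr_dom V b" by auto
      show "expr_eval m B ?d = 0\<^sub>m m m"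
        using d[OF B'] eq[OF B' B(2)] expr_dom_closed[OF over(2) B'(2)] by auto
    qed
    then have "expr_eval n A a - expr_eval n A b = 0\<^sub>m n n" using d[OF A] by simp
    then have "(expr_eval n A a - expr_eval n A b) $$ (i, j) = 0" if "i < n" "j < n" for i j
      using that by simp
    then show ?thesis using cl by (intro eq_matI) auto
  qed
  then show ?thesis using a b by (auto simp: rat_equiv_def)
qed

lemma rat_equiv_iff:
  "(a, b) \<in> rat_equiv V \<longleftrightarrow> a \<in> ratexprs V \<and> b \<in> ratexprs V \<and>
    (\<forall>n A. (n, A) \<in> expr_dom V a \<longrightarrow> (n, A) \<in> expr_dom V b \<longrightarrow> expr_eval n A a = expr_eval n A b)"
  by (auto simp: rat_equiv_def)

abbreviation rat_class :: "'x set \<Rightarrow> ('x, 'k::field) ratexpr \<Rightarrow> ('x, 'k) ratfun" where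
  "rat_class V a \<equiv> rat_equiv V `` {a}"

lemma equiv_rat_equiv: "equiv (ratexprs V) (rat_equiv V :: (('x, 'k::field_char_0) ratexpr \<times> _) set)"
proof (rule equivI)
  show "rat_equiv V \<subseteq> ratexprs V \<times> ratexprs V" by (auto simp: rat_equiv_iff)
  show "refl_on (ratexprs V) (rat_equiv V :: (('x, 'k) ratexpr \<times> _) set)"
    by (auto simp: refl_on_def rat_equiv_def)
  show "sym (rat_equiv V :: (('x, 'k) ratexpr \<times> _) set)"
    by (auto simp: sym_def rat_equiv_iff)
  show "trans (rat_equiv V :: (('x, 'k) ratexpr \<times> _) set)"
  proof (rule transI)
    fix a b c :: "('x, 'k) ratexpr"
    assume "(a, b) \<in> rat_equiv V" "(b, c) \<in> rat_equiv V"
    then show "(a, c) \<in> rat_equiv V"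
      by (intro rat_equivI[of a V c b]) (auto simp: rat_equiv_iff)
  qed
qed

text \<open>
  Values as a relation, because a rational function has a value only on its domain, and because
  the representative that is defined may vary with the point.
\<close>

definition has_val ::
  "'x set \<Rightarrow> ('x, 'k::field) ratfun \<Rightarrow> nat \<Rightarrow> ('x \<Rightarrow> 'k mat) \<Rightarrow> 'k mat \<Rightarrow> bool" where
  "has_val V F n A M \<longleftrightarrow> (\<exists>e \<in> F. (n, A) \<in> expr_dom V e \<and> M = expr_eval n A e)"

text \<open>
  The parameter \<open>K\<close> serves to fix the coefficient field throughout.
\<close>

context
  fixes V :: "'x set" and K :: "'k::field_char_0 itself"
begin

abbreviation (input) Rat :: "('x, 'k) ratfun set" where "Rat \<equiv> carrier (free_skew_field V)"

lemma rat_class_in: "a \<in> ratexprs V \<Longrightarrow> rat_class V a \<in> Rat"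
  by (simp add: free_skew_field_def quotientI)

lemma rat_repr:
  assumes "F \<in> Rat" "a \<in> F"
  shows "a \<in> ratexprs V" "F = rat_class V a"
proof -
  obtain b where b: "b \<in> ratexprs V" "F = rat_class V b"
    using assms(1) by (auto simp: free_skew_field_def elim: quotientE)
  then have ba: "(b, a) \<in> rat_equiv V" using assms(2) by simp
  then show "a \<in> ratexprs V" by (simp add: rat_equiv_def)
  show "F = rat_class V a" using b(2) equiv_class_eq[OF equiv_rat_equiv ba] by simp
qed

lemma rat_obtain:
  assumes "F \<in> Rat"
  obtains a where "a \<in> F" "a \<in> ratexprs V" "F = rat_class V a"
proof -
  obtain b where b: "b \<in> ratexprs V" "F = rat_class V b"
    using assms by (auto simp: free_skew_field_def elim: quotientE)
  then show ?thesis using that equiv_class_self[OF equiv_rat_equiv b(1)] by auto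
qed

lemma add_rat_class:
  assumes "a \<in> ratexprs V" "b \<in> ratexprs V"
  shows "rat_class V a \<oplus>\<^bsub>free_skew_field V\<^esub> rat_class V b = rat_class V (Add a (b :: ('x, 'k) ratexpr))"
proof -
  have "congruent2 (rat_equiv V) (rat_equiv V) (\<lambda>a b. rat_class V (Add a (b :: ('x, 'k) ratexpr)))"
    by (intro congruent2I' equiv_class_eq[OF equiv_rat_equiv])
      (auto simp: rat_equiv_iff ratexprs_Add)
  then show ?thesis
    unfolding free_skew_field_def
    by (simp add: UN_equiv_class2[OF equiv_rat_equiv equiv_rat_equiv] assms)
qed

lemma mult_rat_class:
  assumes "a \<in> ratexprs V" "b \<in> ratexprs V"
  shows "rat_class V a \<otimes>\<^bsub>free_skew_field V\<^esub> rat_class V b = rat_class V (Mul a (b :: ('x, 'k) ratexpr))"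
proof -
  have "congruent2 (rat_equiv V) (rat_equiv V) (\<lambda>a b. rat_class V (Mul a (b :: ('x, 'k) ratexpr)))"
    by (intro congruent2I' equiv_class_eq[OF equiv_rat_equiv])
      (auto simp: rat_equiv_iff ratexprs_Mul)
  then show ?thesis
    unfolding free_skew_field_def
    by (simp add: UN_equiv_class2[OF equiv_rat_equiv equiv_rat_equiv] assms)
qed

lemma has_val_class:
  assumes "a \<in> ratexprs V" "(n, A) \<in> expr_dom V a"
  shows "has_val V (rat_class V (a :: ('x, 'k) ratexpr)) n A (expr_eval n A a)"
  using assms equiv_class_self[OF equiv_rat_equiv assms(1)] by (auto simp: has_val_def)

lemma has_val_repr:
  assumes "F \<in> Rat" "has_val V F n A M"
  obtains a where "a \<in> ratexprs V" "F = rat_class V a" "(n, A) \<in> expr_dom V a" "M = expr_eval n A a"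
  using assms(2) rat_repr[OF assms(1)] that by (auto simp only: has_val_def)

lemma has_val_unique:
  assumes "F \<in> Rat" "has_val V F n A M" "has_val V F n A N"
  shows "M = N"
proof -
  obtain a b where ab: "a \<in> F" "b \<in> F" and
    *: "(n, A) \<in> expr_dom V a" "M = expr_eval n A a" "(n, A) \<in> expr_dom V b" "N = expr_eval n A b"
    using assms(2,3) by (auto simp: has_val_def)
  have "(a, b) \<in> rat_equiv V" using rat_repr[OF assms(1) ab(1)] ab(2) by auto
  then show ?thesis using * by (auto simp: rat_equiv_iff)
qed

lemma has_val_closed:
  assumes "F \<in> Rat" "has_val V F n A M"
  shows "M \<in> carrier_mat n n" "(n, A) \<in> ncpoints V"
proof -
  obtain e where e: "e \<in> F" "(n, A) \<in> expr_dom V e" "M = expr_eval n A e"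
    using assms(2) by (auto simp: has_val_def)
  then show "M \<in> carrier_mat n n"
    using rat_repr(1)[OF assms(1) e(1)] expr_dom_closed[of V e n A] by (simp add: ratexprs_def)
  show "(n, A) \<in> ncpoints V" using e(2) by (simp add: expr_dom_iff)
qed

lemma has_val_add:
  assumes "F \<in> Rat" "G \<in> Rat" "has_val V F n A M" "has_val V G n A N"
  shows "has_val V (F \<oplus>\<^bsub>free_skew_field V\<^esub> G) n A (M + N)"
proof -
  obtain a where a: "a \<in> ratexprs V" "F = rat_class V a" "(n, A) \<in> expr_dom V a" "M = expr_eval n A a"
    using has_val_repr[OF assms(1,3)] .
  obtain b where b: "b \<in> ratexprs V" "G = rat_class V b" "(n, A) \<in> expr_dom V b" "N = expr_eval n A b"
    using has_val_repr[OF assms(2,4)] .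
  show ?thesis using has_val_class[OF ratexprs_Add[OF a(1) b(1)], of n A] a b by (simp add: add_rat_class)
qed

lemma has_val_mult:
  assumes "F \<in> Rat" "G \<in> Rat" "has_val V F n A M" "has_val V G n A N"
  shows "has_val V (F \<otimes>\<^bsub>free_skew_field V\<^esub> G) n A (M * N)"
proof -
  obtain a where a: "a \<in> ratexprs V" "F = rat_class V a" "(n, A) \<in> expr_dom V a" "M = expr_eval n A a"
    using has_val_repr[OF assms(1,3)] .
  obtain b where b: "b \<in> ratexprs V" "G = rat_class V b" "(n, A) \<in> expr_dom V b" "N = expr_eval n A b"
    using has_val_repr[OF assms(2,4)] .
  show ?thesis using has_val_class[OF ratexprs_Mul[OF a(1) b(1)], of n A] a b by (simp add: mult_rat_class)
qed

lemma rat_dom: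
  assumes "F \<in> Rat"
  obtains a where "a \<in> ratexprs V"
    "\<And>n A. (n, A) \<in> expr_dom V a \<Longrightarrow> \<exists>M \<in> carrier_mat n n. has_val V F n A M"
proof -
  obtain a where a: "a \<in> ratexprs V" "F = rat_class V a" using rat_obtain[OF assms] by metis
  show ?thesis
  proof (rule that[OF a(1)])
    fix n A assume "(n, A) \<in> expr_dom V a"
    then have "has_val V F n A (expr_eval n A a)" using has_val_class[OF a(1)] a(2) by simp
    then show "\<exists>M \<in> carrier_mat n n. has_val V F n A M" using has_val_closed[OF assms] by blast
  qed
qed

lemma rat_eqI:
  assumes "F \<in> Rat" "G \<in> Rat" "c \<in> ratexprs V"
    and eq: "\<And>n A. (n, A) \<in> expr_dom V c \<Longrightarrow> \<exists>M. has_val V F n A M \<and> has_val V G n A M"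
  shows "F = G"
proof -
  obtain a where a: "a \<in> ratexprs V" "F = rat_class V a" using rat_obtain[OF assms(1)] by metis
  obtain b where b: "b \<in> ratexprs V" "G = rat_class V b" using rat_obtain[OF assms(2)] by metis
  have "(a, b) \<in> rat_equiv V"
  proof (rule rat_equivI[OF a(1) b(1) assms(3)])
    fix n A assume *: "(n, A) \<in> expr_dom V a" "(n, A) \<in> expr_dom V b" "(n, A) \<in> expr_dom V c"
    have "has_val V F n A (expr_eval n A a)" "has_val V G n A (expr_eval n A b)"
      using has_val_class[OF a(1) *(1)] has_val_class[OF b(1) *(2)] a b by simp_all
    then show "expr_eval n A a = expr_eval n A b"
      using eq[OF *(3)] has_val_unique[OF assms(1)] has_val_unique[OF assms(2)] by metis
  qed
  then show ?thesis using a b equiv_class_eq[OF equiv_rat_equiv] by simp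
qed

text \<open>
  The form of the previous lemma that suits the ring axioms: an identity in three rational
  functions holds if the corresponding identity of matrices holds at their values.
\<close>

lemma rat_eqI3:
  assumes "F \<in> Rat" "G \<in> Rat" "H1 \<in> Rat" "H2 \<in> Rat" "H3 \<in> Rat"
    and eq: "\<And>n A M1 M2 M3. M1 \<in> carrier_mat n n \<Longrightarrow> M2 \<in> carrier_mat n n \<Longrightarrow> M3 \<in> carrier_mat n n \<Longrightarrow>
      (n, A) \<in> ncpoints V \<Longrightarrow> has_val V H1 n A M1 \<Longrightarrow> has_val V H2 n A M2 \<Longrightarrow> has_val V H3 n A M3 \<Longrightarrow>
      \<exists>M. has_val V F n A M \<and> has_val V G n A M"
  shows "F = G"
proof -
  obtain a where a: "a \<in> ratexprs V"
    "\<And>n A. (n, A) \<in> expr_dom V a \<Longrightarrow> \<exists>M \<in> carrier_mat n n. has_val V H1 n A M"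
    using rat_dom[OF assms(3)] by metis
  obtain b where b: "b \<in> ratexprs V"
    "\<And>n A. (n, A) \<in> expr_dom V b \<Longrightarrow> \<exists>M \<in> carrier_mat n n. has_val V H2 n A M"
    using rat_dom[OF assms(4)] by metis
  obtain c where c: "c \<in> ratexprs V"
    "\<And>n A. (n, A) \<in> expr_dom V c \<Longrightarrow> \<exists>M \<in> carrier_mat n n. has_val V H3 n A M"
    using rat_dom[OF assms(5)] by metis
  show ?thesis
  proof (rule rat_eqI[OF assms(1,2) ratexprs_Add[OF a(1) ratexprs_Add[OF b(1) c(1)]]])
    fix n A assume "(n, A) \<in> expr_dom V (Add a (Add b c))"
    then have *: "(n, A) \<in> expr_dom V a" "(n, A) \<in> expr_dom V b" "(n, A) \<in> expr_dom V c" by auto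
    then show "\<exists>M. has_val V F n A M \<and> has_val V G n A M"
      using a(2)[OF *(1)] b(2)[OF *(2)] c(2)[OF *(3)] eq by (metis expr_dom_iff)
  qed
qed

lemma rat_add_closed: "F \<in> Rat \<Longrightarrow> G \<in> Rat \<Longrightarrow> F \<oplus>\<^bsub>free_skew_field V\<^esub> G \<in> Rat"
  by (metis add_rat_class rat_obtain rat_class_in ratexprs_Add)

lemma rat_mult_closed: "F \<in> Rat \<Longrightarrow> G \<in> Rat \<Longrightarrow> F \<otimes>\<^bsub>free_skew_field V\<^esub> G \<in> Rat"
  by (metis mult_rat_class rat_obtain rat_class_in ratexprs_Mul)

lemma poly_ratfun_closed: "p \<in> ncpolys V \<Longrightarrow> poly_ratfun V p \<in> Rat"
  unfolding poly_ratfun_def by (intro rat_class_in ratexprs_Poly)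

lemma has_val_poly:
  assumes "p \<in> ncpolys V" "(n, A) \<in> ncpoints V"
  shows "has_val V (poly_ratfun V p) n A (poly_eval n A (p :: ('x, 'k) ncpoly))"
  using has_val_class[OF ratexprs_Poly[OF assms(1)], of n A] assms(2) by (simp add: poly_ratfun_def)

lemma has_val_const:
  assumes "(n, A) \<in> ncpoints V"
  shows "has_val V (poly_ratfun V (ncconst c)) n A (c \<cdot>\<^sub>m 1\<^sub>m n :: 'k mat)"
  using has_val_poly[OF ncconst_in_ncpolys assms, of c] poly_eval_const[of V A n c] ncpointsD(2)[OF assms]
  by simp

lemma rat_one: "\<one>\<^bsub>free_skew_field V\<^esub> = (poly_ratfun V (ncconst 1) :: ('x, 'k) ratfun)"
  by (simp add: free_skew_field_def poly_ratfun_def)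

lemma rat_zero: "\<zero>\<^bsub>free_skew_field V\<^esub> = (poly_ratfun V (ncconst 0) :: ('x, 'k) ratfun)"
  by (simp add: free_skew_field_def poly_ratfun_def)

lemma has_val_zero:
  "(n, A) \<in> ncpoints V \<Longrightarrow> has_val V (\<zero>\<^bsub>free_skew_field V\<^esub>) n A (0\<^sub>m n n :: 'k mat)"
proof -
  have "0 \<cdot>\<^sub>m 1\<^sub>m n = (0\<^sub>m n n :: 'k mat)" by (rule eq_matI) auto
  then show "(n, A) \<in> ncpoints V \<Longrightarrow> ?thesis" using has_val_const[of n A 0] by (simp only: rat_zero)
qed

lemma has_val_one:
  "(n, A) \<in> ncpoints V \<Longrightarrow> has_val V (\<one>\<^bsub>free_skew_field V\<^esub>) n A (1\<^sub>m n :: 'k mat)"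
proof -
  have "1 \<cdot>\<^sub>m 1\<^sub>m n = (1\<^sub>m n :: 'k mat)" by (rule eq_matI) auto
  then show "(n, A) \<in> ncpoints V \<Longrightarrow> ?thesis" using has_val_const[of n A 1] by (simp only: rat_one)
qed

text \<open>
  Every axiom is the corresponding axiom for matrices, read at points where all functions
  involved have values.
\<close>

lemma ring_free_skew_field: "ring (free_skew_field V :: ('x, 'k) ratfun ring)"
proof -
  let ?R = "free_skew_field V :: ('x, 'k) ratfun ring"
  note vals = has_val_add has_val_mult has_val_zero has_val_one rat_add_closed rat_mult_closed
  have cl: "\<zero>\<^bsub>?R\<^esub> \<in> Rat" "\<one>\<^bsub>?R\<^esub> \<in> Rat" "poly_ratfun V (ncconst c) \<in> Rat" for c
    using poly_ratfun_closed[OF ncconst_in_ncpolys] by (simp_all only: rat_one rat_zero)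
  have ex: "\<exists>M. has_val V F n A M \<and> has_val V G n A M"
    if "has_val V F n A M" "has_val V G n A N" "M = N" for F G n A M N
    using that by auto
  show ?thesis
  proof (rule ringI)
    show "abelian_group ?R"
    proof (rule abelian_groupI)
      fix F G H assume F: "F \<in> Rat" and G: "G \<in> Rat" and H: "H \<in> Rat"
      show "(F \<oplus>\<^bsub>?R\<^esub> G) \<oplus>\<^bsub>?R\<^esub> H = F \<oplus>\<^bsub>?R\<^esub> (G \<oplus>\<^bsub>?R\<^esub> H)"
        by (rule rat_eqI3[OF _ _ F G H], (rule vals cl F G H)+, rule ex,
          (rule vals cl F G H | assumption)+, rule assoc_add_mat, assumption+)
      show "F \<oplus>\<^bsub>?R\<^esub> G = G \<oplus>\<^bsub>?R\<^esub> F"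
        by (rule rat_eqI3[OF _ _ F G H], (rule vals cl F G H)+, rule ex,
          (rule vals cl F G H | assumption)+, rule comm_add_mat, assumption+)
      show "\<zero>\<^bsub>?R\<^esub> \<oplus>\<^bsub>?R\<^esub> F = F"
        by (rule rat_eqI3[OF _ _ F G H], (rule vals cl F G H)+, rule ex,
          (rule vals cl F G H | assumption)+, rule left_add_zero_mat, assumption+)
      show "\<exists>G\<in>Rat. G \<oplus>\<^bsub>?R\<^esub> F = \<zero>\<^bsub>?R\<^esub>"
      proof
        show N: "poly_ratfun V (ncconst (-1)) \<otimes>\<^bsub>?R\<^esub> F \<in> Rat" by (intro rat_mult_closed cl F)
        show "poly_ratfun V (ncconst (-1)) \<otimes>\<^bsub>?R\<^esub> F \<oplus>\<^bsub>?R\<^esub> F = \<zero>\<^bsub>?R\<^esub>"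
        proof (rule rat_eqI3[OF _ _ F F F])
          fix n A M assume M: "M \<in> carrier_mat n n" "(n, A) \<in> ncpoints V" "has_val V F n A M"
          have "(- 1) \<cdot>\<^sub>m 1\<^sub>m n * M + M = 0\<^sub>m n n"
            using M(1) by (auto simp: scalar_mult_mat intro!: eq_matI)
          then show "\<exists>M. has_val V (poly_ratfun V (ncconst (-1)) \<otimes>\<^bsub>?R\<^esub> F \<oplus>\<^bsub>?R\<^esub> F) n A M \<and>
              has_val V \<zero>\<^bsub>?R\<^esub> n A M"
            by (rule ex[rotated 2]) (rule has_val_add has_val_mult has_val_zero has_val_const M cl F N)+
        qed (rule vals cl F N)+
      qed
    qed (rule cl rat_add_closed, assumption?, assumption?)+
    show "Group.monoid ?R"
    proof (rule monoidI)
      fix F G H assume F: "F \<in> Rat" and G: "G \<in> Rat" and H: "H \<in> Rat"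
      show "(F \<otimes>\<^bsub>?R\<^esub> G) \<otimes>\<^bsub>?R\<^esub> H = F \<otimes>\<^bsub>?R\<^esub> (G \<otimes>\<^bsub>?R\<^esub> H)"
        by (rule rat_eqI3[OF _ _ F G H], (rule vals cl F G H)+, rule ex,
          (rule vals cl F G H | assumption)+, rule assoc_mult_mat, assumption+)
    next
      fix F assume F: "F \<in> Rat"
      note G = F and H = F
      show "\<one>\<^bsub>?R\<^esub> \<otimes>\<^bsub>?R\<^esub> F = F"
        by (rule rat_eqI3[OF _ _ F F F], (rule vals cl F G H)+, rule ex,
          (rule vals cl F G H | assumption)+, rule left_mult_one_mat, assumption+)
      show "F \<otimes>\<^bsub>?R\<^esub> \<one>\<^bsub>?R\<^esub> = F"
        by (rule rat_eqI3[OF _ _ F F F], (rule vals cl F G H)+, rule ex,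
          (rule vals cl F G H | assumption)+, rule right_mult_one_mat, assumption+)
    qed (rule cl rat_mult_closed, assumption?, assumption?)+
    fix F G H assume F: "F \<in> Rat" and G: "G \<in> Rat" and H: "H \<in> Rat"
    show "(F \<oplus>\<^bsub>?R\<^esub> G) \<otimes>\<^bsub>?R\<^esub> H = F \<otimes>\<^bsub>?R\<^esub> H \<oplus>\<^bsub>?R\<^esub> G \<otimes>\<^bsub>?R\<^esub> H"
      by (rule rat_eqI3[OF _ _ F G H], (rule vals cl F G H)+, rule ex,
          (rule vals cl F G H | assumption)+, rule add_mult_distrib_mat, assumption+)
    show "H \<otimes>\<^bsub>?R\<^esub> (F \<oplus>\<^bsub>?R\<^esub> G) = H \<otimes>\<^bsub>?R\<^esub> F \<oplus>\<^bsub>?R\<^esub> H \<otimes>\<^bsub>?R\<^esub> G"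
      by (rule rat_eqI3[OF _ _ F G H], (rule vals cl F G H)+, rule ex,
          (rule vals cl F G H | assumption)+, rule mult_add_distrib_mat, assumption+)
  qed
qed

lemma rat_eq_zero_iff:
  assumes "F \<in> Rat"
  shows "F = \<zero>\<^bsub>free_skew_field V\<^esub> \<longleftrightarrow> (\<forall>n A M. has_val V F n A M \<longrightarrow> M = 0\<^sub>m n n)"
proof
  assume "F = \<zero>\<^bsub>free_skew_field V\<^esub>"
  then show "\<forall>n A M. has_val V F n A M \<longrightarrow> M = 0\<^sub>m n n"
    using has_val_closed[OF assms] has_val_zero has_val_unique[OF assms] by metis
next
  assume 0: "\<forall>n A M. has_val V F n A M \<longrightarrow> M = 0\<^sub>m n n"
  interpret ring "free_skew_field V :: ('x, 'k) ratfun ring" by (rule ring_free_skew_field)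
  show "F = \<zero>\<^bsub>free_skew_field V\<^esub>"
    by (rule rat_eqI3[OF assms zero_closed assms assms assms]) (use 0 has_val_zero in metis)
qed

lemma poly_ratfun_hom:
  "poly_ratfun V \<in> Ring.ring_hom (free_algebra V) (free_skew_field V :: ('x, 'k) ratfun ring)"
proof (rule ring_hom_memI)
  let ?R = "free_skew_field V :: ('x, 'k) ratfun ring"
  fix p q :: "('x, 'k) ncpoly"
  assume "p \<in> carrier (free_algebra V)" 
  then have p: "p \<in> ncpolys V" by (simp add: free_algebra_def)
  show "poly_ratfun V p \<in> carrier ?R" using p by (rule poly_ratfun_closed)
  assume "q \<in> carrier (free_algebra V)"
  then have q: "q \<in> ncpolys V" by (simp add: free_algebra_def)
  have "poly_ratfun V (p * q) = poly_ratfun V p \<otimes>\<^bsub>?R\<^esub> poly_ratfun V q"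
  proof (rule rat_eqI[OF _ _ ratexprs_Poly[OF p]])
    fix n and A :: "'x \<Rightarrow> 'k mat" assume "(n, A) \<in> expr_dom V (Poly p)"
    then have A: "(n, A) \<in> ncpoints V" by simp
    show "\<exists>M. has_val V (poly_ratfun V (p * q)) n A M \<and>
        has_val V (poly_ratfun V p \<otimes>\<^bsub>?R\<^esub> poly_ratfun V q) n A M"
      using has_val_poly[OF mult_in_ncpolys[OF p q] A]
        has_val_mult[OF _ _ has_val_poly[OF p A] has_val_poly[OF q A]] poly_ratfun_closed p q
        poly_eval_mult[OF ncpointsD(2)[OF A] p q] by auto
  qed (intro poly_ratfun_closed rat_mult_closed mult_in_ncpolys p q)+
  then show "poly_ratfun V (p \<otimes>\<^bsub>free_algebra V\<^esub> q) = poly_ratfun V p \<otimes>\<^bsub>?R\<^esub> poly_ratfun V q"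
    by (simp add: free_algebra_def)
  have "poly_ratfun V (p + q) = poly_ratfun V p \<oplus>\<^bsub>?R\<^esub> poly_ratfun V q"
  proof (rule rat_eqI[OF _ _ ratexprs_Poly[OF p]])
    fix n and A :: "'x \<Rightarrow> 'k mat" assume "(n, A) \<in> expr_dom V (Poly p)"
    then have A: "(n, A) \<in> ncpoints V" by simp
    show "\<exists>M. has_val V (poly_ratfun V (p + q)) n A M \<and>
        has_val V (poly_ratfun V p \<oplus>\<^bsub>?R\<^esub> poly_ratfun V q) n A M"
      using has_val_poly[OF add_in_ncpolys[OF p q] A]
        has_val_add[OF _ _ has_val_poly[OF p A] has_val_poly[OF q A]] poly_ratfun_closed p q
        poly_eval_add[OF ncpointsD(2)[OF A] p q] by auto
  qed (intro poly_ratfun_closed rat_add_closed add_in_ncpolys p q)+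
  then show "poly_ratfun V (p \<oplus>\<^bsub>free_algebra V\<^esub> q) = poly_ratfun V p \<oplus>\<^bsub>?R\<^esub> poly_ratfun V q"
    by (simp add: free_algebra_def)
next
  show "poly_ratfun V \<one>\<^bsub>free_algebra V\<^esub> = \<one>\<^bsub>free_skew_field V :: ('x, 'k) ratfun ring\<^esub>"
    by (simp add: free_algebra_def free_skew_field_def poly_ratfun_def)
qed

lemma rat_uminus:
  assumes F: "F \<in> Rat"
  shows "\<ominus>\<^bsub>free_skew_field V\<^esub> F = poly_ratfun V (ncconst (-1)) \<otimes>\<^bsub>free_skew_field V\<^esub> F"
proof -
  let ?R = "free_skew_field V :: ('x, 'k) ratfun ring"
  interpret ring ?R by (rule ring_free_skew_field)
  have "(poly_ratfun V (ncconst (-1)) \<oplus>\<^bsub>?R\<^esub> \<one>\<^bsub>?R\<^esub>) = \<zero>\<^bsub>?R\<^esub>"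
    using ring_hom_add[OF poly_ratfun_hom, of "ncconst (-1)" "ncconst 1"]
    by (simp add: rat_one rat_zero free_algebra_def ncconst_in_ncpolys ncconst_add[symmetric]
        del: ncconst_1 ncconst_0)
  then have "\<ominus>\<^bsub>?R\<^esub> \<one>\<^bsub>?R\<^esub> = poly_ratfun V (ncconst (-1))"
    using poly_ratfun_closed[OF ncconst_in_ncpolys, of "-1"] by (intro minus_equality) auto
  then show ?thesis using F l_minus[of "\<one>\<^bsub>?R\<^esub>" F] by simp
qed

lemma height_le_iff:
  assumes "F \<in> Rat"
  shows "ratfun_height F \<le> h \<longleftrightarrow> (\<exists>e \<in> F. expr_height e \<le> h)"
proof
  obtain a where "a \<in> F" using rat_obtain[OF assms] .
  then have "\<exists>e \<in> F. expr_height e = ratfun_height F"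
    unfolding ratfun_height_def by (rule_tac LeastI_ex) auto
  then show "ratfun_height F \<le> h \<Longrightarrow> \<exists>e \<in> F. expr_height e \<le> h" by (metis)
  assume "\<exists>e \<in> F. expr_height e \<le> h"
  then show "ratfun_height F \<le> h"
    unfolding ratfun_height_def by (metis (mono_tags, lifting) Least_le le_trans)
qed

lemma ratfun_height_class:
  assumes "a \<in> ratexprs V" "expr_height a \<le> h"
  shows "ratfun_height (rat_class V (a :: ('x, 'k) ratexpr)) \<le> h"
  using assms equiv_class_self[OF equiv_rat_equiv assms(1)] rat_class_in[OF assms(1)]
  by (auto simp: height_le_iff)

lemma height_repr:
  assumes "F \<in> Rat" "ratfun_height F \<le> h"
  obtains a where "a \<in> ratexprs V" "F = rat_class V a" "expr_height a \<le> h"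
  using assms height_le_iff[OF assms(1)] rat_repr[OF assms(1)] by metis

text \<open>
  Representatives of height at most \<open>h\<close> are closed under the ring operations on expressions;
  negation is multiplication by the constant \<open>-1\<close>, which has height \<open>0\<close>.
\<close>

lemma subring_height:
  "subring {F \<in> Rat. ratfun_height F \<le> h} (free_skew_field V :: ('x, 'k) ratfun ring)"
proof -
  let ?R = "free_skew_field V :: ('x, 'k) ratfun ring"
  let ?K = "{F \<in> Rat. ratfun_height F \<le> h}"
  interpret ring ?R by (rule ring_free_skew_field)
  have const: "poly_ratfun V (ncconst c) \<in> ?K" for c
    using poly_ratfun_closed[OF ncconst_in_ncpolys] ratfun_height_class[OF ratexprs_Poly[OF ncconst_in_ncpolys]]
    by (simp add: poly_ratfun_def)
  have mult: "F \<otimes>\<^bsub>?R\<^esub> G \<in> ?K" if FG: "F \<in> ?K" "G \<in> ?K" for F G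
  proof -
    obtain a where a: "a \<in> ratexprs V" "F = rat_class V a" "expr_height a \<le> h"
      using FG height_repr[of F h] by blast
    obtain b where b: "b \<in> ratexprs V" "G = rat_class V b" "expr_height b \<le> h"
      using FG height_repr[of G h] by blast
    show ?thesis
      using a b FG ratfun_height_class[OF ratexprs_Mul[OF a(1) b(1)], of h]
      by (simp add: mult_rat_class) (simp add: rat_class_in ratexprs_Mul)
  qed
  have add: "F \<oplus>\<^bsub>?R\<^esub> G \<in> ?K" if FG: "F \<in> ?K" "G \<in> ?K" for F G
  proof -
    obtain a where a: "a \<in> ratexprs V" "F = rat_class V a" "expr_height a \<le> h"
      using FG height_repr[of F h] by blast
    obtain b where b: "b \<in> ratexprs V" "G = rat_class V b" "expr_height b \<le> h"
      using FG height_repr[of G h] by blast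
    show ?thesis
      using a b FG ratfun_height_class[OF ratexprs_Add[OF a(1) b(1)], of h]
      by (simp add: add_rat_class) (simp add: rat_class_in ratexprs_Add)
  qed
  show ?thesis
  proof (rule subringI)
    show "\<one>\<^bsub>?R\<^esub> \<in> ?K" using const[of 1] by (simp only: rat_one)
    fix F assume F: "F \<in> ?K"
    show "\<ominus>\<^bsub>?R\<^esub> F \<in> ?K" using mult[OF const F] F by (simp add: rat_uminus)
  qed (use mult add in auto)
qed

lemma ring_free_skew_field_height:
  "ring (free_skew_field_height V h :: ('x, 'k) ratfun ring)"
  unfolding free_skew_field_height_def
  by (rule ring.subring_is_ring[OF ring_free_skew_field subring_height])

end

section \<open>Adding variables\<close>

lemma ncpoints_restrict:
  assumes "V \<subseteq> X" "(n, A) \<in> ncpoints X"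
  shows "(n, restrict A V) \<in> ncpoints V"
  using assms ncpointsD[OF assms(2)] by (intro restrict_in_ncpoints) auto

lemma ncpoints_extend:
  assumes "V \<subseteq> X" "(n, A) \<in> ncpoints V" "\<And>x. x \<in> X - V \<Longrightarrow> B x \<in> carrier_mat n n"
  shows "(n, \<lambda>x\<in>X. if x \<in> V then A x else B x) \<in> ncpoints X"
    "restrict (\<lambda>x\<in>X. if x \<in> V then A x else B x) V = A"
proof -
  show "(n, \<lambda>x\<in>X. if x \<in> V then A x else B x) \<in> ncpoints X"
    using ncpointsD[OF assms(2)] assms(3) by (intro restrict_in_ncpoints) auto
  show "restrict (\<lambda>x\<in>X. if x \<in> V then A x else B x) V = A"
  proof
    fix x
    have "A \<in> extensional V" using assms(2) by (auto simp: ncpoints_def PiE_def)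
    then show "restrict (\<lambda>x\<in>X. if x \<in> V then A x else B x) V x = A x"
      using assms(1) by (auto simp: restrict_def extensional_def)
  qed
qed

lemma ncpolys_subset: "V \<subseteq> X \<Longrightarrow> ncpolys V \<subseteq> ncpolys X"
  by (fastforce simp: ncpolys_def)

lemma expr_over_mono: "V \<subseteq> X \<Longrightarrow> expr_over V e \<Longrightarrow> expr_over X e"
  using ncpolys_subset by (induction e) auto

lemma expr_restrict_subset:
  assumes "V \<subseteq> X" "expr_over V e" "(n, A) \<in> ncpoints X"
  shows "expr_eval n (restrict A V) e = expr_eval n A e"
    "(n, A) \<in> expr_dom X e \<longleftrightarrow> (n, restrict A V) \<in> expr_dom V e"
  using expr_restrict[OF assms(2), of A n] ncpointsD(2)[OF assms(3)] assms
    ncpoints_restrict[OF assms(1,3)]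
  by (auto simp: expr_dom_iff subset_iff)

lemma ratexprs_mono:
  assumes "V \<subseteq> X" "e \<in> ratexprs V"
  shows "e \<in> ratexprs X"
proof -
  obtain n A where e: "expr_over V e" "(n, A) \<in> expr_dom V e" using assms(2) by (auto simp: ratexprs_def)
  let ?A = "\<lambda>x\<in>X. if x \<in> V then A x else 0\<^sub>m n n"
  have "(n, A) \<in> ncpoints V" using e by (simp add: expr_dom_iff)
  note * = ncpoints_extend[OF assms(1) this, of "\<lambda>_. 0\<^sub>m n n"]
  have "(n, ?A) \<in> expr_dom X e"
    using expr_restrict_subset(2)[OF assms(1) e(1), of n ?A] * e(2) by simp
  then show ?thesis using expr_over_mono[OF assms(1) e(1)] by (intro ratexprsI)
qed

text \<open>
  Points over \<open>X\<close> restrict to points over \<open>V\<close>, and points over \<open>V\<close> extend by zero matrices to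
  points over \<open>X\<close>; neither changes the value of an expression over \<open>V\<close>.
\<close>

lemma rat_equiv_mono:
  assumes V: "V \<subseteq> X" and a: "a \<in> ratexprs V" and b: "b \<in> ratexprs V"
  shows "(a, b) \<in> rat_equiv X \<longleftrightarrow> (a, b) \<in> rat_equiv V"
proof
  have over: "expr_over V a" "expr_over V b" using a b by (auto simp: ratexprs_def)
  show "(a, b) \<in> rat_equiv X" if "(a, b) \<in> rat_equiv V"
    unfolding rat_equiv_iff
  proof (intro conjI allI impI ratexprs_mono[OF V] a b)
    fix n A assume *: "(n, A) \<in> expr_dom X a" "(n, A) \<in> expr_dom X b"
    then have p: "(n, A) \<in> ncpoints X" by (simp add: expr_dom_iff)
    show "expr_eval n A a = expr_eval n A b"
      using that * expr_restrict_subset[OF V over(1) p] expr_restrict_subset[OF V over(2) p]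
      by (auto simp: rat_equiv_iff)
  qed
  show "(a, b) \<in> rat_equiv V" if eq: "(a, b) \<in> rat_equiv X"
    unfolding rat_equiv_iff
  proof (intro conjI allI impI a b)
    fix n A assume *: "(n, A) \<in> expr_dom V a" "(n, A) \<in> expr_dom V b"
    let ?A = "\<lambda>x\<in>X. if x \<in> V then A x else 0\<^sub>m n n"
    have "(n, A) \<in> ncpoints V" using * by (simp add: expr_dom_iff)
    note p = ncpoints_extend[OF V this, of "\<lambda>_. 0\<^sub>m n n"]
    have "(n, ?A) \<in> ncpoints X" using p by simp
    note q = expr_restrict_subset[OF V over(1) this] expr_restrict_subset[OF V over(2) this]
    have "expr_eval n ?A a = expr_eval n ?A b"
      using eq * q(2,4) p(2) by (simp add: rat_equiv_iff)
    then show "expr_eval n A a = expr_eval n A b" using q(1,3) p(2) by simp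
  qed
qed

lemma ratfun_incl_class:
  fixes a :: "('x, 'k::field_char_0) ratexpr"
  assumes V: "V \<subseteq> X" and a: "a \<in> ratexprs V"
  shows "ratfun_incl X (rat_class V a) = rat_class X a"
proof
  have "trans (rat_equiv X :: (('x, 'k) ratexpr \<times> _) set)"
    using equiv_rat_equiv by (rule equivE)
  moreover have "(a, b) \<in> rat_equiv X" if "(a, b) \<in> rat_equiv V" for b
    using that rat_equiv_mono[OF V a, of b] by (simp add: rat_equiv_iff)
  ultimately show "ratfun_incl X (rat_class V a) \<subseteq> rat_class X a"
    unfolding ratfun_incl_def by (auto dest: transD)
  show "rat_class X a \<subseteq> ratfun_incl X (rat_class V a)"
    unfolding ratfun_incl_def using equiv_class_self[OF equiv_rat_equiv a] by auto
qed

lemma ratfun_incl_closed: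
  fixes F :: "('x, 'k::field_char_0) ratfun"
  assumes "V \<subseteq> X" "F \<in> carrier (free_skew_field V)"
  shows "ratfun_incl X F \<in> carrier (free_skew_field X)"
  using rat_obtain[OF assms(2)] ratfun_incl_class[OF assms(1)] ratexprs_mono[OF assms(1)] rat_class_in
  by metis

lemma has_val_incl:
  fixes F :: "('x, 'k::field_char_0) ratfun"
  assumes V: "V \<subseteq> X" and F: "F \<in> carrier (free_skew_field V)" and A: "(n, A) \<in> ncpoints X"
    and M: "has_val V F n (restrict A V) M"
  shows "has_val X (ratfun_incl X F) n A M"
proof -
  obtain a where a: "a \<in> ratexprs V" "F = rat_class V a" "(n, restrict A V) \<in> expr_dom V a"
    "M = expr_eval n (restrict A V) a"
    using has_val_repr[OF F M] .
  have over: "expr_over V a" using a by (simp add: ratexprs_def)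
  note * = expr_restrict_subset[OF V over A]
  show ?thesis
    using has_val_class[OF ratexprs_mono[OF V a(1)], of n A] a * by (simp add: ratfun_incl_class[OF V])
qed

lemma ratfun_incl_poly:
  fixes p :: "('x, 'k::field_char_0) ncpoly"
  assumes "V \<subseteq> X" "p \<in> ncpolys V"
  shows "ratfun_incl X (poly_ratfun V p) = poly_ratfun X p"
  unfolding poly_ratfun_def by (rule ratfun_incl_class[OF assms(1) ratexprs_Poly[OF assms(2)]])

lemma ratfun_incl_hom:
  assumes V: "V \<subseteq> X"
  shows "ratfun_incl X \<in> Ring.ring_hom (free_skew_field V) (free_skew_field X :: ('x, 'k::field_char_0) ratfun ring)"
proof (rule ring_hom_memI)
  fix F G :: "('x, 'k) ratfun"
  assume F: "F \<in> carrier (free_skew_field V)"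
  then show "ratfun_incl X F \<in> carrier (free_skew_field X)" by (rule ratfun_incl_closed[OF V])
  assume G: "G \<in> carrier (free_skew_field V)"
  obtain a where a: "a \<in> ratexprs V" "F = rat_class V a" using rat_obtain[OF F] by metis
  obtain b where b: "b \<in> ratexprs V" "G = rat_class V b" using rat_obtain[OF G] by metis
  show "ratfun_incl X (F \<otimes>\<^bsub>free_skew_field V\<^esub> G) =
      ratfun_incl X F \<otimes>\<^bsub>free_skew_field X\<^esub> ratfun_incl X G"
    using a b ratexprs_mono[OF V a(1)] ratexprs_mono[OF V b(1)]
    by (simp add: mult_rat_class ratfun_incl_class[OF V] ratexprs_Mul)
  show "ratfun_incl X (F \<oplus>\<^bsub>free_skew_field V\<^esub> G) =
      ratfun_incl X F \<oplus>\<^bsub>free_skew_field X\<^esub> ratfun_incl X G"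
    using a b ratexprs_mono[OF V a(1)] ratexprs_mono[OF V b(1)]
    by (simp add: add_rat_class ratfun_incl_class[OF V] ratexprs_Add)
next
  show "ratfun_incl X \<one>\<^bsub>free_skew_field V\<^esub> = \<one>\<^bsub>free_skew_field X :: ('x, 'k) ratfun ring\<^esub>"
    unfolding rat_one by (rule ratfun_incl_poly[OF V ncconst_in_ncpolys])
qed

lemma ratfun_incl_eq_iff:
  fixes F G :: "('x, 'k::field_char_0) ratfun"
  assumes V: "V \<subseteq> X" and F: "F \<in> carrier (free_skew_field V)" and G: "G \<in> carrier (free_skew_field V)"
    and eq: "ratfun_incl X F = ratfun_incl X G"
  shows "F = G"
proof -
  obtain a where a: "a \<in> ratexprs V" "F = rat_class V a" using rat_obtain[OF F] by metis
  obtain b where b: "b \<in> ratexprs V" "G = rat_class V b" using rat_obtain[OF G] by metis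
  have "(a, b) \<in> rat_equiv X"
    using eq a b eq_equiv_class[OF _ equiv_rat_equiv ratexprs_mono[OF V b(1)], of a]
    by (simp add: ratfun_incl_class[OF V])
  then show ?thesis using a b rat_equiv_mono[OF V a(1) b(1)] equiv_class_eq[OF equiv_rat_equiv] by metis
qed

section \<open>Substituting rational functions\<close>

lemma nc_evaluation_rat:
  fixes \<xi> :: "'y \<Rightarrow> ('x, 'k::field_char_0) ratfun"
  assumes \<xi>: "\<And>y. y \<in> W \<Longrightarrow> \<xi> y \<in> carrier (free_skew_field V)"
  shows "nc_evaluation (free_skew_field V) (\<lambda>c. poly_ratfun V (ncconst c)) \<xi> W"
proof -
  let ?R = "free_skew_field V :: ('x, 'k) ratfun ring"
  interpret R: ring ?R by (rule ring_free_skew_field)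
  have c: "poly_ratfun V (ncconst c) \<in> carrier ?R" for c
    by (rule poly_ratfun_closed[OF ncconst_in_ncpolys])
  note hom = ring_hom_add[OF poly_ratfun_hom[of V]] ring_hom_mult[OF poly_ratfun_hom[of V]]
  show ?thesis
  proof (intro nc_evaluation.intro R.ring_axioms nc_evaluation_axioms.intro)
    fix c d :: 'k
    show "poly_ratfun V (ncconst (c + d)) = poly_ratfun V (ncconst c) \<oplus>\<^bsub>?R\<^esub> poly_ratfun V (ncconst d)"
      using hom(1)[of "ncconst c" "ncconst d"] by (simp add: free_algebra_def ncconst_in_ncpolys ncconst_add)
    show "poly_ratfun V (ncconst (c * d)) = poly_ratfun V (ncconst c) \<otimes>\<^bsub>?R\<^esub> poly_ratfun V (ncconst d)"
      using hom(2)[of "ncconst c" "ncconst d"] by (simp add: free_algebra_def ncconst_in_ncpolys ncconst_mult)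
    show "poly_ratfun V (ncconst 1) = \<one>\<^bsub>?R\<^esub>" by (simp only: rat_one)
    fix y assume y: "y \<in> W"
    show "poly_ratfun V (ncconst c) \<otimes>\<^bsub>?R\<^esub> \<xi> y = \<xi> y \<otimes>\<^bsub>?R\<^esub> poly_ratfun V (ncconst c)"
    proof (rule rat_eqI3[OF _ _ \<xi>[OF y] \<xi>[OF y] \<xi>[OF y]])
      fix n A M assume M: "M \<in> carrier_mat n n" "(n, A) \<in> ncpoints V" "has_val V (\<xi> y) n A M"
      have "c \<cdot>\<^sub>m 1\<^sub>m n * M = M * (c \<cdot>\<^sub>m 1\<^sub>m n)" using M by (simp add: scalar_mult_mat)
      then show "\<exists>N. has_val V (poly_ratfun V (ncconst c) \<otimes>\<^bsub>?R\<^esub> \<xi> y) n A N \<and>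
          has_val V (\<xi> y \<otimes>\<^bsub>?R\<^esub> poly_ratfun V (ncconst c)) n A N"
        using has_val_mult[OF c \<xi>[OF y] has_val_const[OF M(2)] M(3)]
          has_val_mult[OF \<xi>[OF y] c M(3) has_val_const[OF M(2)]] by metis
    qed (use c \<xi>[OF y] in auto)
  qed (use c \<xi> in auto)
qed

lemma has_val_nc_eval:
  fixes \<xi> :: "'y \<Rightarrow> ('x, 'k::field_char_0) ratfun"
  assumes \<xi>: "\<And>y. y \<in> W \<Longrightarrow> \<xi> y \<in> carrier (free_skew_field V)"
    and A: "(n, A) \<in> ncpoints V" and val: "\<And>y. y \<in> W \<Longrightarrow> has_val V (\<xi> y) n A (Z y)"
    and p: "p \<in> ncpolys W"
  shows "has_val V (nc_eval (free_skew_field V) (\<lambda>c. poly_ratfun V (ncconst c)) \<xi> p) n A (poly_eval n Z p)"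
proof -
  interpret nc_evaluation "free_skew_field V" "\<lambda>c. poly_ratfun V (ncconst c)" \<xi> W
    by (rule nc_evaluation_rat[OF \<xi>])
  have Z: "Z y \<in> carrier_mat n n" if "y \<in> W" for y
    using has_val_closed(1)[OF \<xi>[OF that] val[OF that]] .
  show ?thesis
    using p
  proof (induction rule: ncpolys_induct)
    case (const c)
    show ?case using has_val_const[OF A, of c] by (simp add: eval_const poly_eval_const[of W Z, OF Z])
  next
    case (var y)
    then show ?case using val[OF var] by (simp add: eval_var poly_eval_var[of W Z, OF Z])
  next
    case (add p q)
    then show ?case
      using has_val_add[OF eval_closed eval_closed] by (simp add: eval_add poly_eval_add[of W Z, OF Z])
  next
    case (mult p q)
    then show ?case
      using has_val_mult[OF eval_closed eval_closed] by (simp add: eval_mult poly_eval_mult[of W Z, OF Z])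
  qed
qed

lemma rat_common_dom:
  fixes S :: "('x, 'k::field_char_0) ratfun set"
  assumes "finite S" "S \<subseteq> carrier (free_skew_field V)"
  shows "\<exists>c \<in> ratexprs V. \<forall>n A F. (n, A) \<in> expr_dom V c \<longrightarrow> F \<in> S \<longrightarrow> (\<exists>M. has_val V F n A M)"
  using assms
proof induction
  case empty
  then show ?case using ratexprs_Poly[OF zero_in_ncpolys] by auto
next
  case (insert F S)
  then obtain c where c: "c \<in> ratexprs V"
    "\<And>n A F. (n, A) \<in> expr_dom V c \<Longrightarrow> F \<in> S \<Longrightarrow> \<exists>M. has_val V F n A M" by auto
  obtain a where a: "a \<in> ratexprs V"
    "\<And>n A. (n, A) \<in> expr_dom V a \<Longrightarrow> \<exists>M \<in> carrier_mat n n. has_val V F n A M"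
    using rat_dom[of F V] insert.prems by auto
  show ?case
    by (rule bexI[OF _ ratexprs_Add[OF a(1) c(1)]]) (use a(2) c(2) in \<open>fastforce\<close>)
qed

section \<open>Graphs of rational resolvents\<close>

lemma ratfun_eval_eq:
  fixes F :: "('x, 'k::field_char_0) ratfun"
  assumes "F \<in> carrier (free_skew_field V)" "has_val V F n A M"
  shows "ratfun_eval V F n A = M"
proof -
  have "(\<exists>e \<in> F. (n, A) \<in> expr_dom V e \<and> N = expr_eval n A e) \<longleftrightarrow> N = M" for N
    using has_val_unique[OF assms(1)] assms(2) unfolding has_val_def by blast
  then show ?thesis by (simp add: ratfun_eval_def)
qed

lemma ratfun_dom_iff: "(n, A) \<in> ratfun_dom V F \<longleftrightarrow> (\<exists>M. has_val V F n A M)"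
  by (auto simp: ratfun_dom_def has_val_def)

lemma (in ring) idealI_closed:
  assumes "J \<subseteq> carrier R" "\<zero> \<in> J" "\<And>a b. a \<in> J \<Longrightarrow> b \<in> J \<Longrightarrow> a \<oplus> b \<in> J"
    and l: "\<And>a x. a \<in> J \<Longrightarrow> x \<in> carrier R \<Longrightarrow> x \<otimes> a \<in> J"
    and "\<And>a x. a \<in> J \<Longrightarrow> x \<in> carrier R \<Longrightarrow> a \<otimes> x \<in> J"
  shows "ideal J R"
proof (rule idealI)
  show "ring R" by (rule ring_axioms)
  show "subgroup J (add_monoid R)"
  proof (rule add.subgroupI)
    fix a assume a: "a \<in> J"
    then have "(\<ominus> \<one>) \<otimes> a \<in> J" by (intro l) auto
    then show "\<ominus> a \<in> J" using a assms(1) by (auto simp: l_minus)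
  qed (use assms in auto)
qed (use assms in auto)

text \<open>
  A decomposition of the variables with a tuple of rational functions in the first part of them;
  this unfolds \<open>resolvent_data\<close>.
\<close>

locale resolvent =
  fixes X X' :: "'x set" and r :: "'x \<Rightarrow> ('x, 'k::field_char_0) ratfun"
  assumes finite_X: "finite X" and subset: "X' \<subseteq> X"
    and r_closed: "\<And>j. j \<in> X - X' \<Longrightarrow> r j \<in> carrier (free_skew_field X')"
begin

definition resolved_var :: "'x \<Rightarrow> ('x, 'k) ratfun" where
  "resolved_var x = (if x \<in> X' then poly_ratfun X' (ncvar x) else r x)"

text \<open>
  The homomorphism \<open>f(X', X'') \<mapsto> f(X', r(X'))\<close>.
\<close>

definition resolve :: "('x, 'k) ncpoly \<Rightarrow> ('x, 'k) ratfun" where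
  "resolve = nc_eval (free_skew_field X') (\<lambda>c. poly_ratfun X' (ncconst c)) resolved_var"

definition graph_point :: "nat \<Rightarrow> ('x \<Rightarrow> 'k mat) \<Rightarrow> 'x \<Rightarrow> 'k mat" where
  "graph_point n A = (\<lambda>i \<in> X. if i \<in> X' then A i else ratfun_eval X' (r i) n A)"

lemma resolved_var_closed: "x \<in> X \<Longrightarrow> resolved_var x \<in> carrier (free_skew_field X')"
  by (auto simp: resolved_var_def r_closed intro!: poly_ratfun_closed ncvar_in_ncpolys)

sublocale resolve: nc_evaluation "free_skew_field X'" "\<lambda>c. poly_ratfun X' (ncconst c)" resolved_var X
  rewrites "nc_eval (free_skew_field X') (\<lambda>c. poly_ratfun X' (ncconst c)) resolved_var = resolve"
  by (rule nc_evaluation_rat[OF resolved_var_closed]) (simp_all add: resolve_def)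

lemma tuple_dom_iff:
  "(n, A) \<in> tuple_dom X X' r \<longleftrightarrow>
    (n, A) \<in> ncpoints X' \<and> (\<forall>j \<in> X - X'. has_val X' (r j) n A (ratfun_eval X' (r j) n A))"
proof -
  have "(\<exists>M. has_val X' (r j) n A M) \<longleftrightarrow> has_val X' (r j) n A (ratfun_eval X' (r j) n A)"
    if "j \<in> X - X'" for j
    using ratfun_eval_eq[OF r_closed[OF that]] by metis
  then show ?thesis by (simp add: tuple_dom_def ratfun_dom_iff)
qed

lemma tuple_graph_eq: "tuple_graph X X' r = (\<lambda>(n, A). (n, graph_point n A)) ` tuple_dom X X' r"
  by (simp add: tuple_graph_def graph_point_def)

lemma graph_point:
  assumes "(n, A) \<in> tuple_dom X X' r"
  shows "(n, graph_point n A) \<in> ncpoints X" "restrict (graph_point n A) X' = A"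
proof -
  have "(n, A) \<in> ncpoints X'" using assms by (simp add: tuple_dom_iff)
  note p = ncpoints_extend[OF subset this, of "\<lambda>i. ratfun_eval X' (r i) n A"]
  have "ratfun_eval X' (r i) n A \<in> carrier_mat n n" if "i \<in> X - X'" for i
    using assms that has_val_closed(1)[OF r_closed[OF that]] by (auto simp: tuple_dom_iff)
  with p show "(n, graph_point n A) \<in> ncpoints X" "restrict (graph_point n A) X' = A"
    unfolding graph_point_def by blast+
qed

lemma resolved_var_val:
  assumes "(n, A) \<in> tuple_dom X X' r" "x \<in> X"
  shows "has_val X' (resolved_var x) n A (graph_point n A x)"
proof (cases "x \<in> X'")
  case True
  have A: "(n, A) \<in> ncpoints X'" using assms by (simp add: tuple_dom_iff)
  show ?thesis
    using True assms(2) has_val_poly[OF ncvar_in_ncpolys[OF True] A]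
      poly_eval_var[of X' A n x, OF ncpointsD(2)[OF A]]
    by (simp add: resolved_var_def graph_point_def)
next
  case False
  then show ?thesis using assms by (simp add: resolved_var_def graph_point_def tuple_dom_iff)
qed

lemma resolve_val:
  assumes "(n, A) \<in> tuple_dom X X' r" "f \<in> ncpolys X"
  shows "has_val X' (resolve f) n A (poly_eval n (graph_point n A) f)"
  unfolding resolve_def
  using assms by (intro has_val_nc_eval[of X] resolved_var_closed resolved_var_val) (auto simp: tuple_dom_iff)

lemma generic_dom:
  obtains c where "c \<in> ratexprs X'" "\<And>n A. (n, A) \<in> expr_dom X' c \<Longrightarrow> (n, A) \<in> tuple_dom X X' r"
proof -
  have "finite (r ` (X - X'))" "r ` (X - X') \<subseteq> carrier (free_skew_field X')"
    using finite_X r_closed by auto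
  from rat_common_dom[OF this] obtain c where c: "c \<in> ratexprs X'"
    "\<And>n A F. (n, A) \<in> expr_dom X' c \<Longrightarrow> F \<in> r ` (X - X') \<Longrightarrow> \<exists>M. has_val X' F n A M"
    by blast
  show ?thesis
    by (rule that[OF c(1)]) (use c(2) in \<open>auto simp: tuple_dom_def ratfun_dom_iff expr_dom_iff\<close>)
qed

text \<open>
  The points at which \<open>b\<close> is defined are dense, so the other points of the graph need not be
  tested.
\<close>

lemma resolve_eq_zero_generic:
  assumes f: "f \<in> ncpolys X" and b: "b \<in> ratexprs X'"
    and 0: "\<And>n A. (n, A) \<in> tuple_dom X X' r \<Longrightarrow> (n, A) \<in> expr_dom X' b \<Longrightarrow>
      poly_eval n (graph_point n A) f = 0\<^sub>m n n"
  shows "resolve f = \<zero>\<^bsub>free_skew_field X'\<^esub>"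
proof -
  obtain c where c: "c \<in> ratexprs X'" "\<And>n A. (n, A) \<in> expr_dom X' c \<Longrightarrow> (n, A) \<in> tuple_dom X X' r"
    by (rule generic_dom) (rule that)
  show ?thesis
  proof (rule rat_eqI[OF resolve.eval_closed[OF f] resolve.zero_closed ratexprs_Add[OF b c(1)]])
    fix n and A :: "'x \<Rightarrow> 'k mat" assume "(n, A) \<in> expr_dom X' (Add b c)"
    then have A: "(n, A) \<in> expr_dom X' b" "(n, A) \<in> tuple_dom X X' r" using c(2) by auto
    then have "(n, A) \<in> ncpoints X'" by (simp add: expr_dom_iff)
    then show "\<exists>M. has_val X' (resolve f) n A M \<and> has_val X' \<zero>\<^bsub>free_skew_field X'\<^esub> n A M"
      using resolve_val[OF A(2) f] 0[OF A(2,1)] has_val_zero by metis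
  qed
qed

lemma resolve_eq_zero_iff:
  assumes f: "f \<in> ncpolys X"
  shows "resolve f = \<zero>\<^bsub>free_skew_field X'\<^esub> \<longleftrightarrow> vanishes_on f (tuple_graph X X' r)"
proof
  assume z: "resolve f = \<zero>\<^bsub>free_skew_field X'\<^esub>"
  have "poly_eval n (graph_point n A) f = 0\<^sub>m n n" if A: "(n, A) \<in> tuple_dom X X' r" for n A
    using resolve_val[OF A f] iffD1[OF rat_eq_zero_iff[OF resolve.eval_closed[OF f]] z] by blast
  then show "vanishes_on f (tuple_graph X X' r)" by (auto simp: vanishes_on_def tuple_graph_eq)
next
  assume v: "vanishes_on f (tuple_graph X X' r)"
  show "resolve f = \<zero>\<^bsub>free_skew_field X'\<^esub>"
    by (rule resolve_eq_zero_generic[OF f ratexprs_Poly[OF zero_in_ncpolys]])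
      (use v in \<open>fastforce simp: vanishes_on_def tuple_graph_eq\<close>)
qed

text \<open>
  If \<open>I\<close> is the kernel of \<open>resolve\<close>, the quotient embeds into the rational functions in
  \<open>X'\<close>, and these embed into the rational functions in all variables.
\<close>

lemma quotient_embeds:
  assumes I: "ideal I (free_algebra X)"
    and ker: "\<And>f. f \<in> ncpolys X \<Longrightarrow> f \<in> I \<longleftrightarrow> vanishes_on f (tuple_graph X X' r)"
  shows "\<exists>\<phi> \<in> Ring.ring_hom (free_algebra X Quot I) (free_skew_field X :: ('x, 'k) ratfun ring).
    inj_on \<phi> (carrier (free_algebra X Quot I)) \<and>
    (\<forall>c. \<phi> (I +>\<^bsub>free_algebra X\<^esub> ncconst c) = poly_ratfun X (ncconst c))"
proof -
  let ?h = "\<lambda>f. ratfun_incl X (resolve f)"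
  have "?h \<in> Ring.ring_hom (free_algebra X) (free_skew_field X)"
    using ring_hom_trans[OF resolve.eval_hom ratfun_incl_hom[OF subset]] by (simp add: comp_def)
  then interpret h: ring_hom_ring "free_algebra X" "free_skew_field X" ?h
    by (intro ring_hom_ringI2 ring_free_algebra ring_free_skew_field)
  have zero: "ratfun_incl X \<zero>\<^bsub>free_skew_field X'\<^esub> = \<zero>\<^bsub>free_skew_field X :: ('x, 'k) ratfun ring\<^esub>"
    unfolding rat_zero by (rule ratfun_incl_poly[OF subset ncconst_in_ncpolys])
  have mem: "?h f = \<zero>\<^bsub>free_skew_field X\<^esub> \<longleftrightarrow> f \<in> I" if f: "f \<in> ncpolys X" for f
    using ratfun_incl_eq_iff[OF subset resolve.eval_closed[OF f] resolve.zero_closed] zero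
      resolve_eq_zero_iff[OF f] ker[OF f] by auto
  have carr: "carrier (free_algebra X) = ncpolys X" by (simp add: free_algebra_def)
  have K: "a_kernel (free_algebra X) (free_skew_field X) ?h = I"
    unfolding a_kernel_def' carr using mem ideal.Icarr[OF I, unfolded carr] by blast
  let ?\<phi> = "\<lambda>Y. the_elem (?h ` Y)"
  show ?thesis
  proof (intro bexI[of _ ?\<phi>] conjI allI)
    show "?\<phi> \<in> Ring.ring_hom (free_algebra X Quot I) (free_skew_field X)"
      using h.the_elem_hom unfolding K .
    show "inj_on ?\<phi> (carrier (free_algebra X Quot I))"
      using h.the_elem_inj unfolding K by (intro inj_onI)
    fix c
    have "?\<phi> (I +>\<^bsub>free_algebra X\<^esub> ncconst c) = ?h (ncconst c)"
      using h.the_elem_simp[of "ncconst c"] unfolding K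
      by (simp add: free_algebra_def ncconst_in_ncpolys)
    then show "?\<phi> (I +>\<^bsub>free_algebra X\<^esub> ncconst c) = poly_ratfun X (ncconst c)"
      by (simp add: resolve.eval_const ratfun_incl_poly[OF subset ncconst_in_ncpolys])
  qed
qed

end

section \<open>The resolvent ring and its ideals\<close>

context resolvent
begin

abbreviation coefficient_ring :: "('x, 'k) ratfun ring" where
  "coefficient_ring \<equiv> free_skew_field_height X' (tuple_height X X' r)"
abbreviation R :: "('x, 'k) ratfun ring" where "R \<equiv> resolvent_ring X X' r"

lemma coefficient_ring_simps:
  "carrier coefficient_ring =
    {F \<in> carrier (free_skew_field X'). ratfun_height F \<le> tuple_height X X' r}"
  "mult coefficient_ring = mult (free_skew_field X')"
  "add coefficient_ring = add (free_skew_field X')"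
  "one coefficient_ring = one (free_skew_field X')"
  "zero coefficient_ring = zero (free_skew_field X')"
  by (simp_all add: free_skew_field_height_def)

lemma coefficient_ratfun: "F \<in> carrier coefficient_ring \<Longrightarrow> F \<in> carrier (free_skew_field X')"
  by (simp add: coefficient_ring_simps)

lemma r_in_coefficient_ring:
  assumes "j \<in> X - X'"
  shows "r j \<in> carrier coefficient_ring"
proof -
  have "ratfun_height (r j) \<le> tuple_height X X' r"
    unfolding tuple_height_def by (rule Max_ge) (use assms finite_X in auto)
  then show ?thesis using r_closed[OF assms] by (simp add: coefficient_ring_simps)
qed

lemma poly_in_coefficient_ring:
  assumes "p \<in> ncpolys X'"
  shows "poly_ratfun X' p \<in> carrier coefficient_ring"
  using poly_ratfun_closed[OF assms] ratfun_height_class[OF ratexprs_Poly[OF assms], of "tuple_height X X' r"]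
  by (simp add: coefficient_ring_simps poly_ratfun_def)

lemma ring_coefficient_ring: "ring coefficient_ring"
  by (rule ring_free_skew_field_height)

lemma resolvent_ring_simps:
  "mult R = mult (free_skew_field X)" "add R = add (free_skew_field X)"
  "one R = one (free_skew_field X)" "zero R = zero (free_skew_field X)"
  by (simp_all add: resolvent_ring_def)

lemma generators_closed:
  "ratfun_incl X ` carrier coefficient_ring \<union> poly_ratfun X ` ncpolys X \<subseteq> carrier (free_skew_field X)"
  using ratfun_incl_closed[OF subset] coefficient_ratfun poly_ratfun_closed by blast

lemma subring_resolvent_ring: "subring (carrier R) (free_skew_field X)"
  using ring.generate_ring_is_subring[OF ring_free_skew_field generators_closed]
  by (simp add: resolvent_ring_def)

lemma ring_resolvent_ring: "ring R"
  using ring.generate_ring_is_ring[OF ring_free_skew_field generators_closed]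
  by (simp add: resolvent_ring_def)

lemma resolvent_ring_subset: "u \<in> carrier R \<Longrightarrow> u \<in> carrier (free_skew_field X)"
  using subringE(1)[OF subring_resolvent_ring] by blast

lemma incl_in_resolvent_ring: "F \<in> carrier coefficient_ring \<Longrightarrow> ratfun_incl X F \<in> carrier R"
  by (simp add: resolvent_ring_def generate_ring.incl)

lemma poly_in_resolvent_ring: "p \<in> ncpolys X \<Longrightarrow> poly_ratfun X p \<in> carrier R"
  by (simp add: resolvent_ring_def generate_ring.incl)

text \<open>
  Negation and the unit need no cases of their own: negation is multiplication by a constant
  polynomial, and the unit is one.
\<close>

lemma resolvent_ring_induct [consumes 1, case_names incl poly add mult]:
  assumes "u \<in> carrier R"
    and incl: "\<And>F. F \<in> carrier coefficient_ring \<Longrightarrow> P (ratfun_incl X F)"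
    and poly: "\<And>p. p \<in> ncpolys X \<Longrightarrow> P (poly_ratfun X p)"
    and add: "\<And>u v. u \<in> carrier R \<Longrightarrow> v \<in> carrier R \<Longrightarrow> P u \<Longrightarrow> P v \<Longrightarrow> P (u \<oplus>\<^bsub>free_skew_field X\<^esub> v)"
    and mult: "\<And>u v. u \<in> carrier R \<Longrightarrow> v \<in> carrier R \<Longrightarrow> P u \<Longrightarrow> P v \<Longrightarrow> P (u \<otimes>\<^bsub>free_skew_field X\<^esub> v)"
  shows "P u"
proof -
  let ?G = "ratfun_incl X ` carrier coefficient_ring \<union> poly_ratfun X ` ncpolys X"
  have carr: "carrier R = generate_ring (free_skew_field X) ?G" by (simp add: resolvent_ring_def)
  from assms(1)[unfolded carr] show ?thesis
  proof (induction rule: generate_ring.induct)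
    case one
    show ?case using poly[OF ncconst_in_ncpolys, of 1] by (simp only: rat_one)
  next
    case (incl h)
    then show ?case using assms(2) poly by auto
  next
    case (a_inv h)
    have h: "h \<in> carrier R" using a_inv by (simp add: carr)
    show ?case
      using mult[OF poly_in_resolvent_ring[OF ncconst_in_ncpolys] h poly[OF ncconst_in_ncpolys] a_inv(2), of "-1"]
      by (simp only: rat_uminus[OF resolvent_ring_subset[OF h]])
  next
    case (eng_add h1 h2)
    then show ?case using add by (simp add: carr)
  next
    case (eng_mult h1 h2)
    then show ?case using mult by (simp add: carr)
  qed
qed

lemma graph_incl_val:
  assumes "F \<in> carrier (free_skew_field X')" "(n, A) \<in> tuple_dom X X' r" "has_val X' F n A M"
  shows "has_val X (ratfun_incl X F) n (graph_point n A) M"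
  using has_val_incl[OF subset assms(1) graph_point(1)[OF assms(2)]] assms(3) graph_point(2)[OF assms(2)]
  by simp

text \<open>
  An element of the resolvent ring involves finitely many coefficients besides the entries of
  \<open>r\<close>, and these may fail to be defined at some points of the domain of \<open>r\<close>. Hence it has
  values only at points of the graph over the domain of a further expression.
\<close>

lemma generic_val:
  assumes "u \<in> carrier R"
  shows "\<exists>c \<in> ratexprs X'. \<forall>n A. (n, A) \<in> tuple_dom X X' r \<longrightarrow> (n, A) \<in> expr_dom X' c \<longrightarrow>
    (\<exists>M. has_val X u n (graph_point n A) M)"
  using assms
proof (induction rule: resolvent_ring_induct)
  case (incl F)
  note F = coefficient_ratfun[OF incl]
  obtain a where "a \<in> ratexprs X'"
    "\<And>n A. (n, A) \<in> expr_dom X' a \<Longrightarrow> \<exists>M \<in> carrier_mat n n. has_val X' F n A M"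
    using rat_dom[OF F] by metis
  then show ?case using graph_incl_val[OF F] by (intro bexI[of _ a]) blast+
next
  case (poly p)
  show ?case
    by (rule bexI[OF _ ratexprs_Poly[OF zero_in_ncpolys]]) (use has_val_poly[OF poly graph_point(1)] in blast)
next
  case (add u v)
  then obtain c d where c: "c \<in> ratexprs X'" "d \<in> ratexprs X'"
    and v: "\<And>n A. (n, A) \<in> tuple_dom X X' r \<Longrightarrow> (n, A) \<in> expr_dom X' c \<Longrightarrow> \<exists>M. has_val X u n (graph_point n A) M"
      "\<And>n A. (n, A) \<in> tuple_dom X X' r \<Longrightarrow> (n, A) \<in> expr_dom X' d \<Longrightarrow> \<exists>M. has_val X v n (graph_point n A) M"
    by blast
  show ?case
  proof (intro bexI[OF _ ratexprs_Add[OF c]] allI impI)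
    fix n A assume A: "(n, A) \<in> tuple_dom X X' r" "(n, A) \<in> expr_dom X' (Add c d)"
    then obtain M N where "has_val X u n (graph_point n A) M" "has_val X v n (graph_point n A) N"
      using v[OF A(1)] by auto
    then show "\<exists>M. has_val X (u \<oplus>\<^bsub>free_skew_field X\<^esub> v) n (graph_point n A) M"
      using has_val_add[OF resolvent_ring_subset resolvent_ring_subset] add by blast
  qed
next
  case (mult u v)
  then obtain c d where c: "c \<in> ratexprs X'" "d \<in> ratexprs X'"
    and v: "\<And>n A. (n, A) \<in> tuple_dom X X' r \<Longrightarrow> (n, A) \<in> expr_dom X' c \<Longrightarrow> \<exists>M. has_val X u n (graph_point n A) M"
      "\<And>n A. (n, A) \<in> tuple_dom X X' r \<Longrightarrow> (n, A) \<in> expr_dom X' d \<Longrightarrow> \<exists>M. has_val X v n (graph_point n A) M"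
    by blast
  show ?case
  proof (intro bexI[OF _ ratexprs_Add[OF c]] allI impI)
    fix n A assume A: "(n, A) \<in> tuple_dom X X' r" "(n, A) \<in> expr_dom X' (Add c d)"
    then obtain M N where "has_val X u n (graph_point n A) M" "has_val X v n (graph_point n A) N"
      using v[OF A(1)] by auto
    then show "\<exists>M. has_val X (u \<otimes>\<^bsub>free_skew_field X\<^esub> v) n (graph_point n A) M"
      using has_val_mult[OF resolvent_ring_subset resolvent_ring_subset] mult by blast
  qed
qed

text \<open>
  The elements that vanish at generic points of the graph. This is an ideal that contains the
  generators of the resolvent ideal, and so bounds it from above.
\<close>

definition graph_ideal :: "('x, 'k) ratfun set" where
  "graph_ideal = {u \<in> carrier R. \<exists>c \<in> ratexprs X'. \<forall>n A. (n, A) \<in> tuple_dom X X' r \<longrightarrow>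
     (n, A) \<in> expr_dom X' c \<longrightarrow> has_val X u n (graph_point n A) (0\<^sub>m n n)}"

lemma graph_idealE:
  assumes "u \<in> graph_ideal"
  obtains c where "u \<in> carrier R" "c \<in> ratexprs X'" "\<And>n A. (n, A) \<in> tuple_dom X X' r \<Longrightarrow>
     (n, A) \<in> expr_dom X' c \<Longrightarrow> has_val X u n (graph_point n A) (0\<^sub>m n n)"
  using assms unfolding graph_ideal_def by blast

lemma ideal_graph_ideal: "ideal graph_ideal R"
proof -
  interpret R: ring R by (rule ring_resolvent_ring)
  show ?thesis
  proof (rule R.idealI_closed)
    show "graph_ideal \<subseteq> carrier R" by (auto simp: graph_ideal_def)
    have "has_val X \<zero>\<^bsub>free_skew_field X\<^esub> n (graph_point n A) (0\<^sub>m n n)"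
      if "(n, A) \<in> tuple_dom X X' r" for n A
      using has_val_zero[OF graph_point(1)[OF that]] .
    then show "\<zero>\<^bsub>R\<^esub> \<in> graph_ideal"
      using R.zero_closed ratexprs_Poly[OF zero_in_ncpolys, of X']
      by (auto simp: graph_ideal_def resolvent_ring_simps)
  next
    fix u v assume u: "u \<in> graph_ideal" and v: "v \<in> graph_ideal"
    obtain c where c: "u \<in> carrier R" "c \<in> ratexprs X'" "\<And>n A. (n, A) \<in> tuple_dom X X' r \<Longrightarrow>
       (n, A) \<in> expr_dom X' c \<Longrightarrow> has_val X u n (graph_point n A) (0\<^sub>m n n)"
      by (rule graph_idealE[OF u]) (rule that)
    obtain d where d: "v \<in> carrier R" "d \<in> ratexprs X'" "\<And>n A. (n, A) \<in> tuple_dom X X' r \<Longrightarrow>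
       (n, A) \<in> expr_dom X' d \<Longrightarrow> has_val X v n (graph_point n A) (0\<^sub>m n n)"
      by (rule graph_idealE[OF v]) (rule that)
    have "has_val X (u \<oplus>\<^bsub>free_skew_field X\<^esub> v) n (graph_point n A) (0\<^sub>m n n)"
      if "(n, A) \<in> tuple_dom X X' r" "(n, A) \<in> expr_dom X' (Add c d)" for n A
      using has_val_add[OF resolvent_ring_subset[OF c(1)] resolvent_ring_subset[OF d(1)] c(3) d(3), of n A] that
      by simp
    then show "u \<oplus>\<^bsub>R\<^esub> v \<in> graph_ideal"
      using R.a_closed[OF c(1) d(1)] ratexprs_Add[OF c(2) d(2)]
      unfolding graph_ideal_def resolvent_ring_simps by blast
  next
    fix u x assume u: "u \<in> graph_ideal" and x: "x \<in> carrier R"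
    obtain c where c: "u \<in> carrier R" "c \<in> ratexprs X'" "\<And>n A. (n, A) \<in> tuple_dom X X' r \<Longrightarrow>
       (n, A) \<in> expr_dom X' c \<Longrightarrow> has_val X u n (graph_point n A) (0\<^sub>m n n)"
      by (rule graph_idealE[OF u]) (rule that)
    obtain d where d: "d \<in> ratexprs X'" "\<And>n A. (n, A) \<in> tuple_dom X X' r \<Longrightarrow>
       (n, A) \<in> expr_dom X' d \<Longrightarrow> \<exists>M. has_val X x n (graph_point n A) M"
      using generic_val[OF x] by blast
    note xu = resolvent_ring_subset[OF x] resolvent_ring_subset[OF c(1)]
    have *: "has_val X (x \<otimes>\<^bsub>free_skew_field X\<^esub> u) n (graph_point n A) (0\<^sub>m n n) \<and>
        has_val X (u \<otimes>\<^bsub>free_skew_field X\<^esub> x) n (graph_point n A) (0\<^sub>m n n)"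
      if A: "(n, A) \<in> tuple_dom X X' r" "(n, A) \<in> expr_dom X' (Add c d)" for n A
    proof -
      obtain M where M: "has_val X x n (graph_point n A) M" using d(2)[OF A(1)] A(2) by auto
      have "M \<in> carrier_mat n n" using has_val_closed(1)[OF xu(1) M] .
      moreover have "has_val X u n (graph_point n A) (0\<^sub>m n n)" using c(3)[OF A(1)] A(2) by auto
      ultimately show ?thesis
        using has_val_mult[OF xu(1,2) M] has_val_mult[OF xu(2,1) _ M] by fastforce
    qed
    then show "x \<otimes>\<^bsub>R\<^esub> u \<in> graph_ideal"
      using R.m_closed[OF x c(1)] ratexprs_Add[OF c(2) d(1)]
      unfolding graph_ideal_def resolvent_ring_simps by blast
    show "u \<otimes>\<^bsub>R\<^esub> x \<in> graph_ideal"
      using * R.m_closed[OF c(1) x] ratexprs_Add[OF c(2) d(1)]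
      unfolding graph_ideal_def resolvent_ring_simps by blast
  qed
qed

lemma relation_closed:
  assumes "j \<in> X - X'"
  shows "poly_ratfun X (ncvar j) \<in> carrier R" "ratfun_incl X (r j) \<in> carrier R"
    "poly_ratfun X (ncvar j) \<ominus>\<^bsub>R\<^esub> ratfun_incl X (r j) \<in> carrier R"
proof -
  interpret R: ring R by (rule ring_resolvent_ring)
  show 1: "poly_ratfun X (ncvar j) \<in> carrier R" "ratfun_incl X (r j) \<in> carrier R"
    using assms by (auto intro!: poly_in_resolvent_ring incl_in_resolvent_ring ncvar_in_ncpolys r_in_coefficient_ring)
  show "poly_ratfun X (ncvar j) \<ominus>\<^bsub>R\<^esub> ratfun_incl X (r j) \<in> carrier R"
    using 1 by (rule R.minus_closed)
qed

text \<open>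
  At a generic point of the graph, the relation, \<open>r\<^sub>j\<close> and \<open>X''\<^sub>j\<close> have values \<open>M\<close>, \<open>N\<close> and
  \<open>M + N\<close>; as the point lies on the graph, the last is \<open>N\<close>, so that \<open>M\<close> is zero.
\<close>

lemma relation_in_graph_ideal:
  assumes j: "j \<in> X - X'"
  shows "poly_ratfun X (ncvar j) \<ominus>\<^bsub>R\<^esub> ratfun_incl X (r j) \<in> graph_ideal"
proof -
  interpret R: ring R by (rule ring_resolvent_ring)
  note cl = relation_closed[OF j]
  let ?u = "poly_ratfun X (ncvar j) \<ominus>\<^bsub>R\<^esub> ratfun_incl X (r j)"
  have sum: "?u \<oplus>\<^bsub>R\<^esub> ratfun_incl X (r j) = poly_ratfun X (ncvar j)"
    using cl by (simp add: a_minus_def R.a_assoc R.l_neg)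
  obtain c where c: "c \<in> ratexprs X'" "\<And>n A. (n, A) \<in> tuple_dom X X' r \<Longrightarrow>
       (n, A) \<in> expr_dom X' c \<Longrightarrow> \<exists>M. has_val X ?u n (graph_point n A) M"
    using generic_val[OF cl(3)] by blast
  have "has_val X ?u n (graph_point n A) (0\<^sub>m n n)"
    if A: "(n, A) \<in> tuple_dom X X' r" "(n, A) \<in> expr_dom X' c" for n A
  proof -
    obtain M where M: "has_val X ?u n (graph_point n A) M" using c(2)[OF A] by blast
    note p = graph_point(1)[OF A(1)]
    let ?N = "graph_point n A j"
    have N: "has_val X (ratfun_incl X (r j)) n (graph_point n A) ?N"
      using resolved_var_val[OF A(1), of j] j
      by (intro graph_incl_val r_closed j A(1)) (simp add: resolved_var_def)
    have jX: "j \<in> X" using j by simp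
    have "poly_eval n (graph_point n A) (ncvar j) = ?N"
      using poly_eval_var[of X "graph_point n A" n j, OF ncpointsD(2)[OF p] jX] .
    then have V: "has_val X (poly_ratfun X (ncvar j)) n (graph_point n A) ?N"
      using has_val_poly[OF ncvar_in_ncpolys[OF jX] p] by simp
    note rs = resolvent_ring_subset[OF cl(1)] resolvent_ring_subset[OF cl(2)] resolvent_ring_subset[OF cl(3)]
    have "has_val X (poly_ratfun X (ncvar j)) n (graph_point n A) (M + ?N)"
      using has_val_add[OF rs(3,2) M N] sum by (simp add: resolvent_ring_simps)
    then have eq: "M + ?N = ?N" using has_val_unique[OF rs(1) _ V] by blast
    have Mc: "M \<in> carrier_mat n n" and Nc: "?N \<in> carrier_mat n n"
      using has_val_closed(1)[OF rs(3) M] has_val_closed(1)[OF rs(2) N] .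
    have "M $$ (a, b) = 0" if "a < n" "b < n" for a b
      using arg_cong[OF eq, of "\<lambda>M. M $$ (a, b)"] that Nc by simp
    then have "M = 0\<^sub>m n n" using Mc by (intro eq_matI) auto
    then show ?thesis using M by simp
  qed
  then show ?thesis using cl(3) c(1) unfolding graph_ideal_def by blast
qed

lemma ideal_resolvent_ideal: "ideal (resolvent_ideal X X' r) R"
  unfolding resolvent_ideal_def
  using relation_closed(3) by (intro ring.genideal_ideal[OF ring_resolvent_ring]) auto

lemma relation_in_resolvent_ideal:
  "j \<in> X - X' \<Longrightarrow> poly_ratfun X (ncvar j) \<ominus>\<^bsub>R\<^esub> ratfun_incl X (r j) \<in> resolvent_ideal X X' r"
  unfolding resolvent_ideal_def
  using relation_closed(3) ring.genideal_self[OF ring_resolvent_ring,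
      of "{poly_ratfun X (ncvar j) \<ominus>\<^bsub>R\<^esub> ratfun_incl X (r j) | j. j \<in> X - X'}"] by blast

lemma resolvent_ideal_subset: "resolvent_ideal X X' r \<subseteq> graph_ideal"
  unfolding resolvent_ideal_def
  using relation_in_graph_ideal by (intro ring.genideal_minimal[OF ring_resolvent_ring ideal_graph_ideal]) auto

lemma resolve_zero_of_mem:
  assumes f: "f \<in> ncpolys X" and mem: "poly_ratfun X f \<in> resolvent_ideal X X' r"
  shows "resolve f = \<zero>\<^bsub>free_skew_field X'\<^esub>"
proof -
  have "poly_ratfun X f \<in> graph_ideal" using mem resolvent_ideal_subset by blast
  then obtain c where c: "c \<in> ratexprs X'" "\<And>n A. (n, A) \<in> tuple_dom X X' r \<Longrightarrow>
       (n, A) \<in> expr_dom X' c \<Longrightarrow> has_val X (poly_ratfun X f) n (graph_point n A) (0\<^sub>m n n)"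
    by (rule graph_idealE) (rule that)
  show ?thesis
  proof (rule resolve_eq_zero_generic[OF f c(1)])
    fix n A assume A: "(n, A) \<in> tuple_dom X X' r" "(n, A) \<in> expr_dom X' c"
    show "poly_eval n (graph_point n A) f = 0\<^sub>m n n"
      using has_val_unique[OF poly_ratfun_closed[OF f] has_val_poly[OF f graph_point(1)[OF A(1)]] c(2)[OF A]] .
  qed
qed

text \<open>
  Modulo the resolvent ideal each variable equals its substitute, hence so does each polynomial.
  For products this is \<open>a b - a' b' = (a - a') b + a' (b - b')\<close>.
\<close>

lemma resolve_cong:
  assumes "p \<in> ncpolys X"
  shows "ratfun_incl X (resolve p) \<in> carrier R \<and>
    poly_ratfun X p \<ominus>\<^bsub>R\<^esub> ratfun_incl X (resolve p) \<in> resolvent_ideal X X' r"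
  using assms
proof (induction rule: ncpolys_induct)
  interpret R: ring R by (rule ring_resolvent_ring)
  interpret J: ideal "resolvent_ideal X X' r" R by (rule ideal_resolvent_ideal)
  note incl = ring_hom_add[OF ratfun_incl_hom[OF subset]] ring_hom_mult[OF ratfun_incl_hom[OF subset]]
  have self: "poly_ratfun X p \<in> carrier R \<and>
      poly_ratfun X p \<ominus>\<^bsub>R\<^esub> poly_ratfun X p \<in> resolvent_ideal X X' r" if "p \<in> ncpolys X" for p
    using poly_in_resolvent_ring[OF that] by (simp add: a_minus_def R.r_neg)
  {
    case (const c)
    show ?case
      using self[OF ncconst_in_ncpolys, of c]
      by (simp add: resolve.eval_const ratfun_incl_poly[OF subset ncconst_in_ncpolys])
  next
    case (var x)
    show ?case
    proof (cases "x \<in> X'")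
      case True
      then show ?thesis
        using self[OF ncvar_in_ncpolys[OF var]]
        by (simp add: resolve.eval_var[OF var] resolved_var_def ratfun_incl_poly[OF subset ncvar_in_ncpolys])
    next
      case False
      then show ?thesis
        using relation_in_resolvent_ideal[of x] relation_closed(2)[of x] var
        by (simp add: resolve.eval_var[OF var] resolved_var_def)
    qed
  next
    case (add p q)
    let ?a = "poly_ratfun X p" and ?b = "poly_ratfun X q"
    let ?a' = "ratfun_incl X (resolve p)" and ?b' = "ratfun_incl X (resolve q)"
    have cl: "?a \<in> carrier R" "?b \<in> carrier R" "?a' \<in> carrier R" "?b' \<in> carrier R"
      using add poly_in_resolvent_ring by auto
    have e1: "ratfun_incl X (resolve (p + q)) = ?a' \<oplus>\<^bsub>R\<^esub> ?b'"
      using add incl(1)[OF resolve.eval_closed resolve.eval_closed] by (simp add: resolve.eval_add resolvent_ring_simps)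
    have e2: "poly_ratfun X (p + q) = ?a \<oplus>\<^bsub>R\<^esub> ?b"
      using ring_hom_add[OF poly_ratfun_hom[of X], of p q] add by (simp add: free_algebra_def resolvent_ring_simps)
    have "(?a \<oplus>\<^bsub>R\<^esub> ?b) \<ominus>\<^bsub>R\<^esub> (?a' \<oplus>\<^bsub>R\<^esub> ?b') = (?a \<ominus>\<^bsub>R\<^esub> ?a') \<oplus>\<^bsub>R\<^esub> (?b \<ominus>\<^bsub>R\<^esub> ?b')"
      using cl by (simp add: a_minus_def R.minus_add R.a_ac)
    then show ?case
      unfolding e1 e2 using add J.a_closed cl by simp
  next
    case (mult p q)
    let ?a = "poly_ratfun X p" and ?b = "poly_ratfun X q"
    let ?a' = "ratfun_incl X (resolve p)" and ?b' = "ratfun_incl X (resolve q)"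
    have cl: "?a \<in> carrier R" "?b \<in> carrier R" "?a' \<in> carrier R" "?b' \<in> carrier R"
      using mult poly_in_resolvent_ring by auto
    have e1: "ratfun_incl X (resolve (p * q)) = ?a' \<otimes>\<^bsub>R\<^esub> ?b'"
      using mult incl(2)[OF resolve.eval_closed resolve.eval_closed] by (simp add: resolve.eval_mult resolvent_ring_simps)
    have e2: "poly_ratfun X (p * q) = ?a \<otimes>\<^bsub>R\<^esub> ?b"
      using ring_hom_mult[OF poly_ratfun_hom[of X], of p q] mult by (simp add: free_algebra_def resolvent_ring_simps)
    have "(?a \<otimes>\<^bsub>R\<^esub> ?b) \<ominus>\<^bsub>R\<^esub> (?a' \<otimes>\<^bsub>R\<^esub> ?b') =
        (?a \<ominus>\<^bsub>R\<^esub> ?a') \<otimes>\<^bsub>R\<^esub> ?b \<oplus>\<^bsub>R\<^esub> ?a' \<otimes>\<^bsub>R\<^esub> (?b \<ominus>\<^bsub>R\<^esub> ?b')"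
    proof -
      have "(?a \<ominus>\<^bsub>R\<^esub> ?a') \<otimes>\<^bsub>R\<^esub> ?b \<oplus>\<^bsub>R\<^esub> ?a' \<otimes>\<^bsub>R\<^esub> (?b \<ominus>\<^bsub>R\<^esub> ?b') =
          ?a \<otimes>\<^bsub>R\<^esub> ?b \<oplus>\<^bsub>R\<^esub> (\<ominus>\<^bsub>R\<^esub> (?a' \<otimes>\<^bsub>R\<^esub> ?b) \<oplus>\<^bsub>R\<^esub> (?a' \<otimes>\<^bsub>R\<^esub> ?b \<oplus>\<^bsub>R\<^esub> \<ominus>\<^bsub>R\<^esub> (?a' \<otimes>\<^bsub>R\<^esub> ?b')))"
        using cl by (simp add: a_minus_def R.l_distr R.r_distr R.l_minus R.r_minus R.a_assoc)
      also have "\<dots> = (?a \<otimes>\<^bsub>R\<^esub> ?b) \<ominus>\<^bsub>R\<^esub> (?a' \<otimes>\<^bsub>R\<^esub> ?b')"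
        using cl by (simp add: a_minus_def R.r_neg1)
      finally show ?thesis ..
    qed
    then show ?case
      unfolding e1 e2 using mult J.a_closed J.I_l_closed J.I_r_closed cl by simp
  }
qed

lemma mem_of_resolve_zero:
  assumes f: "f \<in> ncpolys X" and 0: "resolve f = \<zero>\<^bsub>free_skew_field X'\<^esub>"
  shows "poly_ratfun X f \<in> resolvent_ideal X X' r"
proof -
  interpret R: ring R by (rule ring_resolvent_ring)
  have "ratfun_incl X (resolve f) = \<zero>\<^bsub>R\<^esub>"
    unfolding 0 resolvent_ring_simps rat_zero by (rule ratfun_incl_poly[OF subset ncconst_in_ncpolys])
  then show ?thesis
    using resolve_cong[OF f] poly_in_resolvent_ring[OF f] by (simp add: a_minus_def)
qed

end

section \<open>Alternating monomials\<close>

text \<open>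
  Each of finitely many scalar functions on \<open>\<Omega>\<close> is recovered linearly from its values at suitable
  points \<open>p i\<close>, by functions \<open>\<Sum>u. G i u * val u\<close> in their span. This finite dual basis
  replaces the choice of a basis of the space of coefficients in a tensor product argument.
  
  In the induction, let \<open>t\<close> be the error that the points and functions found so far leave for the
  new function \<open>s\<close>. If \<open>t\<close> is not zero, say at \<open>z\<close>, then \<open>z\<close> becomes a further point with the
  function \<open>t / t z\<close>, and the old functions are corrected by multiples of \<open>t\<close> so as to vanish at \<open>z\<close>.
\<close>

lemma reproducing_points:
  fixes val :: "'s \<Rightarrow> 'o \<Rightarrow> 'k::field"
  assumes "finite S"
  shows "\<exists>(m::nat) p G. (\<forall>i<m. p i \<in> \<Omega>) \<and>
    (\<forall>s\<in>S. \<forall>\<omega>\<in>\<Omega>. val s \<omega> = (\<Sum>i<m. val s (p i) * (\<Sum>u\<in>S. G i u * val u \<omega>)))"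
  using assms
proof induction
  case empty
  then show ?case by (intro exI[of _ 0]) simp
next
  case (insert s S)
  from insert.IH obtain m :: nat and p G where pG: "(\<forall>i<m. p i \<in> \<Omega>) \<and>
    (\<forall>s'\<in>S. \<forall>\<omega>\<in>\<Omega>. val s' \<omega> = (\<Sum>i<m. val s' (p i) * (\<Sum>u\<in>S. G i u * val u \<omega>)))"
    by (elim exE) (rule that)
  note p = conjunct1[OF pG] and G = conjunct2[OF pG]
  define g where "g i \<omega> = (\<Sum>u\<in>S. G i u * val u \<omega>)" for i \<omega>
  define t where "t \<omega> = val s \<omega> - (\<Sum>i<m. val s (p i) * g i \<omega>)" for \<omega>
  have G': "val s' \<omega> = (\<Sum>i<m. val s' (p i) * g i \<omega>)" if "s' \<in> S" "\<omega> \<in> \<Omega>" for s' \<omega>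
    using G that by (simp add: g_def)
  define H where "H i u = (if u = s then 0 else G i u)" for i u
  have H: "(\<Sum>u\<in>insert s S. H i u * val u \<omega>) = g i \<omega>" for i \<omega>
    using insert(1,2) by (auto simp: H_def g_def intro!: sum.cong)
  show ?case
  proof (cases "\<forall>\<omega>\<in>\<Omega>. t \<omega> = 0")
    case True
    show ?thesis
    proof (intro exI conjI ballI allI impI)
      fix s' \<omega> assume "s' \<in> insert s S" "\<omega> \<in> \<Omega>"
      then show "val s' \<omega> = (\<Sum>i<m. val s' (p i) * (\<Sum>u\<in>insert s S. H i u * val u \<omega>))"
        using G' True unfolding H by (auto simp: t_def)
    qed (use p in simp)
  next
    case False
    then obtain z where z: "z \<in> \<Omega>" "t z \<noteq> 0" by blast
    define T where "T u = (if u = s then 1 else - (\<Sum>i<m. val s (p i) * G i u))" for u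
    have T: "(\<Sum>u\<in>insert s S. T u * val u \<omega>) = t \<omega>" for \<omega>
    proof -
      have "(\<Sum>u\<in>S. T u * val u \<omega>) = (\<Sum>u\<in>S. - (\<Sum>i<m. val s (p i) * G i u) * val u \<omega>)"
        using insert(2) by (intro sum.cong) (auto simp: T_def)
      also have "\<dots> = - (\<Sum>u\<in>S. \<Sum>i<m. val s (p i) * (G i u * val u \<omega>))"
        by (simp add: sum_negf sum_distrib_right mult.assoc)
      also have "\<dots> = - (\<Sum>i<m. val s (p i) * g i \<omega>)"
        unfolding g_def sum_distrib_left by (subst sum.swap) simp
      finally show ?thesis using insert(1,2) by (simp add: T_def t_def)
    qed
    define p' where "p' i = (if i < m then p i else z)" for i
    define G2 where "G2 i u = (if i < m then H i u - g i z / t z * T u else T u / t z)" for i u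
    have G2: "(\<Sum>u\<in>insert s S. G2 i u * val u \<omega>) =
        (if i < m then g i \<omega> - g i z / t z * t \<omega> else t \<omega> / t z)" for i \<omega>
    proof (cases "i < m")
      case True
      have "(\<Sum>u\<in>insert s S. G2 i u * val u \<omega>) =
          (\<Sum>u\<in>insert s S. H i u * val u \<omega> - g i z / t z * (T u * val u \<omega>))"
        using True by (intro sum.cong) (auto simp: G2_def algebra_simps)
      also have "\<dots> = g i \<omega> - g i z / t z * t \<omega>"
        by (simp only: sum_subtractf H sum_distrib_left[symmetric] T)
      finally show ?thesis using True by simp
    next
      case False
      have "(\<Sum>u\<in>insert s S. G2 i u * val u \<omega>) = (\<Sum>u\<in>insert s S. T u * val u \<omega> / t z)"
        using False by (intro sum.cong) (auto simp: G2_def)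
      also have "\<dots> = t \<omega> / t z" by (simp only: sum_divide_distrib[symmetric] T)
      finally show ?thesis using False by simp
    qed
    show ?thesis
    proof (intro exI conjI ballI allI impI)
      show "p' i \<in> \<Omega>" if "i < Suc m" for i using p z by (simp add: p'_def)
      fix s' \<omega> assume s': "s' \<in> insert s S" and \<omega>: "\<omega> \<in> \<Omega>"
      define a where "a = (\<Sum>i<m. val s' (p i) * g i \<omega>)"
      define b where "b = (\<Sum>i<m. val s' (p i) * g i z)"
      have "(\<Sum>i<Suc m. val s' (p' i) * (\<Sum>u\<in>insert s S. G2 i u * val u \<omega>)) =
          (\<Sum>i<m. val s' (p i) * (g i \<omega> - g i z / t z * t \<omega>)) + val s' z * (t \<omega> / t z)"
        unfolding G2 by (simp add: p'_def)
      also have "(\<Sum>i<m. val s' (p i) * (g i \<omega> - g i z / t z * t \<omega>)) = a - b * (t \<omega> / t z)"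
        unfolding a_def b_def sum_distrib_right sum_subtractf[symmetric]
        by (intro sum.cong) (auto simp: algebra_simps)
      also have "a - b * (t \<omega> / t z) + val s' z * (t \<omega> / t z) = a + (val s' z - b) * (t \<omega> / t z)"
        by (simp only: left_diff_distrib add_diff_eq diff_add_eq)
      also have "\<dots> = val s' \<omega>"
      proof (cases "s' = s")
        case True
        then have "val s' z - b = t z" "a = val s \<omega> - t \<omega>" by (simp_all add: b_def a_def t_def)
        then show ?thesis using True z by simp
      next
        case False
        then have "val s' z = b" "val s' \<omega> = a" using s' G'[of s'] z \<omega> by (auto simp: a_def b_def)
        then show ?thesis by simp
      qed
      finally show "val s' \<omega> = (\<Sum>i<Suc m. val s' (p' i) * (\<Sum>u\<in>insert s S. G2 i u * val u \<omega>))" ..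
    qed
  qed
qed

text \<open>
  The monomial \<open>a\<^sub>0 x\<^sub>1 a\<^sub>1 \<cdots> x\<^sub>d a\<^sub>d\<close>, in which coefficients are formal variables of their own.
\<close>

fun alt_mono :: "'s \<Rightarrow> ('y \<times> 's) list \<Rightarrow> ('y + 's, 'c::comm_ring_1) ncpoly" where
  "alt_mono a [] = ncvar (Inr a)"
| "alt_mono a ((y, b) # r) = ncvar (Inr a) * (ncvar (Inl y) * alt_mono b r)"

text \<open>
  The value \<open>a\<^sub>0(\<omega>\<^sub>0) \<cdots> a\<^sub>d(\<omega>\<^sub>d)\<close> of the coefficients of a monomial at independent points, that is, of
  the tensor \<open>a\<^sub>0 \<otimes> \<cdots> \<otimes> a\<^sub>d\<close>.
\<close>

fun alt_val :: "('s \<Rightarrow> 'o \<Rightarrow> 'k::comm_ring_1) \<Rightarrow> 's \<Rightarrow> ('y \<times> 's) list \<Rightarrow> 'o list \<Rightarrow> 'k" where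
  "alt_val val a [] \<omega>s = val a (hd \<omega>s)"
| "alt_val val a ((y, b) # r) \<omega>s = val a (hd \<omega>s) * alt_val val b r (tl \<omega>s)"

lemma alt_mono_in:
  assumes "Inr a \<in> W" "\<And>y b. (y, b) \<in> set r \<Longrightarrow> Inl y \<in> W \<and> Inr b \<in> W"
  shows "alt_mono a r \<in> ncpolys W"
  using assms
  by (induction a r rule: alt_mono.induct) (auto intro!: mult_in_ncpolys ncvar_in_ncpolys)

lemma ideal_free_algebraD:
  assumes "ideal N (free_algebra W)"
  shows "0 \<in> N" "p \<in> N \<Longrightarrow> q \<in> N \<Longrightarrow> p + q \<in> N" "p \<in> N \<Longrightarrow> p \<in> ncpolys W"
    "p \<in> N \<Longrightarrow> a \<in> ncpolys W \<Longrightarrow> a * p \<in> N" "p \<in> N \<Longrightarrow> a \<in> ncpolys W \<Longrightarrow> p * a \<in> N"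
proof -
  interpret ideal N "free_algebra W" by fact
  show "0 \<in> N" using additive_subgroup.zero_closed[OF is_additive_subgroup] by (simp add: free_algebra_def)
  show "p \<in> N \<Longrightarrow> q \<in> N \<Longrightarrow> p + q \<in> N" using additive_subgroup.a_closed[OF is_additive_subgroup, of p q] by (simp add: free_algebra_def)
  show "p \<in> N \<Longrightarrow> p \<in> ncpolys W" using Icarr[of p] by (simp add: free_algebra_def)
  show "p \<in> N \<Longrightarrow> a \<in> ncpolys W \<Longrightarrow> a * p \<in> N" using I_l_closed[of p a] by (simp add: free_algebra_def)
  show "p \<in> N \<Longrightarrow> a \<in> ncpolys W \<Longrightarrow> p * a \<in> N" using I_r_closed[of p a] by (simp add: free_algebra_def)
qed

lemma ideal_free_algebra_sum:
  assumes "ideal N (free_algebra W)" "\<And>i. i \<in> T \<Longrightarrow> f i \<in> N"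
  shows "sum f T \<in> N"
  using assms(2) ideal_free_algebraD(1,2)[OF assms(1)]
  by (induction T rule: infinite_finite_induct) auto

lemma ncconst_sum: "ncconst (sum f T) = (\<Sum>i\<in>T. ncconst (f i))"
  by (induction T rule: infinite_finite_induct) (auto simp: ncconst_add)

lemma ncconst_uminus: "ncconst (- c) = - ncconst c"
  using ncconst_add[of "-c" c] by (simp add: eq_neg_iff_add_eq_0)

text \<open>
  If an ideal contains all linear relations between coefficients, it contains each combination of
  monomials with word \<open>w\<close> whose coefficient tensor vanishes. The induction on \<open>w\<close> replaces the
  first coefficient \<open>a\<close> of each monomial by \<open>\<Sum>i. a(p i) g i\<close>, where the functions \<open>g i\<close> are
  common to all monomials; collecting what stands behind each \<open>g i\<close> and the first letter leaves
  combinations of monomials with the shorter word, to which the induction hypothesis applies.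
\<close>

lemma alt_mono_vanish_fixed_word:
  fixes val :: "'s \<Rightarrow> 'o \<Rightarrow> 'k::field" and N :: "('y + 's, 'k) ncpoly set"
  assumes S: "finite S" "Inr ` S \<subseteq> W" and N: "ideal N (free_algebra W)"
    and lin: "\<And>c. (\<And>\<omega>. \<omega> \<in> \<Omega> \<Longrightarrow> (\<Sum>s\<in>S. c s * val s \<omega>) = 0) \<Longrightarrow>
      (\<Sum>s\<in>S. ncconst (c s) * ncvar (Inr s)) \<in> N"
    and M: "finite M" "Inl ` set w \<subseteq> W" "\<And>m. m \<in> M \<Longrightarrow> a m \<in> S"
      "\<And>m. m \<in> M \<Longrightarrow> map fst (xs m) = w" "\<And>m. m \<in> M \<Longrightarrow> snd ` set (xs m) \<subseteq> S"
    and 0: "\<And>\<omega>s. set \<omega>s \<subseteq> \<Omega> \<Longrightarrow> length \<omega>s = Suc (length w) \<Longrightarrow>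
      (\<Sum>m\<in>M. c m * alt_val val (a m) (xs m) \<omega>s) = 0"
  shows "(\<Sum>m\<in>M. ncconst (c m) * alt_mono (a m) (xs m)) \<in> N"
  using M(2-) 0
proof (induction w arbitrary: c a xs)
  case Nil
  define C where "C s = (\<Sum>m\<in>{m\<in>M. a m = s}. c m)" for s
  have aS: "a ` M \<subseteq> S" using Nil by auto
  have "(\<Sum>s\<in>S. ncconst (C s) * ncvar (Inr s)) \<in> N"
  proof (rule lin)
    fix \<omega> assume \<omega>: "\<omega> \<in> \<Omega>"
    have "(\<Sum>s\<in>S. C s * val s \<omega>) = (\<Sum>s\<in>S. \<Sum>m\<in>{m\<in>M. a m = s}. c m * val (a m) \<omega>)"
      unfolding C_def sum_distrib_right by (intro sum.cong) auto
    also have "\<dots> = (\<Sum>m\<in>M. c m * val (a m) \<omega>)"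
      by (rule sum.group[OF M(1) S(1) aS])
    also have "\<dots> = (\<Sum>m\<in>M. c m * alt_val val (a m) (xs m) [\<omega>])"
      using Nil by (intro sum.cong) auto
    also have "\<dots> = 0" using Nil(5)[of "[\<omega>]"] \<omega> by simp
    finally show "(\<Sum>s\<in>S. C s * val s \<omega>) = 0" .
  qed
  also have "(\<Sum>s\<in>S. ncconst (C s) * ncvar (Inr s)) =
      (\<Sum>s\<in>S. \<Sum>m\<in>{m\<in>M. a m = s}. ncconst (c m) * ncvar (Inr (a m)))"
    unfolding C_def ncconst_sum sum_distrib_right by (intro sum.cong) auto
  also have "\<dots> = (\<Sum>m\<in>M. ncconst (c m) * ncvar (Inr (a m)))"
    by (rule sum.group[OF M(1) S(1) aS])
  also have "\<dots> = (\<Sum>m\<in>M. ncconst (c m) * alt_mono (a m) (xs m))"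
    using Nil by (intro sum.cong) auto
  finally show ?case .
next
  case (Cons y w)
  note ND = ideal_free_algebraD[OF N]
  define b where "b m = snd (hd (xs m))" for m
  define rs where "rs m = tl (xs m)" for m
  have xs: "xs m = (y, b m) # rs m" if "m \<in> M" for m
    using Cons.prems(3)[OF that] by (cases "xs m") (auto simp: b_def rs_def)
  have bS: "b m \<in> S" and rsS: "snd ` set (rs m) \<subseteq> S" and rsw: "map fst (rs m) = w" if "m \<in> M" for m
    using Cons.prems(3)[OF that] Cons.prems(4)[OF that] by (auto simp: xs[OF that])
  have yW: "Inl y \<in> W" and wW: "Inl ` set w \<subseteq> W" using Cons.prems(1) by auto
  have rest: "(alt_mono (b m) (rs m) :: ('y + 's, 'k) ncpoly) \<in> ncpolys W" if "m \<in> M" for m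
  proof (rule alt_mono_in)
    show "Inr (b m) \<in> W" using bS[OF that] S by auto
    fix y b assume "(y, b) \<in> set (rs m)"
    then have "y \<in> set w" "b \<in> S" using rsw[OF that] rsS[OF that] by force+
    then show "Inl y \<in> W \<and> Inr b \<in> W" using wW S by auto
  qed
  from reproducing_points[OF S(1), of \<Omega> val] obtain k :: nat and p G
    where pG: "(\<forall>i<k. p i \<in> \<Omega>) \<and>
      (\<forall>s\<in>S. \<forall>\<omega>\<in>\<Omega>. val s \<omega> = (\<Sum>i<k. val s (p i) * (\<Sum>u\<in>S. G i u * val u \<omega>)))"
    by (elim exE) (rule that)
  note p' = conjunct1[OF pG] and G' = conjunct2[OF pG]
  have p: "p i \<in> \<Omega>" if "i < k" for i using p' that by blast
  have G: "val s \<omega> = (\<Sum>i<k. val s (p i) * (\<Sum>u\<in>S. G i u * val u \<omega>))"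
    if "s \<in> S" "\<omega> \<in> \<Omega>" for s \<omega>
    using G' that by blast
  define g :: "nat \<Rightarrow> ('y + 's, 'k) ncpoly" where "g i = (\<Sum>u\<in>S. ncconst (G i u) * ncvar (Inr u))" for i
  have gW: "g i \<in> ncpolys W" for i
    unfolding g_def using S by (intro sum_in_ncpolys mult_in_ncpolys ncconst_in_ncpolys ncvar_in_ncpolys) auto
  have repr: "ncvar (Inr s) - (\<Sum>i<k. ncconst (val s (p i)) * g i) \<in> N" if s: "s \<in> S" for s
  proof -
    let ?c = "\<lambda>u. (if u = s then 1 else 0) - (\<Sum>i<k. val s (p i) * G i u)"
    have "(\<Sum>u\<in>S. ncconst (?c u) * ncvar (Inr u)) \<in> N"
    proof (rule lin)
      fix \<omega> assume \<omega>: "\<omega> \<in> \<Omega>"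
      have "(\<Sum>u\<in>S. ?c u * val u \<omega>) =
          (\<Sum>u\<in>S. (if u = s then val u \<omega> else 0) - (\<Sum>i<k. val s (p i) * (G i u * val u \<omega>)))"
        by (intro sum.cong) (auto simp: algebra_simps sum_distrib_right sum_distrib_left)
      also have "\<dots> = val s \<omega> - (\<Sum>u\<in>S. \<Sum>i<k. val s (p i) * (G i u * val u \<omega>))"
        using S(1) s by (simp add: sum_subtractf)
      also have "(\<Sum>u\<in>S. \<Sum>i<k. val s (p i) * (G i u * val u \<omega>)) = val s \<omega>"
        unfolding G[OF s \<omega>, of] sum_distrib_left by (subst sum.swap) (simp add: G[OF s \<omega>, symmetric])
      finally show "(\<Sum>u\<in>S. ?c u * val u \<omega>) = 0" by simp
    qed
    also have "(\<Sum>u\<in>S. ncconst (?c u) * ncvar (Inr u)) =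
        (\<Sum>u\<in>S. (if u = s then ncvar (Inr u) else 0) -
          (\<Sum>i<k. ncconst (val s (p i)) * (ncconst (G i u) * ncvar (Inr u))))"
    proof (intro sum.cong refl)
      fix u assume "u \<in> S"
      have eq: "ncconst (?c u) = ncconst (if u = s then 1 else 0) -
          (\<Sum>i<k. ncconst (val s (p i)) * ncconst (G i u))"
        unfolding diff_conv_add_uminus ncconst_add ncconst_uminus ncconst_sum ncconst_mult ..
      show "ncconst (?c u) * ncvar (Inr u) = (if u = s then ncvar (Inr u) else 0) -
          (\<Sum>i<k. ncconst (val s (p i)) * (ncconst (G i u) * ncvar (Inr u)))"
        unfolding eq by (simp add: left_diff_distrib sum_distrib_right mult.assoc)
    qed
    also have "\<dots> = ncvar (Inr s) - (\<Sum>u\<in>S. \<Sum>i<k. ncconst (val s (p i)) * (ncconst (G i u) * ncvar (Inr u)))"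
      using S(1) s by (simp add: sum_subtractf)
    also have "(\<Sum>u\<in>S. \<Sum>i<k. ncconst (val s (p i)) * (ncconst (G i u) * ncvar (Inr u))) =
        (\<Sum>i<k. ncconst (val s (p i)) * g i)"
      unfolding g_def sum_distrib_left by (rule sum.swap)
    finally show ?thesis .
  qed
  define h :: "_ \<Rightarrow> ('y + 's, 'k) ncpoly" where "h m = ncvar (Inl y) * alt_mono (b m) (rs m)" for m
  have hW: "h m \<in> ncpolys W" if "m \<in> M" for m
    unfolding h_def using rest[OF that] yW by (intro mult_in_ncpolys ncvar_in_ncpolys)
  have first: "(\<Sum>m\<in>M. ncconst (c m) * ((ncvar (Inr (a m)) - (\<Sum>i<k. ncconst (val (a m) (p i)) * g i)) * h m)) \<in> N"
    using Cons.prems(2) by (intro ideal_free_algebra_sum[OF N] ND(4,5) repr hW ncconst_in_ncpolys) auto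
  have inner: "(\<Sum>m\<in>M. ncconst (c m * val (a m) (p i)) * alt_mono (b m) (rs m)) \<in> N" if i: "i < k" for i
  proof (rule Cons.IH[OF wW])
    fix \<omega>s assume \<omega>s: "set \<omega>s \<subseteq> \<Omega>" "length \<omega>s = Suc (length w)"
    have "(\<Sum>m\<in>M. c m * val (a m) (p i) * alt_val val (b m) (rs m) \<omega>s) =
        (\<Sum>m\<in>M. c m * alt_val val (a m) (xs m) (p i # \<omega>s))"
      by (intro sum.cong) (auto simp: xs)
    also have "\<dots> = 0" using Cons.prems(5)[of "p i # \<omega>s"] \<omega>s p[OF i] by simp
    finally show "(\<Sum>m\<in>M. c m * val (a m) (p i) * alt_val val (b m) (rs m) \<omega>s) = 0" .
  qed (use bS rsS rsw in auto)
  have second: "(\<Sum>i<k. g i * (ncvar (Inl y) *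
      (\<Sum>m\<in>M. ncconst (c m * val (a m) (p i)) * alt_mono (b m) (rs m)))) \<in> N"
    by (rule ideal_free_algebra_sum[OF N], rule ND(4)[OF ND(4)[OF inner ncvar_in_ncpolys[OF yW]] gW]) simp
  have "(\<Sum>i<k. g i * (ncvar (Inl y) * (\<Sum>m\<in>M. ncconst (c m * val (a m) (p i)) * alt_mono (b m) (rs m)))) =
      (\<Sum>i<k. \<Sum>m\<in>M. ncconst (c m) * (ncconst (val (a m) (p i)) * g i * h m))"
  proof (intro sum.cong refl)
    fix i
    have "g i * (ncvar (Inl y) * (ncconst (c m * val (a m) (p i)) * alt_mono (b m) (rs m))) =
        ncconst (c m) * (ncconst (val (a m) (p i)) * g i * h m)" for m
    proof -
      let ?k = "ncconst (c m * val (a m) (p i)) :: ('y + 's, 'k) ncpoly"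
      have "g i * (ncvar (Inl y) * (?k * alt_mono (b m) (rs m))) =
          (g i * ncvar (Inl y) * ?k) * alt_mono (b m) (rs m)"
        by (simp only: mult.assoc)
      also have "g i * ncvar (Inl y) * ?k = ?k * (g i * ncvar (Inl y))"
        by (rule ncconst_commute[symmetric, of _ W]) (use gW yW in \<open>intro mult_in_ncpolys ncvar_in_ncpolys\<close>)
      finally show ?thesis by (simp add: h_def ncconst_mult mult.assoc)
    qed
    then show "g i * (ncvar (Inl y) * (\<Sum>m\<in>M. ncconst (c m * val (a m) (p i)) * alt_mono (b m) (rs m))) =
        (\<Sum>m\<in>M. ncconst (c m) * (ncconst (val (a m) (p i)) * g i * h m))"
      by (simp add: sum_distrib_left)
  qed
  also have "\<dots> = (\<Sum>m\<in>M. ncconst (c m) * ((\<Sum>i<k. ncconst (val (a m) (p i)) * g i) * h m))"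
    unfolding sum_distrib_left sum_distrib_right by (rule sum.swap)
  finally have second': "(\<Sum>m\<in>M. ncconst (c m) * ((\<Sum>i<k. ncconst (val (a m) (p i)) * g i) * h m)) \<in> N"
    using second by simp
  have "(\<Sum>m\<in>M. ncconst (c m) * alt_mono (a m) (xs m)) =
      (\<Sum>m\<in>M. ncconst (c m) * ((ncvar (Inr (a m)) - (\<Sum>i<k. ncconst (val (a m) (p i)) * g i)) * h m)) +
      (\<Sum>m\<in>M. ncconst (c m) * ((\<Sum>i<k. ncconst (val (a m) (p i)) * g i) * h m))"
    unfolding sum.distrib[symmetric]
    by (intro sum.cong refl) (simp add: xs h_def algebra_simps)
  then show ?case using ND(2)[OF first second'] by simp
qed

lemma alt_mono_vanish:
  fixes val :: "'s \<Rightarrow> 'o \<Rightarrow> 'k::field" and N :: "('y + 's, 'k) ncpoly set"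
  assumes S: "finite S" "Inr ` S \<subseteq> W" and N: "ideal N (free_algebra W)"
    and lin: "\<And>c. (\<And>\<omega>. \<omega> \<in> \<Omega> \<Longrightarrow> (\<Sum>s\<in>S. c s * val s \<omega>) = 0) \<Longrightarrow>
      (\<Sum>s\<in>S. ncconst (c s) * ncvar (Inr s)) \<in> N"
    and M: "finite M" "\<And>m. m \<in> M \<Longrightarrow> a m \<in> S" "\<And>m. m \<in> M \<Longrightarrow> Inl ` fst ` set (xs m) \<subseteq> W"
      "\<And>m. m \<in> M \<Longrightarrow> snd ` set (xs m) \<subseteq> S"
    and 0: "\<And>w \<omega>s. set \<omega>s \<subseteq> \<Omega> \<Longrightarrow> length \<omega>s = Suc (length w) \<Longrightarrow>
      (\<Sum>m\<in>M. c m * (if map fst (xs m) = w then alt_val val (a m) (xs m) \<omega>s else 0)) = 0"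
  shows "(\<Sum>m\<in>M. ncconst (c m) * alt_mono (a m) (xs m)) \<in> N"
proof -
  let ?word = "\<lambda>m. map fst (xs m)"
  have "(\<Sum>m\<in>{m \<in> M. ?word m = w}. ncconst (c m) * alt_mono (a m) (xs m)) \<in> N"
    if w: "w \<in> ?word ` M" for w
  proof (rule alt_mono_vanish_fixed_word[OF S N lin, where w = w])
    show "Inl ` set w \<subseteq> W" using w M(3) by fastforce
    fix \<omega>s assume "set \<omega>s \<subseteq> \<Omega>" "length \<omega>s = Suc (length w)"
    from 0[OF this] have "(\<Sum>m\<in>M. if ?word m = w then c m * alt_val val (a m) (xs m) \<omega>s else 0) = 0"
      by (simp add: if_distrib cong: if_cong)
    then show "(\<Sum>m\<in>{m \<in> M. ?word m = w}. c m * alt_val val (a m) (xs m) \<omega>s) = 0"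
      using M(1) by (simp add: sum.inter_filter)
  qed (use M in auto)
  then have "(\<Sum>w\<in>?word ` M. \<Sum>m\<in>{m \<in> M. ?word m = w}. ncconst (c m) * alt_mono (a m) (xs m)) \<in> N"
    by (rule ideal_free_algebra_sum[OF N])
  also have "(\<Sum>w\<in>?word ` M. \<Sum>m\<in>{m \<in> M. ?word m = w}. ncconst (c m) * alt_mono (a m) (xs m)) =
      (\<Sum>m\<in>M. ncconst (c m) * alt_mono (a m) (xs m))"
    by (rule sum.group) (use M(1) in auto)
  finally show ?thesis .
qed

section \<open>Separating alternating monomials by matrices\<close>

lemma poly_eval_upper_triangular:
  fixes Z Z0 Z' U :: "'z \<Rightarrow> 'k::field mat"
  assumes Z0: "\<And>x. x \<in> V \<Longrightarrow> Z0 x \<in> carrier_mat n n" and Z': "\<And>x. x \<in> V \<Longrightarrow> Z' x \<in> carrier_mat m m"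
    and U: "\<And>x. x \<in> V \<Longrightarrow> U x \<in> carrier_mat n m"
    and Z: "\<And>x. x \<in> V \<Longrightarrow> Z x = four_block_mat (Z0 x) (U x) (0\<^sub>m m n) (Z' x)"
    and p: "p \<in> ncpolys V"
  shows "\<exists>T \<in> carrier_mat n m. poly_eval (n + m) Z p =
    four_block_mat (poly_eval n Z0 p) T (0\<^sub>m m n) (poly_eval m Z' p)"
  using p
proof (induction rule: ncpolys_induct)
  have Zc: "Z x \<in> carrier_mat (n + m) (n + m)" if "x \<in> V" for x
    using Z0[OF that] Z'[OF that] Z[OF that] by simp
  have cl: "poly_eval n Z0 p \<in> carrier_mat n n" "poly_eval m Z' p \<in> carrier_mat m m"
    if "p \<in> ncpolys V" for p
    using poly_eval_closed[of V Z0 n p, OF Z0] poly_eval_closed[of V Z' m p, OF Z'] that by auto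
  {
    case (const c)
    have "four_block_mat (c \<cdot>\<^sub>m 1\<^sub>m n) (0\<^sub>m n m) (0\<^sub>m m n) (c \<cdot>\<^sub>m 1\<^sub>m m) = c \<cdot>\<^sub>m (1\<^sub>m (n + m) :: 'k mat)"
      by (rule eq_matI) auto
    then show ?case
      by (intro bexI[of _ "0\<^sub>m n m"])
        (simp_all add: poly_eval_const[of V Z0, OF Z0] poly_eval_const[of V Z', OF Z'] poly_eval_const[of V Z, OF Zc])
  next
    case (var x)
    then show ?case
      using U by (intro bexI[of _ "U x"])
        (simp_all add: poly_eval_var[of V Z0, OF Z0] poly_eval_var[of V Z', OF Z'] poly_eval_var[of V Z, OF Zc] Z)
  next
    case (add p q)
    then obtain S T where T: "S \<in> carrier_mat n m" "T \<in> carrier_mat n m"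
      "poly_eval (n + m) Z p = four_block_mat (poly_eval n Z0 p) S (0\<^sub>m m n) (poly_eval m Z' p)"
      "poly_eval (n + m) Z q = four_block_mat (poly_eval n Z0 q) T (0\<^sub>m m n) (poly_eval m Z' q)"
      by blast
    have "poly_eval (n + m) Z (p + q) = four_block_mat (poly_eval n Z0 (p + q)) (S + T) (0\<^sub>m m n) (poly_eval m Z' (p + q))"
      using add(1,2) T cl
      by (simp add: poly_eval_add[of V Z0, OF Z0] poly_eval_add[of V Z', OF Z'] poly_eval_add[of V Z, OF Zc]
          add_four_block_mat[of _ n n _ m _ m])
    then show ?case using T by (intro bexI[of _ "S + T"]) auto
  next
    case (mult p q)
    then obtain S T where T: "S \<in> carrier_mat n m" "T \<in> carrier_mat n m"
      "poly_eval (n + m) Z p = four_block_mat (poly_eval n Z0 p) S (0\<^sub>m m n) (poly_eval m Z' p)"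
      "poly_eval (n + m) Z q = four_block_mat (poly_eval n Z0 q) T (0\<^sub>m m n) (poly_eval m Z' q)"
      by blast
    let ?T = "poly_eval n Z0 p * T + S * poly_eval m Z' q"
    have "poly_eval (n + m) Z (p * q) =
        four_block_mat (poly_eval n Z0 p) S (0\<^sub>m m n) (poly_eval m Z' p) *
        four_block_mat (poly_eval n Z0 q) T (0\<^sub>m m n) (poly_eval m Z' q)"
      using mult(1,2) T by (simp add: poly_eval_mult[of V Z, OF Zc])
    also have "\<dots> = four_block_mat (poly_eval n Z0 p * poly_eval n Z0 q + S * 0\<^sub>m m n) ?T
        (0\<^sub>m m n * poly_eval n Z0 q + poly_eval m Z' p * 0\<^sub>m m n) (0\<^sub>m m n * T + poly_eval m Z' p * poly_eval m Z' q)"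
      by (rule mult_four_block_mat) (use mult(1,2) T cl in auto)
    also have "\<dots> = four_block_mat (poly_eval n Z0 (p * q)) ?T (0\<^sub>m m n) (poly_eval m Z' (p * q))"
    proof (rule cong_four_block_mat)
      note c = cl(1)[OF mult(1)] cl(1)[OF mult(2)] cl(2)[OF mult(1)] cl(2)[OF mult(2)]
      show "poly_eval n Z0 p * poly_eval n Z0 q + S * 0\<^sub>m m n = poly_eval n Z0 (p * q)"
        using c T mult(1,2) by (simp add: poly_eval_mult[of V Z0, OF Z0])
      show "0\<^sub>m m n * poly_eval n Z0 q + poly_eval m Z' p * 0\<^sub>m m n = 0\<^sub>m m n"
        using c by simp
      show "0\<^sub>m m n * T + poly_eval m Z' p * poly_eval m Z' q = poly_eval m Z' (p * q)"
        using c T mult(1,2) by (simp add: poly_eval_mult[of V Z', OF Z'])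
    qed simp
    finally show ?case using T cl mult(1,2) by (intro bexI[of _ ?T]) auto
  }
qed

lemma mult_matrix_unit:
  fixes M R :: "'k::comm_ring_1 mat"
  assumes "M \<in> carrier_mat n n" "R \<in> carrier_mat m m" "p < n" "q < n" "i < m" "j < m"
  shows "(M * (mat n m (\<lambda>(a, b). if a = q \<and> b = i then 1 else 0) * R)) $$ (p, j) = M $$ (p, q) * R $$ (i, j)"
proof -
  let ?E = "mat n m (\<lambda>(a, b). if a = q \<and> b = i then 1 else 0) :: 'k mat"
  have "(?E * R) $$ (a, j) = (if a = q then R $$ (i, j) else 0)" if "a < n" for a
  proof -
    have "(?E * R) $$ (a, j) = (\<Sum>b = 0..<m. (if a = q \<and> b = i then 1 else 0) * R $$ (b, j))"
      using assms that by (simp add: scalar_prod_def)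
    also have "\<dots> = (\<Sum>b = 0..<m. if b = i then (if a = q then R $$ (b, j) else 0) else 0)"
      by (intro sum.cong) auto
    also have "\<dots> = (if a = q then R $$ (i, j) else 0)" using assms by simp
    finally show ?thesis .
  qed
  note ER = this
  have "(M * (?E * R)) $$ (p, j) = (\<Sum>a = 0..<n. M $$ (p, a) * (?E * R) $$ (a, j))"
    using assms by (simp add: scalar_prod_def)
  also have "\<dots> = (\<Sum>a = 0..<n. if a = q then M $$ (p, a) * R $$ (i, j) else 0)"
    by (intro sum.cong) (auto simp: ER)
  finally show ?thesis using assms by simp
qed

text \<open>
  For a prescribed word \<open>w\<close> and prescribed points there are matrices for which one fixed entry of
  the value of a monomial is zero unless its word is \<open>w\<close>, and is then the product of the prescribed
  entries of its coefficients. The coefficients are evaluated at the direct sum of the points, and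
  a variable \<open>y\<close> sends the block of one point to the block of the next, by a matrix unit, at the
  positions where \<open>w\<close> has the letter \<open>y\<close>. A path from the first to the last block then has to
  spell \<open>w\<close>. The induction adds one block in front of the others.
\<close>

lemma alt_mono_separation:
  fixes ev :: "nat \<Rightarrow> 'a \<Rightarrow> 's \<Rightarrow> 'k::field mat" and w :: "'y list"
  assumes ev: "\<And>n A s. (n, A) \<in> D \<Longrightarrow> s \<in> S \<Longrightarrow> ev n A s \<in> carrier_mat n n"
    and sum: "\<And>n A m B. (n, A) \<in> D \<Longrightarrow> (m, B) \<in> D \<Longrightarrow>
      \<exists>C. (n + m, C) \<in> D \<and> (\<forall>s\<in>S. ev (n + m) C s = block_sum (ev n A s) (ev m B s))"
    and \<omega>s: "set \<omega>s \<subseteq> {(n, A, i, j). (n, A) \<in> D \<and> i < n \<and> j < n}" "length \<omega>s = Suc (length w)"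
  shows "\<exists>N A B i j. (N, A) \<in> D \<and> (\<forall>y. B y \<in> carrier_mat N N) \<and> i < N \<and> j < N \<and>
    (\<forall>a xs. a \<in> S \<longrightarrow> snd ` set xs \<subseteq> S \<longrightarrow>
      poly_eval N (case_sum B (ev N A)) (alt_mono a xs) $$ (i, j) =
      (if map fst xs = w then alt_val (\<lambda>s (n, A, i, j). ev n A s $$ (i, j)) a xs \<omega>s else 0))"
  using \<omega>s
proof (induction w arbitrary: \<omega>s)
  case Nil
  define V :: "('y + 's) set" where "V = range Inl \<union> Inr ` S"
  obtain n A p q where \<omega>: "\<omega>s = [(n, A, p, q)]" "(n, A) \<in> D" "p < n" "q < n"
    using Nil by (cases \<omega>s) auto
  let ?B = "\<lambda>_ :: 'y. 0\<^sub>m n n :: 'k mat"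
  let ?Z = "case_sum ?B (ev n A)"
  have Z: "?Z x \<in> carrier_mat n n" if "x \<in> V" for x using that ev[OF \<omega>(2)] by (auto simp: V_def)
  have VI: "Inl y \<in> V" "s \<in> S \<Longrightarrow> Inr s \<in> V" for y s by (auto simp: V_def)
  have "poly_eval n ?Z (alt_mono a xs) $$ (p, q) =
      (if map fst xs = [] then alt_val (\<lambda>s (n, A, i, j). ev n A s $$ (i, j)) a xs \<omega>s else 0)"
    if a: "a \<in> S" and xs: "snd ` set xs \<subseteq> S" for a xs
  proof (cases xs)
    case Nil
    then show ?thesis using a by (simp add: poly_eval_var[of V ?Z, OF Z] VI \<omega>)
  next
    case (Cons yb r)
    obtain y b where yb: "yb = (y, b)" by (cases yb)
    have r: "(alt_mono b r :: ('y + 's, 'k) ncpoly) \<in> ncpolys V"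
      by (rule alt_mono_in) (use xs Cons yb VI in force)+
    have "poly_eval n ?Z (alt_mono a xs) = ev n A a * (0\<^sub>m n n * poly_eval n ?Z (alt_mono b r))"
      using a r by (simp add: Cons yb poly_eval_mult[of V ?Z, OF Z] poly_eval_var[of V ?Z, OF Z] VI
          ncvar_in_ncpolys mult_in_ncpolys)
    also have "\<dots> = 0\<^sub>m n n"
      using ev[OF \<omega>(2) a] poly_eval_closed[of V ?Z, OF Z r] by simp
    finally show ?thesis using Cons \<omega>(3,4) by simp
  qed
  then show ?case using \<omega>
    by (intro exI[of _ n] exI[of _ A] exI[of _ ?B] exI[of _ p] exI[of _ q]) auto
next
  case (Cons y0 w)
  define V :: "('y + 's) set" where "V = range Inl \<union> Inr ` S"
  let ?val = "\<lambda>s (n, A, i, j). ev n A s $$ (i, j)"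
  obtain n A p q \<omega>s' where \<omega>: "\<omega>s = (n, A, p, q) # \<omega>s'" "(n, A) \<in> D" "p < n" "q < n"
    using Cons.prems by (cases \<omega>s) auto
  have "\<exists>N A B i j. (N, A) \<in> D \<and> (\<forall>y. B y \<in> carrier_mat N N) \<and> i < N \<and> j < N \<and>
    (\<forall>a xs. a \<in> S \<longrightarrow> snd ` set xs \<subseteq> S \<longrightarrow>
      poly_eval N (case_sum B (ev N A)) (alt_mono a xs) $$ (i, j) =
      (if map fst xs = w then alt_val ?val a xs \<omega>s' else 0))"
    by (rule Cons.IH) (use Cons.prems \<omega>(1) in auto)
  then obtain m A' B' i j where *: "(m, A') \<in> D \<and> (\<forall>y. B' y \<in> carrier_mat m m) \<and> i < m \<and> j < m \<and>
    (\<forall>a xs. a \<in> S \<longrightarrow> snd ` set xs \<subseteq> S \<longrightarrow>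
      poly_eval m (case_sum B' (ev m A')) (alt_mono a xs) $$ (i, j) =
      (if map fst xs = w then alt_val ?val a xs \<omega>s' else 0))"
    by (elim exE) (rule that)
  then have A': "(m, A') \<in> D" and B': "\<And>y. B' y \<in> carrier_mat m m" and ij: "i < m" "j < m"
    and IH: "\<And>a xs. a \<in> S \<Longrightarrow> snd ` set xs \<subseteq> S \<Longrightarrow>
      poly_eval m (case_sum B' (ev m A')) (alt_mono a xs) $$ (i, j) =
      (if map fst xs = w then alt_val ?val a xs \<omega>s' else 0)"
    by auto
  obtain C where C: "(n + m, C) \<in> D" "\<And>s. s \<in> S \<Longrightarrow> ev (n + m) C s = block_sum (ev n A s) (ev m A' s)"
    using sum[OF \<omega>(2) A'] by blast
  \<comment> \<open>The matrix unit that leads from column \<open>q\<close> of the new block to row \<open>i\<close> of the old ones.\<close>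
  let ?E = "mat n m (\<lambda>(a, b). if a = q \<and> b = i then 1 else 0) :: 'k mat"
  let ?U = "\<lambda>y. if y = y0 then ?E else 0\<^sub>m n m"
  let ?B = "\<lambda>y. four_block_mat (0\<^sub>m n n) (?U y) (0\<^sub>m m n) (B' y)"
  let ?Z = "case_sum ?B (ev (n + m) C)" and ?Z' = "case_sum B' (ev m A')"
  let ?Zl = "case_sum (\<lambda>_. 0\<^sub>m n n) (ev n A)" and ?UU = "case_sum ?U (\<lambda>_. 0\<^sub>m n m)"
  have B: "?B y \<in> carrier_mat (n + m) (n + m)" for y using B' by simp
  have Z: "?Z x \<in> carrier_mat (n + m) (n + m)" if "x \<in> V" for x
  proof (cases x)
    case (Inl y)
    show ?thesis unfolding Inl sum.case by (rule B)
  next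
    case (Inr s)
    then show ?thesis using that ev[OF C(1)] by (auto simp: V_def)
  qed
  have VI: "Inl y \<in> V" "s \<in> S \<Longrightarrow> Inr s \<in> V" for y s by (auto simp: V_def)
  have Z0: "?Zl x \<in> carrier_mat n n" if "x \<in> V" for x using that ev[OF \<omega>(2)] by (auto simp: V_def)
  have Z': "?Z' x \<in> carrier_mat m m" if "x \<in> V" for x using that ev[OF A'] B' by (auto simp: V_def)
  have UU: "?UU x \<in> carrier_mat n m" if "x \<in> V" for x using that by (auto simp: V_def)
  have evC: "ev (n + m) C s = four_block_mat (ev n A s) (0\<^sub>m n m) (0\<^sub>m m n) (ev m A' s)"
    if "s \<in> S" for s
    using C(2)[OF that] ev[OF \<omega>(2) that] ev[OF A' that] by (simp add: block_sum_def)
  have Zb: "?Z x = four_block_mat (?Zl x) (?UU x) (0\<^sub>m m n) (?Z' x)" if "x \<in> V" for x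
    using that by (auto simp: V_def evC)
  have "poly_eval (n + m) ?Z (alt_mono a xs) $$ (p, n + j) =
      (if map fst xs = y0 # w then alt_val ?val a xs \<omega>s else 0)"
    if a: "a \<in> S" and xs: "snd ` set xs \<subseteq> S" for a xs
  proof (cases xs)
    case Nil
    then show ?thesis
      using a ij \<omega>(3) ev[OF \<omega>(2) a] ev[OF A' a]
      by (simp add: poly_eval_var[of V ?Z, OF Z] VI C(2) block_sum_def)
  next
    case (Cons yb r)
    obtain y b where yb: "yb = (y, b)" by (cases yb)
    have bS: "b \<in> S" "snd ` set r \<subseteq> S" using xs Cons yb by auto
    have r: "(alt_mono b r :: ('y + 's, 'k) ncpoly) \<in> ncpolys V"
      by (rule alt_mono_in) (use bS VI in force)+
    let ?Rl = "poly_eval n ?Zl (alt_mono b r)" and ?R' = "poly_eval m ?Z' (alt_mono b r)"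
    obtain T where T: "T \<in> carrier_mat n m"
      "poly_eval (n + m) ?Z (alt_mono b r) = four_block_mat ?Rl T (0\<^sub>m m n) ?R'"
      using poly_eval_upper_triangular[of V ?Zl n ?Z' m ?UU ?Z, OF Z0 Z' UU Zb r] by blast
    have R: "?Rl \<in> carrier_mat n n" "?R' \<in> carrier_mat m m"
      using poly_eval_closed[of V ?Zl, OF Z0 r] poly_eval_closed[of V ?Z', OF Z' r] by simp_all
    have U: "?U y \<in> carrier_mat n m" by simp
    note ea = ev[OF \<omega>(2) a] and ea' = ev[OF A' a]
    have "poly_eval (n + m) ?Z (alt_mono a xs) =
        ev (n + m) C a * (?B y * poly_eval (n + m) ?Z (alt_mono b r))"
      using a r by (simp add: Cons yb poly_eval_mult[of V ?Z, OF Z] poly_eval_var[of V ?Z, OF Z] VI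
          ncvar_in_ncpolys mult_in_ncpolys)
    also have "?B y * poly_eval (n + m) ?Z (alt_mono b r) =
        four_block_mat (0\<^sub>m n n) (?U y * ?R') (0\<^sub>m m n) (B' y * ?R')"
    proof -
      have "?B y * four_block_mat ?Rl T (0\<^sub>m m n) ?R' =
          four_block_mat (0\<^sub>m n n * ?Rl + ?U y * 0\<^sub>m m n) (0\<^sub>m n n * T + ?U y * ?R')
            (0\<^sub>m m n * ?Rl + B' y * 0\<^sub>m m n) (0\<^sub>m m n * T + B' y * ?R')"
        by (rule mult_four_block_mat[OF _ U _ B' R(1) T(1) _ R(2)]) auto
      also have "\<dots> = four_block_mat (0\<^sub>m n n) (?U y * ?R') (0\<^sub>m m n) (B' y * ?R')"
        using R T U B'[of y] mult_carrier_mat[OF U R(2)] mult_carrier_mat[OF B'[of y] R(2)]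
          right_mult_zero_mat[OF U, of n]
        by (intro cong_four_block_mat) (simp_all del: mult_carrier_mat)
      finally show ?thesis by (simp only: T(2))
    qed
    also have "ev (n + m) C a * four_block_mat (0\<^sub>m n n) (?U y * ?R') (0\<^sub>m m n) (B' y * ?R') =
        four_block_mat (ev n A a * 0\<^sub>m n n + 0\<^sub>m n m * 0\<^sub>m m n) (ev n A a * (?U y * ?R') + 0\<^sub>m n m * (B' y * ?R'))
          (0\<^sub>m m n * 0\<^sub>m n n + ev m A' a * 0\<^sub>m m n) (0\<^sub>m m n * (?U y * ?R') + ev m A' a * (B' y * ?R'))"
    proof -
      have "ev (n + m) C a = four_block_mat (ev n A a) (0\<^sub>m n m) (0\<^sub>m m n) (ev m A' a)"
        using C(2)[OF a] ea ea' by (simp add: block_sum_def)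
      then show ?thesis
        by (simp only:) (rule mult_four_block_mat[OF ea _ _ ea' _ mult_carrier_mat[OF U R(2)] _
            mult_carrier_mat[OF B' R(2)]], auto)
    qed
    finally have "poly_eval (n + m) ?Z (alt_mono a xs) $$ (p, n + j) =
        (ev n A a * (?U y * ?R') + 0\<^sub>m n m * (B' y * ?R')) $$ (p, j)"
      using ij \<omega>(3) ea ea' R B'[of y] by simp
    also have "\<dots> = (ev n A a * (?U y * ?R')) $$ (p, j)"
      using left_mult_zero_mat[OF mult_carrier_mat[OF B'[of y] R(2)], of n] ij \<omega>(3)
        mult_carrier_mat[OF ea mult_carrier_mat[OF U R(2)]] by simp
    also have "\<dots> = (if y = y0 then ev n A a $$ (p, q) * ?R' $$ (i, j) else 0)"
    proof (cases "y = y0")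
      case True
      then show ?thesis using mult_matrix_unit[OF ea R(2) \<omega>(3,4) ij] by simp
    next
      case False
      then show ?thesis
        using left_mult_zero_mat[OF R(2), of n] right_mult_zero_mat[OF ea, of m] ij \<omega>(3) by simp
    qed
    also have "\<dots> = (if map fst xs = y0 # w then alt_val ?val a xs \<omega>s else 0)"
      using IH[OF bS] by (auto simp: Cons yb \<omega>(1))
    finally show ?thesis .
  qed
  then show ?case
    using C(1) B \<omega>(3) ij
    by (intro exI[of _ "n + m"] exI[of _ C] exI[of _ ?B] exI[of _ p] exI[of _ "n + j"]) auto
qed

section \<open>Normal forms of words\<close>

text \<open>
  The alternating monomial that a word in coefficients and variables becomes by multiplying
  adjacent coefficients and inserting the unit wherever a coefficient is missing.
\<close>

fun alt_form :: "('s, 'm) monoid_scheme \<Rightarrow> ('y + 's) list \<Rightarrow> 's \<times> ('y \<times> 's) list" where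
  "alt_form K [] = (\<one>\<^bsub>K\<^esub>, [])"
| "alt_form K (Inl y # w) = (\<one>\<^bsub>K\<^esub>, (y, fst (alt_form K w)) # snd (alt_form K w))"
| "alt_form K (Inr s # w) = (s \<otimes>\<^bsub>K\<^esub> fst (alt_form K w), snd (alt_form K w))"

lemma alt_form_closed:
  assumes "ring K" "set w \<subseteq> Inl ` Y \<union> Inr ` carrier K"
  shows "fst (alt_form K w) \<in> carrier K" "fst ` set (snd (alt_form K w)) \<subseteq> Y"
    "snd ` set (snd (alt_form K w)) \<subseteq> carrier K"
proof -
  interpret ring K by fact
  have "fst (alt_form K w) \<in> carrier K \<and> fst ` set (snd (alt_form K w)) \<subseteq> Y \<and>
      snd ` set (snd (alt_form K w)) \<subseteq> carrier K"
    using assms(2)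
  proof (induction w)
    case (Cons x w)
    then show ?case by (cases x) auto
  qed simp
  then show "fst (alt_form K w) \<in> carrier K" "fst ` set (snd (alt_form K w)) \<subseteq> Y"
    "snd ` set (snd (alt_form K w)) \<subseteq> carrier K"
    by auto
qed

lemma alt_form_cong:
  fixes N :: "('y + 's, 'k::field) ncpoly set"
  assumes K: "ring K" and W: "W = Inl ` Y \<union> Inr ` carrier K" and N: "ideal N (free_algebra W)"
    and mult: "\<And>s t. s \<in> carrier K \<Longrightarrow> t \<in> carrier K \<Longrightarrow>
      ncvar (Inr s) * ncvar (Inr t) - ncvar (Inr (s \<otimes>\<^bsub>K\<^esub> t)) \<in> N"
    and one: "1 - ncvar (Inr \<one>\<^bsub>K\<^esub>) \<in> N"
    and w: "set w \<subseteq> W"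
  shows "Poly_Mapping.single (Word w) 1 - alt_mono (fst (alt_form K w)) (snd (alt_form K w)) \<in> N"
  using w
proof (induction w)
  case Nil
  have "Poly_Mapping.single (Word []) 1 = (1 :: ('y + 's, 'k) ncpoly)"
    using ncconst_1 unfolding ncconst_def zero_ncword_def .
  then show ?case using one by simp
next
  case (Cons x w)
  interpret K: ring K by (rule K)
  note ND = ideal_free_algebraD[OF N]
  obtain a xs where axs: "alt_form K w = (a, xs)" by (cases "alt_form K w")
  have w: "set w \<subseteq> Inl ` Y \<union> Inr ` carrier K" using Cons.prems W by simp
  have cl: "a \<in> carrier K" "fst ` set xs \<subseteq> Y" "snd ` set xs \<subseteq> carrier K"
    using alt_form_closed[OF K w] axs by auto
  have rest: "(alt_mono a xs :: ('y + 's, 'k) ncpoly) \<in> ncpolys W"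
    by (rule alt_mono_in) (use cl W in force)+
  have step: "Poly_Mapping.single (Word (x # w)) 1 = ncvar x * Poly_Mapping.single (Word w) (1 :: 'k)"
    by (simp add: ncvar_mult_monom)
  have IH: "Poly_Mapping.single (Word w) 1 - alt_mono a xs \<in> N" using Cons axs by simp
  have xW: "ncvar x \<in> ncpolys W" using Cons.prems by (intro ncvar_in_ncpolys) simp
  have first: "ncvar x * (Poly_Mapping.single (Word w) 1 - alt_mono a xs) \<in> N"
    by (rule ND(4)[OF IH xW])
  show ?case
  proof (cases x)
    case (Inl y)
    have "(1 - ncvar (Inr \<one>\<^bsub>K\<^esub>)) * (ncvar x * alt_mono a xs) \<in> N"
      by (rule ND(5)[OF one mult_in_ncpolys[OF xW rest]])
    from ND(2)[OF first this] show ?thesis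
      by (simp add: step[unfolded Inl] axs Inl algebra_simps)
  next
    case (Inr s)
    have s: "s \<in> carrier K" using Cons.prems by (auto simp: Inr W)
    have "ncvar (Inr s) * alt_mono a xs - alt_mono (s \<otimes>\<^bsub>K\<^esub> a) xs \<in> N"
    proof (cases xs)
      case Nil
      then show ?thesis using mult[OF s cl(1)] by simp
    next
      case (Cons yb r)
      obtain y b where yb: "yb = (y, b)" by (cases yb)
      have "ncvar (Inl y) * alt_mono b r \<in> (ncpolys W :: ('y + 's, 'k) ncpoly set)"
        by (intro mult_in_ncpolys ncvar_in_ncpolys alt_mono_in) (use cl W Cons yb in force)+
      from ND(5)[OF mult[OF s cl(1)] this] show ?thesis
        by (simp add: Cons yb algebra_simps)
    qed
    from ND(2)[OF first this] show ?thesis by (simp add: step[unfolded Inr] axs Inr algebra_simps)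
  qed
qed

lemma ncpoly_alt_form:
  fixes N :: "('y + 's, 'k::field) ncpoly set"
  assumes K: "ring K" and W: "W = Inl ` Y \<union> Inr ` carrier K" and N: "ideal N (free_algebra W)"
    and mult: "\<And>s t. s \<in> carrier K \<Longrightarrow> t \<in> carrier K \<Longrightarrow>
      ncvar (Inr s) * ncvar (Inr t) - ncvar (Inr (s \<otimes>\<^bsub>K\<^esub> t)) \<in> N"
    and one: "1 - ncvar (Inr \<one>\<^bsub>K\<^esub>) \<in> N"
    and P: "P \<in> ncpolys W"
  shows "P - (\<Sum>w\<in>Poly_Mapping.keys P. ncconst (Poly_Mapping.lookup P w) *
    alt_mono (fst (alt_form K (letters w))) (snd (alt_form K (letters w)))) \<in> N"
proof -
  have "P = (\<Sum>w\<in>Poly_Mapping.keys P. Poly_Mapping.single w (Poly_Mapping.lookup P w))"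
    by (rule poly_mapping_eqI) (auto simp: lookup_sum lookup_single when_def in_keys_iff)
  also have "\<dots> = (\<Sum>w\<in>Poly_Mapping.keys P. ncconst (Poly_Mapping.lookup P w) * Poly_Mapping.single (Word (letters w)) 1)"
    by (simp add: ncconst_mult_monom)
  finally have eq: "P - (\<Sum>w\<in>Poly_Mapping.keys P. ncconst (Poly_Mapping.lookup P w) *
      alt_mono (fst (alt_form K (letters w))) (snd (alt_form K (letters w)))) =
    (\<Sum>w\<in>Poly_Mapping.keys P. ncconst (Poly_Mapping.lookup P w) *
      (Poly_Mapping.single (Word (letters w)) 1 -
       alt_mono (fst (alt_form K (letters w))) (snd (alt_form K (letters w)))))"
    by (simp add: right_diff_distrib sum_subtractf)
  show ?thesis
    unfolding eq
    by (intro ideal_free_algebra_sum[OF N] ideal_free_algebraD(4)[OF N] ncconst_in_ncpolys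
        alt_form_cong[OF K W N mult one]) (use P in \<open>auto simp: ncpolys_def\<close>)
qed

lemma (in nc_evaluation) kernel_ideal: "ideal {p \<in> ncpolys V. eval p = \<zero>} (free_algebra V)"
proof (rule ring.idealI_closed[OF ring_free_algebra])
  show "{p \<in> ncpolys V. eval p = \<zero>} \<subseteq> carrier (free_algebra V)" by (auto simp: free_algebra_def)
qed (auto simp: free_algebra_def eval_zero eval_add eval_mult zero_in_ncpolys add_in_ncpolys mult_in_ncpolys)

lemma (in nc_evaluation) eval_diff_zero_iff:
  assumes "p \<in> ncpolys V" "q \<in> ncpolys V"
  shows "p - q \<in> {p \<in> ncpolys V. eval p = \<zero>} \<longleftrightarrow> eval p = eval q"
proof -
  have "p - q \<in> ncpolys V" using add_in_ncpolys[OF assms(1) uminus_in_ncpolys[OF assms(2)]] by simp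
  moreover have "eval (p - q) = eval p \<ominus> eval q"
    using eval_add[OF assms(1) uminus_in_ncpolys[OF assms(2)]] assms by (simp add: eval_uminus a_minus_def)
  moreover have "eval p \<ominus> eval q = \<zero> \<longleftrightarrow> eval p = eval q"
    using assms eval_closed by (metis r_right_minus_eq)
  ultimately show ?thesis by simp
qed

lemma poly_eval_sum_index:
  assumes Z: "\<And>x. x \<in> V \<Longrightarrow> Z x \<in> carrier_mat n n" and "finite M"
    and f: "\<And>m. m \<in> M \<Longrightarrow> f m \<in> ncpolys V" and ij: "i < n" "j < n"
  shows "poly_eval n Z (\<Sum>m\<in>M. ncconst (c m) * f m) $$ (i, j) =
    (\<Sum>m\<in>M. c m * poly_eval n Z (f m) $$ (i, j :: nat))"
  using \<open>finite M\<close> f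
proof induction
  case empty
  show ?case using poly_eval_const[of V Z n 0, OF Z] ij by simp
next
  case (insert m M)
  have m: "f m \<in> ncpolys V" "(\<Sum>m\<in>M. ncconst (c m) * f m) \<in> ncpolys V"
    using insert.prems by (auto intro!: sum_in_ncpolys mult_in_ncpolys ncconst_in_ncpolys)
  note cl = poly_eval_closed[of V Z, OF Z m(1)] poly_eval_closed[of V Z, OF Z m(2)]
  have "poly_eval n Z (\<Sum>m\<in>insert m M. ncconst (c m) * f m) =
      c m \<cdot>\<^sub>m poly_eval n Z (f m) + poly_eval n Z (\<Sum>m\<in>M. ncconst (c m) * f m)"
    using insert(1,2) m cl
    by (simp add: poly_eval_add[of V Z, OF Z] poly_eval_mult[of V Z, OF Z] poly_eval_const[of V Z, OF Z]
        mult_in_ncpolys ncconst_in_ncpolys scalar_mult_mat)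
  then show ?case using insert cl ij by simp
qed

section \<open>The resolvent ring is a coproduct\<close>

lemma ratexprs_common:
  fixes e :: "'s \<Rightarrow> ('x, 'k::field_char_0) ratexpr"
  assumes "finite S" "e ` S \<subseteq> ratexprs V"
  shows "\<exists>c \<in> ratexprs V. \<forall>n A s. (n, A) \<in> expr_dom V c \<longrightarrow> s \<in> S \<longrightarrow> (n, A) \<in> expr_dom V (e s)"
  using assms
proof induction
  case empty
  then show ?case using ratexprs_Poly[OF zero_in_ncpolys] by auto
next
  case (insert s S)
  then obtain c where c: "c \<in> ratexprs V"
    "\<And>n A s. (n, A) \<in> expr_dom V c \<Longrightarrow> s \<in> S \<Longrightarrow> (n, A) \<in> expr_dom V (e s)" by auto
  have "e s \<in> ratexprs V" using insert.prems by simp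
  then show ?case
    by (intro bexI[OF _ ratexprs_Add[OF _ c(1), of "e s"]]) (auto dest: c(2))
qed

context resolvent
begin

definition formal_vars :: "('x + ('x, 'k) ratfun) set" where
  "formal_vars = Inl ` (X - X') \<union> Inr ` carrier coefficient_ring"

text \<open>
  Formal expressions are polynomials in the variables outside \<open>X'\<close> and in the elements of the
  coefficient ring, which are treated as variables. A formal expression thus
  records how an element of the resolvent ring is built from its generators.
\<close>

definition formal_val :: "('x + ('x, 'k) ratfun, 'k) ncpoly \<Rightarrow> ('x, 'k) ratfun" where
  "formal_val = nc_eval (free_skew_field X) (\<lambda>c. poly_ratfun X (ncconst c))
     (case_sum (\<lambda>x. poly_ratfun X (ncvar x)) (ratfun_incl X))"

lemma formal_var_closed:
  "z \<in> formal_vars \<Longrightarrow>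
    case_sum (\<lambda>x. poly_ratfun X (ncvar x)) (ratfun_incl X) z \<in> carrier (free_skew_field X)"
  by (auto simp: formal_vars_def intro!: poly_ratfun_closed ncvar_in_ncpolys
      ratfun_incl_closed[OF subset] coefficient_ratfun)

sublocale formal: nc_evaluation "free_skew_field X" "\<lambda>c. poly_ratfun X (ncconst c)"
    "case_sum (\<lambda>x. poly_ratfun X (ncvar x)) (ratfun_incl X)" formal_vars
  rewrites "nc_eval (free_skew_field X) (\<lambda>c. poly_ratfun X (ncconst c))
     (case_sum (\<lambda>x. poly_ratfun X (ncvar x)) (ratfun_incl X)) = formal_val"
  by (rule nc_evaluation_rat[OF formal_var_closed]) (simp_all add: formal_val_def)

lemma formal_vars_intros:
  "x \<in> X - X' \<Longrightarrow> Inl x \<in> formal_vars" "F \<in> carrier coefficient_ring \<Longrightarrow> Inr F \<in> formal_vars"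
  by (auto simp: formal_vars_def)

lemma formal_val_relations:
  "F \<in> carrier coefficient_ring \<Longrightarrow> G \<in> carrier coefficient_ring \<Longrightarrow>
    formal_val (ncvar (Inr F) * ncvar (Inr G)) = formal_val (ncvar (Inr (F \<otimes>\<^bsub>coefficient_ring\<^esub> G)))"
  "formal_val 1 = formal_val (ncvar (Inr \<one>\<^bsub>coefficient_ring\<^esub>))"
proof -
  interpret K: ring coefficient_ring by (rule ring_coefficient_ring)
  have hom: "ratfun_incl X \<in> Ring.ring_hom (free_skew_field X') (free_skew_field X :: ('x, 'k) ratfun ring)"
    by (rule ratfun_incl_hom[OF subset])
  note incl = ring_hom_mult[OF hom] ring_hom_one[OF hom]
  have v: "formal_val (ncvar (Inr F)) = ratfun_incl X F" if "F \<in> carrier coefficient_ring" for F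
    using formal.eval_var[OF formal_vars_intros(2)[OF that]] by simp
  show "formal_val (ncvar (Inr F) * ncvar (Inr G)) = formal_val (ncvar (Inr (F \<otimes>\<^bsub>coefficient_ring\<^esub> G)))"
    if F: "F \<in> carrier coefficient_ring" and G: "G \<in> carrier coefficient_ring" for F G
  proof -
    have "formal_val (ncvar (Inr F) * ncvar (Inr G)) = ratfun_incl X F \<otimes>\<^bsub>free_skew_field X\<^esub> ratfun_incl X G"
      using F G by (simp add: formal.eval_mult v ncvar_in_ncpolys formal_vars_intros)
    also have "\<dots> = ratfun_incl X (F \<otimes>\<^bsub>coefficient_ring\<^esub> G)"
      using incl(1)[OF coefficient_ratfun[OF F] coefficient_ratfun[OF G]] by (simp add: coefficient_ring_simps(2))
    finally show ?thesis using v[OF K.m_closed[OF F G]] by simp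
  qed
  show "formal_val 1 = formal_val (ncvar (Inr \<one>\<^bsub>coefficient_ring\<^esub>))"
    using v[OF K.one_closed] formal.eval_one incl(2) by (simp add: coefficient_ring_simps)
qed

text \<open>
  The resolvent ring has no relations beyond those of a coproduct: a formal expression whose value
  is zero is zero in every ring \<open>Q\<close> that receives the coefficient ring and the remaining variables
  compatibly with scalars. The kernels of both evaluations contain the relations that bring the expression
  into alternating form \<open>P'\<close>. The value of \<open>P'\<close> is zero at all matrices, in particular
  at those that separate monomials, so that all its coefficient tensors vanish; and the kernel in
  \<open>Q\<close> contains the linear relations between coefficients, because these hold in the coefficient ring.
\<close>

lemma formal_val_zero_imp:
  fixes Q :: "('q, 'm) ring_scheme" and \<alpha> :: "('x, 'k) ratfun \<Rightarrow> 'q" and \<xi> :: "'x \<Rightarrow> 'q"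
  assumes Q: "nc_evaluation Q (\<lambda>c. \<alpha> (poly_ratfun X' (ncconst c))) (case_sum \<xi> \<alpha>) formal_vars"
    and \<alpha>: "\<alpha> \<in> Ring.ring_hom coefficient_ring Q"
    and P: "P \<in> ncpolys formal_vars" and 0: "formal_val P = \<zero>\<^bsub>free_skew_field X\<^esub>"
  shows "nc_eval Q (\<lambda>c. \<alpha> (poly_ratfun X' (ncconst c))) (case_sum \<xi> \<alpha>) P = \<zero>\<^bsub>Q\<^esub>"
proof -
  let ?K = coefficient_ring
  interpret K: ring ?K by (rule ring_coefficient_ring)
  interpret Q: nc_evaluation Q "\<lambda>c. \<alpha> (poly_ratfun X' (ncconst c))" "case_sum \<xi> \<alpha>" formal_vars
    by (rule Q)
  define N1 where "N1 = {p \<in> ncpolys formal_vars. formal_val p = \<zero>\<^bsub>free_skew_field X\<^esub>}"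
  define N2 where "N2 = {p \<in> ncpolys formal_vars. Q.eval p = \<zero>\<^bsub>Q\<^esub>}"
  have N1: "ideal N1 (free_algebra formal_vars)"
    unfolding N1_def by (rule formal.kernel_ideal)
  have N2: "ideal N2 (free_algebra formal_vars)"
    unfolding N2_def by (rule Q.kernel_ideal)
  have var: "(ncvar (Inr F) :: ('x + ('x, 'k) ratfun, 'k) ncpoly) \<in> ncpolys formal_vars" if "F \<in> carrier ?K" for F
    by (intro ncvar_in_ncpolys formal_vars_intros that)
  have rel1: "ncvar (Inr F) * ncvar (Inr G) - ncvar (Inr (F \<otimes>\<^bsub>?K\<^esub> G)) \<in> N1"
    if "F \<in> carrier ?K" "G \<in> carrier ?K" for F G
    unfolding N1_def using that formal_val_relations(1)[OF that]
    by (subst formal.eval_diff_zero_iff) (auto intro!: var mult_in_ncpolys)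
  have one1: "1 - ncvar (Inr \<one>\<^bsub>?K\<^esub>) \<in> N1"
    unfolding N1_def using formal_val_relations(2)
    by (subst formal.eval_diff_zero_iff) (auto intro!: var one_in_ncpolys)
  have Qv: "Q.eval (ncvar (Inr F)) = \<alpha> F" if "F \<in> carrier ?K" for F
    using Q.eval_var[OF formal_vars_intros(2)[OF that]] by simp
  have rel2: "ncvar (Inr F) * ncvar (Inr G) - ncvar (Inr (F \<otimes>\<^bsub>?K\<^esub> G)) \<in> N2"
    if "F \<in> carrier ?K" "G \<in> carrier ?K" for F G
  proof -
    have "Q.eval (ncvar (Inr F) * ncvar (Inr G)) = Q.eval (ncvar (Inr (F \<otimes>\<^bsub>?K\<^esub> G)))"
      using that by (simp add: Q.eval_mult var Qv ring_hom_mult[OF \<alpha>])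
    then show ?thesis
      unfolding N2_def using that by (subst Q.eval_diff_zero_iff) (auto intro!: var mult_in_ncpolys)
  qed
  have one2: "1 - ncvar (Inr \<one>\<^bsub>?K\<^esub>) \<in> N2"
  proof -
    have "Q.eval 1 = Q.eval (ncvar (Inr \<one>\<^bsub>?K\<^esub>))"
      by (simp add: Q.eval_one Qv ring_hom_one[OF \<alpha>])
    then show ?thesis
      unfolding N2_def by (subst Q.eval_diff_zero_iff) (auto intro!: var one_in_ncpolys)
  qed
  define M where "M = Poly_Mapping.keys P"
  define c where "c = Poly_Mapping.lookup P"
  define a where "a m = fst (alt_form ?K (letters m))" for m :: "('x + ('x, 'k) ratfun) ncword"
  define xs where "xs m = snd (alt_form ?K (letters m))" for m :: "('x + ('x, 'k) ratfun) ncword"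
  define P' where "P' = (\<Sum>m\<in>M. ncconst (c m) * alt_mono (a m) (xs m))"
  have diff1: "P - P' \<in> N1" and diff2: "P - P' \<in> N2"
    unfolding P'_def M_def c_def a_def xs_def
    by (rule ncpoly_alt_form[OF K.ring_axioms formal_vars_def _ _ _ P]; fact N1 N2 rel1 rel2 one1 one2)+
  have fM: "finite M" by (simp add: M_def)
  have form: "a m \<in> carrier ?K" "fst ` set (xs m) \<subseteq> X - X'" "snd ` set (xs m) \<subseteq> carrier ?K"
    if "m \<in> M" for m
    using alt_form_closed[OF K.ring_axioms, of "letters m" "X - X'"] P that
    by (auto simp: a_def xs_def M_def ncpolys_def formal_vars_def)
  define S where "S = (\<Union>m\<in>M. insert (a m) (snd ` set (xs m)))"
  have S: "finite S" "S \<subseteq> carrier ?K"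
    unfolding S_def using fM form(1,3) by (simp, blast)
  have SM: "a m \<in> S" "snd ` set (xs m) \<subseteq> S" if "m \<in> M" for m using that by (auto simp: S_def)
  define V where "V = Inl ` (X - X') \<union> Inr ` S"
  have V: "V \<subseteq> formal_vars" using S by (auto simp: V_def formal_vars_def)
  have mono_V: "(alt_mono (a m) (xs m) :: (_, 'k) ncpoly) \<in> ncpolys V" if "m \<in> M" for m
  proof (rule alt_mono_in)
    show "Inr (a m) \<in> V" using SM(1)[OF that] by (simp add: V_def)
    fix y b assume "(y, b) \<in> set (xs m)"
    then have "y \<in> fst ` set (xs m)" "b \<in> snd ` set (xs m)" by force+
    then have "y \<in> X - X'" "b \<in> S" using SM(2)[OF that] form(2)[OF that] by blast+
    then show "Inl y \<in> V \<and> Inr b \<in> V" unfolding V_def by blast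
  qed
  have P'V: "P' \<in> ncpolys V"
    unfolding P'_def by (intro sum_in_ncpolys mult_in_ncpolys ncconst_in_ncpolys mono_V)
  then have P'W: "P' \<in> ncpolys formal_vars" using ncpolys_subset[OF V] by blast
  \<comment> \<open>One representative is fixed for each coefficient: the domain of a single expression is closed under direct sums.\<close>
  define rep where "rep s = (SOME e. e \<in> s)" for s :: "('x, 'k) ratfun"
  have rep: "rep s \<in> s" "rep s \<in> ratexprs X'" "s = rat_class X' (rep s)" if "s \<in> S" for s
  proof -
    have s: "s \<in> carrier (free_skew_field X')" using that S coefficient_ratfun by blast
    then show 1: "rep s \<in> s" unfolding rep_def using rat_obtain[OF s] by (metis someI)
    show "rep s \<in> ratexprs X'" "s = rat_class X' (rep s)" using rat_repr[OF s 1] by auto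
  qed
  have over: "expr_over X' (rep s)" if "s \<in> S" for s using rep(2)[OF that] by (simp add: ratexprs_def)
  define D where "D = {(n, A). (n, A) \<in> ncpoints X' \<and> (\<forall>s\<in>S. expr_defined n A (rep s))}"
  define ev where "ev n A s = expr_eval n A (rep s)" for n and A :: "'x \<Rightarrow> 'k mat" and s
  have D: "(n, A) \<in> ncpoints X'" "\<And>s. s \<in> S \<Longrightarrow> expr_defined n A (rep s)" if "(n, A) \<in> D" for n A
    using that by (auto simp: D_def)
  have ev: "ev n A s \<in> carrier_mat n n" if "(n, A) \<in> D" "s \<in> S" for n A s
    unfolding ev_def using D[OF that(1)] that(2) over by (intro expr_eval_closed ncpointsD(2)) auto
  have val: "has_val X' s n A (ev n A s)" if "(n, A) \<in> D" "s \<in> S" for n A s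
    using has_val_class[OF rep(2)[OF that(2)], of n A] D[OF that(1)] that(2) rep(3)[OF that(2)]
    by (simp add: ev_def expr_dom_iff)
  have D_sum: "\<exists>C. (n + m, C) \<in> D \<and> (\<forall>s\<in>S. ev (n + m) C s = block_sum (ev n A s) (ev m B s))"
    if A: "(n, A) \<in> D" and B: "(m, B) \<in> D" for n A m B
  proof -
    let ?C = "restrict (\<lambda>x. block_sum (A x) (B x)) X'"
    note pA = ncpointsD[OF D(1)[OF A]] and pB = ncpointsD[OF D(1)[OF B]]
    have "expr_defined (n + m) ?C (rep s) \<and>
        expr_eval (n + m) ?C (rep s) = block_sum (expr_eval n A (rep s)) (expr_eval m B (rep s))"
      if "s \<in> S" for s
      using expr_block_sum[of X' A n B m ?C "rep s", OF pA(2) pB(2) _ over[OF that] D(2)[OF A that] D(2)[OF B that]]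
      by simp
    moreover have "(n + m, ?C) \<in> ncpoints X'"
      using pA pB by (intro restrict_in_ncpoints) auto
    ultimately show ?thesis by (intro exI[of _ ?C]) (auto simp: D_def ev_def)
  qed
  obtain g where g: "g \<in> ratexprs X'" "\<And>n A. (n, A) \<in> expr_dom X' g \<Longrightarrow> (n, A) \<in> D"
  proof -
    have "rep ` S \<subseteq> ratexprs X'" using rep(2) by blast
    from ratexprs_common[OF S(1) this] obtain g where g: "g \<in> ratexprs X'"
      "\<And>n A s. (n, A) \<in> expr_dom X' g \<Longrightarrow> s \<in> S \<Longrightarrow> (n, A) \<in> expr_dom X' (rep s)" by blast
    show thesis
      by (rule that[OF g(1)]) (use g(2) in \<open>auto simp: D_def expr_dom_iff\<close>)
  qed
  \<comment> \<open>The scalar functions on coefficients are the matrix entries of their values.\<close>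
  let ?\<Omega> = "{(n, A, i, j). (n, A) \<in> D \<and> i < n \<and> j < n}"
  let ?val = "\<lambda>s (n, A, i, j). ev n A s $$ (i, j)"
  have lin: "(\<Sum>s\<in>S. ncconst (d s) * ncvar (Inr s)) \<in> N2"
    if d: "\<And>\<omega>. \<omega> \<in> ?\<Omega> \<Longrightarrow> (\<Sum>s\<in>S. d s * ?val s \<omega>) = 0" for d
  proof -
    \<comment> \<open>A linear combination of coefficients is formed in the coefficient ring and evaluated there; it is zero as soon as its entries are.\<close>
    have "\<exists>F \<in> carrier ?K. Q.eval (\<Sum>s\<in>T. ncconst (d s) * ncvar (Inr s)) = \<alpha> F \<and>
        (\<forall>n A. (n, A) \<in> D \<longrightarrow> (\<exists>L \<in> carrier_mat n n. has_val X' F n A L \<and>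
          (\<forall>i<n. \<forall>j<n. L $$ (i, j) = (\<Sum>s\<in>T. d s * ev n A s $$ (i, j)))))"
      if "finite T" "T \<subseteq> S" for T
      using that
    proof induction
      case empty
      have "has_val X' \<zero>\<^bsub>?K\<^esub> n A (0\<^sub>m n n)" if "(n, A) \<in> D" for n A
        using has_val_zero[OF D(1)[OF that]] by (simp add: coefficient_ring_simps)
      then show ?case
        using ring_hom_zero[OF \<alpha> K.ring_axioms Q.ring_axioms]
        by (intro bexI[of _ "\<zero>\<^bsub>?K\<^esub>"] conjI allI impI bexI[of _ "0\<^sub>m n n" for n])
          (auto simp: Q.eval_zero)
    next
      case (insert s T)
      then obtain F where F: "F \<in> carrier ?K" "Q.eval (\<Sum>s\<in>T. ncconst (d s) * ncvar (Inr s)) = \<alpha> F"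
        and FL: "\<And>n A. (n, A) \<in> D \<Longrightarrow> \<exists>L \<in> carrier_mat n n. has_val X' F n A L \<and>
          (\<forall>i<n. \<forall>j<n. L $$ (i, j) = (\<Sum>s\<in>T. d s * ev n A s $$ (i, j)))"
        by auto
      have s: "s \<in> S" "s \<in> carrier ?K" using insert.prems S by auto
      let ?d = "poly_ratfun X' (ncconst (d s))"
      have dK: "?d \<in> carrier ?K" by (rule poly_in_coefficient_ring[OF ncconst_in_ncpolys])
      let ?F = "?d \<otimes>\<^bsub>?K\<^esub> s \<oplus>\<^bsub>?K\<^esub> F"
      have T: "(\<Sum>s\<in>T. ncconst (d s) * ncvar (Inr s)) \<in> ncpolys formal_vars"
        using insert.prems S by (intro sum_in_ncpolys mult_in_ncpolys ncconst_in_ncpolys var) auto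
      have "Q.eval (\<Sum>s\<in>insert s T. ncconst (d s) * ncvar (Inr s)) = \<alpha> ?d \<otimes>\<^bsub>Q\<^esub> \<alpha> s \<oplus>\<^bsub>Q\<^esub> \<alpha> F"
        using insert(1,2) T s F(2)
        by (simp add: Q.eval_add Q.eval_mult Q.eval_const Qv var mult_in_ncpolys ncconst_in_ncpolys)
      also have "\<dots> = \<alpha> ?F"
        using dK s F(1) by (simp add: ring_hom_add[OF \<alpha>] ring_hom_mult[OF \<alpha>])
      finally have 1: "Q.eval (\<Sum>s\<in>insert s T. ncconst (d s) * ncvar (Inr s)) = \<alpha> ?F" .
      have 2: "\<exists>L \<in> carrier_mat n n. has_val X' ?F n A L \<and>
          (\<forall>i<n. \<forall>j<n. L $$ (i, j) = (\<Sum>s\<in>insert s T. d s * ev n A s $$ (i, j)))"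
        if A: "(n, A) \<in> D" for n A
      proof -
        obtain L where L: "L \<in> carrier_mat n n" "has_val X' F n A L"
          "\<forall>i<n. \<forall>j<n. L $$ (i, j) = (\<Sum>s\<in>T. d s * ev n A s $$ (i, j))"
          using FL[OF A] by blast
        let ?L = "(d s \<cdot>\<^sub>m 1\<^sub>m n) * ev n A s + L"
        note rf = coefficient_ratfun[OF dK] coefficient_ratfun[OF s(2)] coefficient_ratfun[OF F(1)]
        have "has_val X' ?F n A ?L"
          unfolding coefficient_ring_simps
          by (intro has_val_add has_val_mult rat_mult_closed rf has_val_const[OF D(1)[OF A]] val[OF A s(1)] L(2))
        moreover have "?L = d s \<cdot>\<^sub>m ev n A s + L" using ev[OF A s(1)] by (simp add: scalar_mult_mat)
        ultimately show ?thesis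
          using L ev[OF A s(1)] insert(1,2) by (intro bexI[of _ "d s \<cdot>\<^sub>m ev n A s + L"]) auto
      qed
      show ?case using 1 2 dK s(2) F(1) by (intro bexI[of _ ?F]) auto
    qed
    from this[OF S(1) subset_refl] obtain F where F: "F \<in> carrier ?K"
      "Q.eval (\<Sum>s\<in>S. ncconst (d s) * ncvar (Inr s)) = \<alpha> F"
      and FL: "\<And>n A. (n, A) \<in> D \<Longrightarrow> \<exists>L \<in> carrier_mat n n. has_val X' F n A L \<and>
          (\<forall>i<n. \<forall>j<n. L $$ (i, j) = (\<Sum>s\<in>S. d s * ev n A s $$ (i, j)))"
      by blast
    have "F = \<zero>\<^bsub>free_skew_field X'\<^esub>"
    proof (rule rat_eqI[OF coefficient_ratfun[OF F(1)] resolve.zero_closed g(1)])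
      fix n A assume "(n, A) \<in> expr_dom X' g"
      then have A: "(n, A) \<in> D" by (rule g(2))
      obtain L where L: "L \<in> carrier_mat n n" "has_val X' F n A L"
          "\<forall>i<n. \<forall>j<n. L $$ (i, j) = (\<Sum>s\<in>S. d s * ev n A s $$ (i, j))"
          using FL[OF A] by blast
      have "L $$ (i, j) = 0" if "i < n" "j < n" for i j
        using L(3) d[of "(n, A, i, j)"] A that by simp
      then have "L = 0\<^sub>m n n" using L(1) by (intro eq_matI) auto
      then show "\<exists>M. has_val X' F n A M \<and> has_val X' \<zero>\<^bsub>free_skew_field X'\<^esub> n A M"
        using L(2) has_val_zero[OF D(1)[OF A]] by blast
    qed
    then have "Q.eval (\<Sum>s\<in>S. ncconst (d s) * ncvar (Inr s)) = \<zero>\<^bsub>Q\<^esub>"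
      using F(2) ring_hom_zero[OF \<alpha> K.ring_axioms Q.ring_axioms] by (simp add: coefficient_ring_simps)
    moreover have "(\<Sum>s\<in>S. ncconst (d s) * ncvar (Inr s)) \<in> ncpolys formal_vars"
      using S by (intro sum_in_ncpolys mult_in_ncpolys ncconst_in_ncpolys var) auto
    ultimately show ?thesis by (simp add: N2_def)
  qed
  have "P' \<in> N2"
    unfolding P'_def
  proof (rule alt_mono_vanish[OF S(1) _ N2 lin fM])
    show "Inr ` S \<subseteq> formal_vars" using S by (auto simp: formal_vars_def)
    fix w :: "'x list" and \<omega>s
    assume \<omega>s: "set \<omega>s \<subseteq> ?\<Omega>" "length \<omega>s = Suc (length w)"
    have "\<exists>n A (B :: 'x \<Rightarrow> 'k mat) i j. (n, A) \<in> D \<and> (\<forall>y. B y \<in> carrier_mat n n) \<and> i < n \<and> j < n \<and>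
      (\<forall>b ys. b \<in> S \<longrightarrow> snd ` set ys \<subseteq> S \<longrightarrow>
        poly_eval n (case_sum B (ev n A)) (alt_mono b ys) $$ (i, j) =
        (if map fst ys = w then alt_val ?val b ys \<omega>s else 0))"
      using ev D_sum \<omega>s by (rule alt_mono_separation)
    then obtain n A and B :: "'x \<Rightarrow> 'k mat" and i j where *: "(n, A) \<in> D \<and> (\<forall>y. B y \<in> carrier_mat n n) \<and> i < n \<and> j < n \<and>
      (\<forall>b ys. b \<in> S \<longrightarrow> snd ` set ys \<subseteq> S \<longrightarrow>
        poly_eval n (case_sum B (ev n A)) (alt_mono b ys) $$ (i, j) =
        (if map fst ys = w then alt_val ?val b ys \<omega>s else 0))"
      by (elim exE) (rule that)
    then have A: "(n, A) \<in> D" and B: "\<And>y. B y \<in> carrier_mat n n" and ij: "i < n" "j < n"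
      and sep: "\<And>b ys. b \<in> S \<Longrightarrow> snd ` set ys \<subseteq> S \<Longrightarrow>
        poly_eval n (case_sum B (ev n A)) (alt_mono b ys) $$ (i, j) =
        (if map fst ys = w then alt_val ?val b ys \<omega>s else 0)"
      by auto
    let ?Z = "case_sum B (ev n A)"
    let ?A = "\<lambda>x\<in>X. if x \<in> X' then A x else B x"
    note p = ncpoints_extend[OF subset D(1)[OF A], of B, OF B]
    have vals: "has_val X (case_sum (\<lambda>x. poly_ratfun X (ncvar x)) (ratfun_incl X) z) n ?A (?Z z)"
      if z: "z \<in> V" for z
    proof (cases z)
      case (Inl x)
      then have x: "x \<in> X" "x \<notin> X'" using z by (auto simp: V_def)
      have "poly_eval n ?A (ncvar x) = ?A x"
        using poly_eval_var[of X ?A n x, OF ncpointsD(2)[OF p(1)] x(1)] .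
      then show ?thesis
        using has_val_poly[OF ncvar_in_ncpolys[OF x(1)] p(1)] x by (simp add: Inl)
    next
      case (Inr s)
      then have s: "s \<in> S" using z by (auto simp: V_def)
      then have sK: "s \<in> carrier ?K" using S by blast
      show ?thesis
        using has_val_incl[OF subset coefficient_ratfun[OF sK] p(1)] val[OF A s] p(2) by (simp add: Inr)
    qed
    have "has_val X (formal_val P') n ?A (poly_eval n ?Z P')"
      unfolding formal_val_def
      by (rule has_val_nc_eval[OF _ p(1) vals P'V]) (use formal_var_closed V in blast)+
    moreover have "formal_val P' = \<zero>\<^bsub>free_skew_field X\<^esub>"
    proof -
      have "formal_val P = formal_val P'"
        using diff1 formal.eval_diff_zero_iff[OF P P'W] unfolding N1_def by simp
      then show ?thesis using 0 by simp
    qed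
    ultimately have z: "poly_eval n ?Z P' = 0\<^sub>m n n"
      using rat_eq_zero_iff[OF formal.eval_closed[OF P'W]] by blast
    have Z: "?Z z \<in> carrier_mat n n" if "z \<in> V" for z
      using that B ev[OF A] by (auto simp: V_def)
    have "(\<Sum>m\<in>M. c m * poly_eval n ?Z (alt_mono (a m) (xs m)) $$ (i, j)) = poly_eval n ?Z P' $$ (i, j)"
      unfolding P'_def by (rule poly_eval_sum_index[symmetric, of V ?Z, OF Z fM mono_V ij])
    also have "\<dots> = 0" unfolding z using ij by simp
    finally show "(\<Sum>m\<in>M. c m * (if map fst (xs m) = w then alt_val ?val (a m) (xs m) \<omega>s else 0)) = 0"
      using sep[OF SM] by simp
  next
    fix m assume m: "m \<in> M"
    show "a m \<in> S" "snd ` set (xs m) \<subseteq> S" using SM[OF m] by auto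
    show "Inl ` fst ` set (xs m) \<subseteq> formal_vars" unfolding formal_vars_def using form(2)[OF m] by blast
  qed
  then have "Q.eval P' = \<zero>\<^bsub>Q\<^esub>" by (simp add: N2_def)
  then show ?thesis
    using diff2 Q.eval_diff_zero_iff[OF P P'W] unfolding N2_def by simp
qed

text \<open>
  The elements of the resolvent ring that some formal expression represents and that the same
  expression annihilates in \<open>Q\<close> form an ideal \<open>J\<close>, which contains the image of \<open>I\<close>. As formal expressions with
  equal values are equal in \<open>Q\<close>, a polynomial in \<open>J\<close> is sent to zero by \<open>\<beta>\<close>.
\<close>

lemma pushout_kernel:
  fixes Q :: "('q, 'm) ring_scheme" and \<alpha> :: "('x, 'k) ratfun \<Rightarrow> 'q" and \<beta> :: "('x, 'k) ncpoly \<Rightarrow> 'q"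
  assumes Q: "ring Q" and \<alpha>: "\<alpha> \<in> Ring.ring_hom coefficient_ring Q"
    and \<beta>: "\<beta> \<in> Ring.ring_hom (free_algebra X) Q"
    and agree: "\<And>p. p \<in> ncpolys X' \<Longrightarrow> \<alpha> (poly_ratfun X' p) = \<beta> p"
    and I: "I \<subseteq> ncpolys X" "\<And>p. p \<in> I \<Longrightarrow> \<beta> p = \<zero>\<^bsub>Q\<^esub>"
    and f: "f \<in> ncpolys X" "poly_ratfun X f \<in> Idl\<^bsub>R\<^esub> (poly_ratfun X ` I)"
  shows "\<beta> f = \<zero>\<^bsub>Q\<^esub>"
proof -
  let ?K = coefficient_ring
  interpret Q: ring Q by fact
  interpret R: ring R by (rule ring_resolvent_ring)
  interpret K: ring ?K by (rule ring_coefficient_ring)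
  let ?\<sigma> = "\<lambda>c. \<alpha> (poly_ratfun X' (ncconst c))" and ?\<xi> = "\<lambda>x. \<beta> (ncvar x)"
  have b1: "\<beta> p \<in> carrier Q" if "p \<in> ncpolys X" for p
    using ring_hom_closed[OF \<beta>, of p] that by (simp add: free_algebra_def)
  have b: "\<beta> (p + q) = \<beta> p \<oplus>\<^bsub>Q\<^esub> \<beta> q" "\<beta> (p * q) = \<beta> p \<otimes>\<^bsub>Q\<^esub> \<beta> q"
    if "p \<in> ncpolys X" "q \<in> ncpolys X" for p q
    using ring_hom_add[OF \<beta>, of p q] ring_hom_mult[OF \<beta>, of p q] that
    by (simp_all add: free_algebra_def)
  have \<sigma>: "?\<sigma> c = \<beta> (ncconst c)" for c by (rule agree[OF ncconst_in_ncpolys])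
  interpret kc: nc_evaluation "free_skew_field X'" "\<lambda>c. poly_ratfun X' (ncconst c)" "\<lambda>F. F" "carrier ?K"
    by (rule nc_evaluation_rat) (rule coefficient_ratfun)
  have ev: "nc_evaluation Q ?\<sigma> (case_sum ?\<xi> \<alpha>) formal_vars"
  proof (intro nc_evaluation.intro Q.ring_axioms nc_evaluation_axioms.intro)
    fix c d :: 'k
    show "?\<sigma> c \<in> carrier Q" unfolding \<sigma> by (intro b1 ncconst_in_ncpolys)
    show "?\<sigma> (c + d) = ?\<sigma> c \<oplus>\<^bsub>Q\<^esub> ?\<sigma> d" "?\<sigma> (c * d) = ?\<sigma> c \<otimes>\<^bsub>Q\<^esub> ?\<sigma> d"
      unfolding \<sigma> unfolding ncconst_add ncconst_mult by (intro b ncconst_in_ncpolys)+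
    show "?\<sigma> 1 = \<one>\<^bsub>Q\<^esub>" unfolding \<sigma> using ring_hom_one[OF \<beta>] by (simp add: free_algebra_def)
    fix z assume z: "z \<in> formal_vars"
    show "case_sum ?\<xi> \<alpha> z \<in> carrier Q"
      using z ring_hom_closed[OF \<alpha>] b1[OF ncvar_in_ncpolys] by (auto simp: formal_vars_def)
    show "?\<sigma> c \<otimes>\<^bsub>Q\<^esub> case_sum ?\<xi> \<alpha> z = case_sum ?\<xi> \<alpha> z \<otimes>\<^bsub>Q\<^esub> ?\<sigma> c"
    proof (cases z)
      case (Inl x)
      then have x: "ncvar x \<in> ncpolys X" using z by (intro ncvar_in_ncpolys) (auto simp: formal_vars_def)
      show ?thesis
        unfolding Inl sum.case \<sigma> b(2)[OF ncconst_in_ncpolys x, symmetric] b(2)[OF x ncconst_in_ncpolys, symmetric]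
          ncconst_commute[OF x] ..
    next
      case (Inr F)
      then have F: "F \<in> carrier ?K" using z by (auto simp: formal_vars_def)
      have c: "poly_ratfun X' (ncconst c) \<in> carrier ?K" by (rule poly_in_coefficient_ring[OF ncconst_in_ncpolys])
      have "poly_ratfun X' (ncconst c) \<otimes>\<^bsub>?K\<^esub> F = F \<otimes>\<^bsub>?K\<^esub> poly_ratfun X' (ncconst c)"
        using kc.commute[OF F] by (simp add: coefficient_ring_simps(2))
      then show ?thesis
        unfolding Inr sum.case ring_hom_mult[OF \<alpha> c F, symmetric] ring_hom_mult[OF \<alpha> F c, symmetric] by simp
    qed
  qed
  interpret E: nc_evaluation Q ?\<sigma> "case_sum ?\<xi> \<alpha>" formal_vars by (rule ev)
  have key: "E.eval P = \<zero>\<^bsub>Q\<^esub>" if "P \<in> ncpolys formal_vars" "formal_val P = \<zero>\<^bsub>free_skew_field X\<^esub>" for P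
    by (rule formal_val_zero_imp[OF ev \<alpha> that])
  have lift: "\<exists>P \<in> ncpolys formal_vars. formal_val P = poly_ratfun X p \<and> E.eval P = \<beta> p" if "p \<in> ncpolys X" for p
    using that
  proof (induction rule: ncpolys_induct)
    case (const c)
    show ?case
      using E.eval_const[of c] \<sigma>[of c] formal.eval_const[of c]
      by (intro bexI[of _ "ncconst c"] ncconst_in_ncpolys) simp
  next
    case (var x)
    show ?case
    proof (cases "x \<in> X'")
      case True
      have K: "poly_ratfun X' (ncvar x) \<in> carrier ?K"
        by (intro poly_in_coefficient_ring ncvar_in_ncpolys True)
      show ?thesis
        using formal.eval_var[OF formal_vars_intros(2)[OF K]] E.eval_var[OF formal_vars_intros(2)[OF K]]
          ratfun_incl_poly[OF subset ncvar_in_ncpolys[OF True]] agree[OF ncvar_in_ncpolys[OF True]]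
        by (intro bexI[of _ "ncvar (Inr (poly_ratfun X' (ncvar x)))"] ncvar_in_ncpolys formal_vars_intros K) simp
    next
      case False
      then have x: "x \<in> X - X'" using var by simp
      show ?thesis
        using formal.eval_var[OF formal_vars_intros(1)[OF x]] E.eval_var[OF formal_vars_intros(1)[OF x]]
        by (intro bexI[of _ "ncvar (Inl x)"] ncvar_in_ncpolys formal_vars_intros x) simp
    qed
  next
    case (add p q)
    then obtain P P' where "P \<in> ncpolys formal_vars" "formal_val P = poly_ratfun X p" "E.eval P = \<beta> p"
      "P' \<in> ncpolys formal_vars" "formal_val P' = poly_ratfun X q" "E.eval P' = \<beta> q" by blast
    then show ?case
      using ring_hom_add[OF poly_ratfun_hom[of X], of p q] add(1,2)
      by (intro bexI[of _ "P + P'"])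
        (simp_all add: formal.eval_add E.eval_add b free_algebra_def add_in_ncpolys)
  next
    case (mult p q)
    then obtain P P' where "P \<in> ncpolys formal_vars" "formal_val P = poly_ratfun X p" "E.eval P = \<beta> p"
      "P' \<in> ncpolys formal_vars" "formal_val P' = poly_ratfun X q" "E.eval P' = \<beta> q" by blast
    then show ?case
      using ring_hom_mult[OF poly_ratfun_hom[of X], of p q] mult(1,2)
      by (intro bexI[of _ "P * P'"])
        (simp_all add: formal.eval_mult E.eval_mult b free_algebra_def mult_in_ncpolys)
  qed
  have lift_R: "\<exists>P \<in> ncpolys formal_vars. formal_val P = u" if "u \<in> carrier R" for u
    using that
  proof (induction rule: resolvent_ring_induct)
    case (incl F)
    show ?case
      using formal.eval_var[OF formal_vars_intros(2)[OF incl]]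
      by (intro bexI[of _ "ncvar (Inr F)"] ncvar_in_ncpolys formal_vars_intros incl) simp
  next
    case (poly p)
    then show ?case using lift by blast
  next
    case (add u v)
    then show ?case by (metis formal.eval_add add_in_ncpolys)
  next
    case (mult u v)
    then show ?case by (metis formal.eval_mult mult_in_ncpolys)
  qed
  define J where "J = {u \<in> carrier R. \<exists>P \<in> ncpolys formal_vars. formal_val P = u \<and> E.eval P = \<zero>\<^bsub>Q\<^esub>}"
  have "ideal J R"
  proof (rule R.idealI_closed)
    show "J \<subseteq> carrier R" by (auto simp: J_def)
    show "\<zero>\<^bsub>R\<^esub> \<in> J"
      using R.zero_closed zero_in_ncpolys[of formal_vars] formal.eval_zero E.eval_zero
      by (auto simp: J_def resolvent_ring_simps)
  next
    fix u v assume "u \<in> J" "v \<in> J"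
    then obtain P P' where *: "u \<in> carrier R" "P \<in> ncpolys formal_vars" "formal_val P = u" "E.eval P = \<zero>\<^bsub>Q\<^esub>"
      "v \<in> carrier R" "P' \<in> ncpolys formal_vars" "formal_val P' = v" "E.eval P' = \<zero>\<^bsub>Q\<^esub>"
      by (auto simp: J_def)
    then have "formal_val (P + P') = u \<oplus>\<^bsub>R\<^esub> v" "E.eval (P + P') = \<zero>\<^bsub>Q\<^esub>"
      by (simp_all add: formal.eval_add E.eval_add resolvent_ring_simps)
    then show "u \<oplus>\<^bsub>R\<^esub> v \<in> J"
      using * R.a_closed[of u v] add_in_ncpolys[of P formal_vars P'] unfolding J_def by blast
  next
    fix u x assume "u \<in> J" and x: "x \<in> carrier R"
    then obtain P where *: "u \<in> carrier R" "P \<in> ncpolys formal_vars" "formal_val P = u" "E.eval P = \<zero>\<^bsub>Q\<^esub>"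
      by (auto simp: J_def)
    obtain L where L: "L \<in> ncpolys formal_vars" "formal_val L = x"
      using lift_R[OF x] by blast
    have "formal_val (L * P) = x \<otimes>\<^bsub>R\<^esub> u" "E.eval (L * P) = \<zero>\<^bsub>Q\<^esub>"
      "formal_val (P * L) = u \<otimes>\<^bsub>R\<^esub> x" "E.eval (P * L) = \<zero>\<^bsub>Q\<^esub>"
      using * L E.eval_closed[OF L(1)]
      by (simp_all add: formal.eval_mult E.eval_mult resolvent_ring_simps)
    then show "x \<otimes>\<^bsub>R\<^esub> u \<in> J" "u \<otimes>\<^bsub>R\<^esub> x \<in> J"
      using * L R.m_closed[of x u] R.m_closed[of u x] x mult_in_ncpolys[of L formal_vars P]
        mult_in_ncpolys[of P formal_vars L] unfolding J_def by blast+
  qed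
  moreover have "poly_ratfun X ` I \<subseteq> J"
  proof
    fix u assume "u \<in> poly_ratfun X ` I"
    then obtain p where p: "p \<in> I" "u = poly_ratfun X p" by blast
    then have pX: "p \<in> ncpolys X" using I by blast
    show "u \<in> J"
      using lift[OF pX] p I(2)[OF p(1)] poly_in_resolvent_ring[OF pX] by (auto simp: J_def)
  qed
  ultimately have "poly_ratfun X f \<in> J" using R.genideal_minimal f(2) by blast
  then obtain P where P: "P \<in> ncpolys formal_vars" "formal_val P = poly_ratfun X f" "E.eval P = \<zero>\<^bsub>Q\<^esub>"
    by (auto simp: J_def)
  obtain P' where P': "P' \<in> ncpolys formal_vars" "formal_val P' = poly_ratfun X f" "E.eval P' = \<beta> f"
    using lift[OF f(1)] by blast
  have "P' - P \<in> ncpolys formal_vars" using add_in_ncpolys[OF P'(1) uminus_in_ncpolys[OF P(1)]] by simp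
  moreover have "formal_val (P' - P) = \<zero>\<^bsub>free_skew_field X\<^esub>"
    using formal.eval_diff_zero_iff[OF P'(1) P(1)] P P' by simp
  ultimately have "E.eval (P' - P) = \<zero>\<^bsub>Q\<^esub>" by (rule key)
  then have "E.eval P' = E.eval P"
    using E.eval_diff_zero_iff[OF P'(1) P(1)] \<open>P' - P \<in> ncpolys formal_vars\<close> by simp
  then show ?thesis using P P' by simp
qed

lemma ring_hom_free_algebra_subset:
  assumes "V \<subseteq> W" "h \<in> Ring.ring_hom (free_algebra W) Q"
  shows "h \<in> Ring.ring_hom (free_algebra V) Q"
  using assms(2) ncpolys_subset[OF assms(1)] by (auto simp: Ring.ring_hom_def free_algebra_def subset_iff Pi_iff)

lemma graph_subset_zero_locus:
  assumes I: "I \<subseteq> ncpolys X" and v: "\<And>f. f \<in> I \<Longrightarrow> vanishes_on f (tuple_graph X X' r)"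
  shows "tuple_graph X X' r \<subseteq> zero_locus X I"
  using v graph_point(1) by (fastforce simp: zero_locus_def tuple_graph_eq vanishes_on_def)

text \<open>
  The kernel of \<open>resolve\<close> is \<open>I\<close>. The coproduct is the ring \<open>Q\<close> of the previous lemmas, and its
  faithfulness says that a polynomial that becomes zero in it lies in \<open>I\<close>.
\<close>

lemma frr_vanishing_ideal:
  assumes I: "ideal I (free_algebra X)"
    and gen: "Idl\<^bsub>R\<^esub> (poly_ratfun X ` I) = resolvent_ideal X X' r"
    and faithful: "faithful_coproduct (free_algebra X') (free_algebra X Quot I) coefficient_ring
      (\<lambda>p. I +>\<^bsub>free_algebra X\<^esub> p) (poly_ratfun X')"
    and f: "f \<in> ncpolys X"
  shows "f \<in> I \<longleftrightarrow> vanishes_on f (tuple_graph X X' r)"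
proof
  interpret F: ring "free_algebra X :: ('x, 'k) ncpoly ring" by (rule ring_free_algebra)
  interpret I: ideal I "free_algebra X" by (rule I)
  interpret R: ring R by (rule ring_resolvent_ring)
  have carr: "carrier (free_algebra X) = ncpolys X" by (simp add: free_algebra_def)
  have IX: "I \<subseteq> ncpolys X" using I.Icarr unfolding carr by blast
  show "vanishes_on f (tuple_graph X X' r)" if "f \<in> I"
  proof -
    have "poly_ratfun X ` I \<subseteq> carrier R" using IX poly_in_resolvent_ring by blast
    then have "poly_ratfun X f \<in> resolvent_ideal X X' r"
      using R.genideal_self that unfolding gen[symmetric] by blast
    then show ?thesis using resolve_zero_of_mem[OF f] resolve_eq_zero_iff[OF f] by blast
  qed
  show "f \<in> I" if v: "vanishes_on f (tuple_graph X X' r)"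
  proof -
    let ?S = "free_algebra X' :: ('x, 'k) ncpoly ring" and ?Q1 = "free_algebra X Quot I"
    let ?f1 = "\<lambda>p. I +>\<^bsub>free_algebra X\<^esub> p" and ?f2 = "poly_ratfun X'"
    let ?C = "coproduct ?S ?Q1 coefficient_ring ?f1 ?f2"
    let ?in = "coproduct_inj ?S ?Q1 coefficient_ring ?f1 ?f2"
    have sub: "ncpolys X' \<subseteq> ncpolys X" by (rule ncpolys_subset[OF subset])
    have f1: "?f1 \<in> Ring.ring_hom ?S ?Q1"
      by (rule ring_hom_free_algebra_subset[OF subset I.rcos_ring_hom])
    have f2: "?f2 \<in> Ring.ring_hom ?S coefficient_ring"
      using poly_ratfun_hom[of X'] poly_in_coefficient_ring
      by (auto simp: Ring.ring_hom_def free_algebra_def coefficient_ring_simps)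
    note co = coproduct_inj_hom[OF I.quotient_is_ring ring_coefficient_ring f1 f2]
    let ?b = "\<lambda>p. ?in (Inl (?f1 p))"
    have b: "?b \<in> Ring.ring_hom (free_algebra X) ?C"
      using ring_hom_trans[OF I.rcos_ring_hom co(2)] by (simp add: comp_def)
    have I0: "?f1 p = ?f1 0" if "p \<in> I" for p
      using that IX by (intro coset_eqI[OF I]) (auto simp: zero_in_ncpolys)
    have b0: "?b 0 = \<zero>\<^bsub>?C\<^esub>"
      using ring_hom_zero[OF b F.ring_axioms co(1)] by (simp add: free_algebra_def)
    have "poly_ratfun X f \<in> Idl\<^bsub>R\<^esub> (poly_ratfun X ` I)"
      unfolding gen using v resolve_eq_zero_iff[OF f] mem_of_resolve_zero[OF f] by blast
    then have "?b f = \<zero>\<^bsub>?C\<^esub>"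
      using I0 b0 co(4) by (intro pushout_kernel[OF co(1) co(3) b _ IX _ f]) (auto simp: free_algebra_def)
    then have "?in (Inl (?f1 f)) = ?in (Inl (?f1 0))" using b0 by simp
    moreover have "?f1 f \<in> carrier ?Q1" "?f1 0 \<in> carrier ?Q1"
      using ring_hom_closed[OF I.rcos_ring_hom] f zero_in_ncpolys by (auto simp: carr)
    ultimately have "?f1 f = ?f1 0"
      using faithful unfolding faithful_coproduct_def by (auto dest: inj_onD)
    then show "f \<in> I"
      using F.quotient_eq_iff_same_a_r_cos[OF I, of f 0] f free_algebra_minus[OF f zero_in_ncpolys]
      by (simp add: carr zero_in_ncpolys)
  qed
qed

end

section \<open>The two implications\<close>

lemma resolventI:
  assumes "finite X" "resolvent_data X X' r"
  shows "resolvent X X' r"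
  using assms by unfold_locales (auto simp: resolvent_data_def)

lemma frr_imp_grr_nullstellensatz:
  fixes I :: "('x, 'k::field_char_0) ncpoly set"
  assumes X: "finite X" and I: "ideal I (free_algebra X)" and frr: "frr_wrt X X' r I"
    and faithful: "faithful_coproduct (free_algebra X') (free_algebra X Quot I)
      (free_skew_field_height X' (tuple_height X X' r)) (\<lambda>p. I +>\<^bsub>free_algebra X\<^esub> p) (poly_ratfun X')"
  shows "grr X I \<and> nullstellensatz_property X I"
proof -
  have data: "resolvent_data X X' r" using frr by (simp add: frr_wrt_def)
  interpret resolvent X X' r by (rule resolventI[OF X data])
  have gen: "Idl\<^bsub>resolvent_ring X X' r\<^esub> (poly_ratfun X ` I) = resolvent_ideal X X' r"
    using frr by (simp add: frr_wrt_def)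
  note mem = frr_vanishing_ideal[OF I gen faithful]
  have IX: "I \<subseteq> ncpolys X" using ideal.Icarr[OF I] by (auto simp: free_algebra_def)
  have graph: "tuple_graph X X' r \<subseteq> zero_locus X I"
    using IX mem by (intro graph_subset_zero_locus[OF IX]) blast
  have Z: "vanishes_on f (zero_locus X I)" if "f \<in> I" for f
    using that by (auto simp: vanishes_on_def zero_locus_def)
  have "grr_wrt X X' r I"
    unfolding grr_wrt_def using data graph mem Z by blast
  moreover have "f \<in> I" if "f \<in> ncpolys X" "vanishes_on f (zero_locus X I)" for f
    using that graph mem[OF that(1)] unfolding vanishes_on_def by blast
  ultimately show ?thesis
    unfolding grr_def nullstellensatz_property_def using Z by blast
qed

lemma grr_nullstellensatz_embeds:
  fixes I :: "(nat, 'k::field_char_0) ncpoly set"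
  assumes I: "ideal I (free_algebra {1..m})" and grr: "grr {1..m} I"
    and N: "nullstellensatz_property {1..m} I"
  shows "embeds_into_free_skew_field {1..m} I"
proof -
  obtain X' r where g: "grr_wrt {1..m} X' r I" using grr by (auto simp: grr_def)
  then interpret resolvent "{1..m}" X' r by (intro resolventI) (auto simp: grr_wrt_def)
  have "f \<in> I \<longleftrightarrow> vanishes_on f (tuple_graph {1..m} X' r)" if f: "f \<in> ncpolys {1..m}" for f
  proof -
    have "tuple_graph {1..m} X' r \<subseteq> zero_locus {1..m} I" using g by (simp add: grr_wrt_def)
    then have "vanishes_on f (zero_locus {1..m} I) \<longleftrightarrow> vanishes_on f (tuple_graph {1..m} X' r)"
      using g f unfolding grr_wrt_def vanishes_on_def by blast
    then show ?thesis using N f by (simp add: nullstellensatz_property_def)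
  qed
  from quotient_embeds[OF I this] show ?thesis unfolding embeds_into_free_skew_field_def by blast
qed

theorem theorem2p5:
  fixes g :: nat and I :: "(nat, 'k::field_char_0) ncpoly set"
  assumes "ideal I (free_algebra {1..g})"
  shows "(\<forall>X' r. frr_wrt {1..g} X' r I \<and>
            faithful_coproduct
              (free_algebra X')
              (free_algebra {1..g} Quot I)
              (free_skew_field_height X' (tuple_height {1..g} X' r))
              (\<lambda>p. I +>\<^bsub>free_algebra {1..g}\<^esub> p)
              (poly_ratfun X')
          \<longrightarrow> grr {1..g} I \<and> nullstellensatz_property {1..g} I)
       \<and> (grr {1..g} I \<and> nullstellensatz_property {1..g} I
          \<longrightarrow> embeds_into_free_skew_field {1..g} I)"
  using frr_imp_grr_nullstellensatz[OF finite_atLeastAtMost assms] grr_nullstellensatz_embeds[OF assms]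
  by blast

end
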